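(* Let $D<0$ be a fundamental discriminant and let $\mathfrak z=\mathfrak z_D$. Then there exist a number field $K$, non-zero complex constants $\kappa_{\mathfrak z},\lambda_{\mathfrak z}$ and polynomials $a_1(t),a_2(t),a_3(t),a_4(t)\in\mathcal O_K[t]$ (all depending on $\mathfrak z$) such that $$c_{\mathfrak z}(\Delta,m)=\kappa_{\mathfrak z}\,\frac{\lambda_{\mathfrak z}^m}{m!}\,q_{m,\mathfrak z}(0)\qquad (m\ge 0),$$ where $q_{m,\mathfrak z}(t)\in\mathcal O_K[t]$ are defined recursively by $q_{0,\mathfrak z}(t)=1$, $q_{1,\mathfrak z}(t)=a_1(t)$ and, for $n\ge1$, $$q_{n+1,\mathfrak z}(t)=(a_1(t)+n\,a_2(t))\,q_{n,\mathfrak z}(t)+a_3(t)\,q'_{n,\mathfrak z}(t)+n(n+11)\,a_4(t)\,q_{n-1,\mathfrak z}(t).$$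
   Context: $\mathbb H$ is the upper half-plane, $\Delta(z)=q\prod_{n\ge1}(1-q^n)^{24}$ with $q=e^{2\pi i z}$ is Ramanujan's cusp form of weight $12$ for $\mathrm{SL}(2,\mathbb Z)$. A negative fundamental discriminant is $D<0$ with $D\equiv1\bmod 4$ squarefree, or $D=4m$ with $m\equiv 2,3\bmod 4$ squarefree; $\mathfrak z_D=\sqrt D/2$ if $D$ is even and $\mathfrak z_D=(1+\sqrt D)/2$ if $D$ is odd. For $z_0=\alpha+i\beta\in\mathbb H$ put $\sigma_{z_0}=\frac{1}{2i\beta}\begin{pmatrix}-\overline{z_0}&z_0\\-1&1\end{pmatrix}$, a biholomorphism from the unit disc onto $\mathbb H$ with $\sigma_{z_0}0=z_0$. For $\gamma=\begin{pmatrix}a&b\\c&d\end{pmatrix}\in\mathrm{GL}(2,\mathbb C)$ and even $k$, $(f|_k\gamma)(z)=\det(\gamma)^{k/2}f(\gamma z)(cz+d)^{-k}$. For holomorphic $f$ on $\mathbb H$ of weight $k$, the numbers $c_{z_0}(f,n)$ are defined by the Taylor expansion $(f|_k\sigma_{z_0})(z)=\sum_{n\ge0}c_{z_0}(f,n)z^n$ on the unit disc. *)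

theory Defs
  imports
    "HOL-Complex_Analysis.Complex_Analysis"
    "HOL-Computational_Algebra.Computational_Algebra"
begin

definition neg_fundamental_discriminant :: "int \<Rightarrow> bool" where
  "neg_fundamental_discriminant D \<longleftrightarrow> D < 0 \<and>
     ((D mod 4 = 1 \<and> squarefree D) \<or>
      (\<exists>m. D = 4 * m \<and> m mod 4 \<in> {2, 3} \<and> squarefree m))"

text \<open>For \<open>D < 0\<close>, \<^const>\<open>csqrt\<close> gives the square root of \<open>D\<close> in the upper half-plane.\<close>
definition cm_point :: "int \<Rightarrow> complex" where
  "cm_point D = (if even D then csqrt (of_int D) / 2 else (1 + csqrt (of_int D)) / 2)"

text \<open>Meaningful for \<open>Im z > 0\<close> only.\<close>
definition Ramanujan_Delta :: "complex \<Rightarrow> complex" where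
  "Ramanujan_Delta z =
     (let q = exp (2 * of_real pi * \<i> * z) in q * (\<Prod>n. (1 - q ^ Suc n) ^ 24))"

text \<open>For even \<open>k\<close> only, so that \<open>k div 2\<close> is exact.\<close>
definition slash :: "int \<Rightarrow> (complex \<Rightarrow> complex) \<Rightarrow> complex^2^2 \<Rightarrow> complex \<Rightarrow> complex" where
  "slash k f \<gamma> z =
     det \<gamma> powi (k div 2) * f (moebius (\<gamma>$1$1) (\<gamma>$1$2) (\<gamma>$2$1) (\<gamma>$2$2) z)
       * (\<gamma>$2$1 * z + \<gamma>$2$2) powi (-k)"

definition disc_to_halfplane :: "complex \<Rightarrow> complex^2^2" where
  "disc_to_halfplane z0 =
     (let s = 1 / (2 * \<i> * of_real (Im z0))
      in vector [vector [s * (- cnj z0), s * z0], vector [s * (-1), s * 1]])"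

definition taylor_coeff :: "int \<Rightarrow> complex \<Rightarrow> (complex \<Rightarrow> complex) \<Rightarrow> nat \<Rightarrow> complex" where
  "taylor_coeff k z0 f n = fps_nth (fps_expansion (slash k f (disc_to_halfplane z0)) 0) n"

text \<open>Subfields of the complex numbers of finite degree over the rationals; every abstract
  number field is isomorphic to one of these.\<close>
definition number_field :: "complex set \<Rightarrow> bool" where
  "number_field K \<longleftrightarrow>
     1 \<in> K \<and> (\<forall>x\<in>K. \<forall>y\<in>K. x - y \<in> K \<and> x * y \<in> K) \<and> (\<forall>x\<in>K. inverse x \<in> K) \<and>
     (\<exists>B. finite B \<and> K = module.span (\<lambda>(r::rat) x. of_rat r * x) B)"

definition ring_of_integers :: "complex set \<Rightarrow> complex set" where
  "ring_of_integers K = {x \<in> K. algebraic_int x}"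

definition polys_over :: "complex set \<Rightarrow> complex poly set" where
  "polys_over R = {p. \<forall>i. coeff p i \<in> R}"

lemma Im_cm_point_pos: "D < 0 \<Longrightarrow> Im (cm_point D) > 0"
  by (auto simp: cm_point_def)

lemma disc_to_halfplane_nth [simp]:
  "disc_to_halfplane z0 $ 1 $ 1 = - cnj z0 / (2 * \<i> * of_real (Im z0))"
  "disc_to_halfplane z0 $ 1 $ 2 = z0 / (2 * \<i> * of_real (Im z0))"
  "disc_to_halfplane z0 $ 2 $ 1 = - 1 / (2 * \<i> * of_real (Im z0))"
  "disc_to_halfplane z0 $ 2 $ 2 = 1 / (2 * \<i> * of_real (Im z0))"
  by (simp_all add: disc_to_halfplane_def Let_def)

lemma moebius_disc_to_halfplane:
  assumes "Im z0 > 0"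
  shows "moebius (disc_to_halfplane z0 $ 1 $ 1) (disc_to_halfplane z0 $ 1 $ 2)
           (disc_to_halfplane z0 $ 2 $ 1) (disc_to_halfplane z0 $ 2 $ 2) z
         = (z0 - cnj z0 * z) / (1 - z)"
proof -
  define s where "s = 2 * \<i> * complex_of_real (Im z0)"
  have "s \<noteq> 0" using assms by (simp add: s_def)
  have "(- cnj z0 / s * z + z0 / s) / (- 1 / s * z + 1 / s)
      = ((z0 - cnj z0 * z) / s) / ((1 - z) / s)"
    by (simp add: diff_divide_distrib)
  also have "\<dots> = (z0 - cnj z0 * z) / (1 - z)" using \<open>s \<noteq> 0\<close> by simp
  finally show ?thesis by (simp add: moebius_def s_def)
qed

lemma Im_moebius_disc_pos:
  assumes "Im z0 > 0" "norm z < 1"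
  shows "Im ((z0 - cnj z0 * z) / (1 - z)) > 0"
proof -
  have z: "1 - z \<noteq> 0" using assms(2) by auto
  have n: "(Re z)\<^sup>2 + (Im z)\<^sup>2 < 1"
    using assms(2) by (simp add: cmod_def)
  have "Im ((z0 - cnj z0 * z) / (1 - z)) =
      Im z0 * (1 - ((Re z)\<^sup>2 + (Im z)\<^sup>2)) / ((1 - Re z)\<^sup>2 + (Im z)\<^sup>2)"
    by (simp add: Im_divide) (simp add: algebra_simps power2_eq_square)
  moreover have "(1 - Re z)\<^sup>2 + (Im z)\<^sup>2 > 0"
    using z by (metis complex_neq_0 minus_complex.sel one_complex.sel power2_minus diff_0)
  ultimately show ?thesis using assms n by simp
qed

lemma taylor_coeff_sums:
  assumes "Im z0 > 0" and f: "f holomorphic_on {z. Im z > 0}" and z: "norm z < 1"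
  shows "(\<lambda>n. taylor_coeff k z0 f n * z ^ n) sums slash k f (disc_to_halfplane z0) z"
proof -
  let ?F = "slash k f (disc_to_halfplane z0)"
  let ?s = "2 * \<i> * complex_of_real (Im z0)"
  have ne: "1 - w \<noteq> 0" if "w \<in> ball 0 1" for w :: complex using that by auto
  have "(\<lambda>w. det (disc_to_halfplane z0) powi (k div 2) * f ((z0 - cnj z0 * w) / (1 - w))
          * ((1 - w) / ?s) powi (-k)) holomorphic_on ball 0 1"
    using assms(1) ne
    by (intro holomorphic_intros holomorphic_on_compose_gen[OF _ f, unfolded o_def])
       (auto intro!: Im_moebius_disc_pos)
  also have "(\<lambda>w. det (disc_to_halfplane z0) powi (k div 2) * f ((z0 - cnj z0 * w) / (1 - w))
          * ((1 - w) / ?s) powi (-k)) = ?F"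
    unfolding slash_def moebius_disc_to_halfplane[OF assms(1)]
    by (simp add: diff_divide_distrib)
  finally have "?F holomorphic_on ball 0 1" .
  from holomorphic_power_series[OF this, of z] z show ?thesis
    by (simp add: taylor_coeff_def fps_expansion_def)
qed

end

theory Submission
  imports Defs "Jordan_Normal_Form.Char_Poly"
begin

text \<open>
  Pulled back to the disc, with their automorphy factors, \<open>F = \<Delta>\<close>, \<open>P = E\<^sub>2 - 3/(\<pi> y)\<close> (made holomorphic
  in the disc variable), \<open>Q = E\<^sub>4\<close>, \<open>R = E\<^sub>6\<close> satisfy, up to a constant factor \<open>c\<close> of the derivation,
  Ramanujan's system \<open>F' = P F\<close>, \<open>P' = (P\<^sup>2 - Q)/12\<close>, \<open>Q' = (P Q - R)/3\<close>, \<open>R' = (P R - Q\<^sup>2)/2\<close>.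
  Putting \<open>B = (Q/Q(0))\<^bsup>1/2\<^esup>\<close>, \<open>T = R/B\<^sup>3 - R(0)\<close>, \<open>\<phi> = P - P(0) B\<close> (or, if \<open>Q(0) = 0\<close>, the cube root of
  \<open>R/R(0)\<close> and \<open>T = Q/B\<^sup>2\<close>) turns it into a system with polynomial coefficients in \<open>T\<close>, whose
  iterated derivatives of \<open>F\<close> at the origin are \<open>F(0) q\<^sub>n(0)\<close> with \<open>q\<^sub>n\<close> given by a three-term recursion.

  After scaling by a twelfth root of \<open>\<Delta>(z\<^sub>0)\<close>, the values \<open>P(0), Q(0), R(0)\<close> are algebraic. Indeed \<open>z\<^sub>0\<close> is
  fixed by an integral matrix \<open>M\<close> whose determinant \<open>N\<close> is not a square. The functions
  \<open>\<Delta>|M'/\<Delta>\<close> with \<open>det M' = N\<close> form a finite set permuted by the modular group, so the product of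
  \<open>l - \<Delta>|M'/\<Delta>\<close> over this set is a polynomial in \<open>j\<close> with algebraic coefficients; for the value \<open>l\<close> of
  \<open>\<Delta>|M/\<Delta>\<close> at \<open>z\<^sub>0\<close>, which is an algebraic automorphy factor, it is not identically zero (as \<open>N\<close> is not a
  square, no \<open>\<Delta>|M'/\<Delta>\<close> tends to \<open>l\<close> at the cusp) but vanishes at \<open>z\<^sub>0\<close>. Hence \<open>j(z\<^sub>0)\<close> is algebraic. The logarithmic derivative of
  \<open>\<Delta>|M/\<Delta>\<close> at \<open>z\<^sub>0\<close> is an algebraic multiple of \<open>E\<^sub>2 - 3/(\<pi> y)\<close>, and its sixth power over \<open>\<Delta>\<close> is
  integral over the ring of polynomials in \<open>j\<close>. Since \<open>Q(0)\<^sup>3 = j(z\<^sub>0)\<close> and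
  \<open>R(0)\<^sup>2 = j(z\<^sub>0) - 1728\<close> after the scaling, this suffices.
\<close>

section \<open>Algebraic numbers and number fields\<close>

text \<open>Nothing about modular forms is presupposed; the analytic source of everything is the
  inversion law of \<open>eisenstein_E2\<close>, read off from a conditionally convergent double
  series. The law for \<open>Ramanujan_Delta\<close> follows because \<open>eisenstein_E2\<close> is
  its logarithmic derivative. \<open>E4_fun\<close> and \<open>E6_fun\<close> are defined by solving
  the equations for P' and Q' for Q and R: their expansions inherit algebraic coefficients, and only
  the equation for R' needs a proof. That equation and E4^3 - E6^2 = 1728 Delta are reduced to
  weight 0, where the maximum principle forces a function holomorphic at the cusp to be constant.
  The role of B is that of a form of weight 2 with value 1 at the origin: dividing by powers of B
  turns forms into functions of weight 0, hence of T. A form without a zero at the origin is needed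
  for this, whence the two cases; 1728 Delta having no zero excludes a third one. Algebraic values
  yield polynomials over a number field only. Integrality is a matter of scaling: multiplying
  \<open>a1\<close>, \<open>a2\<close>, \<open>a3\<close> by an integer s and \<open>a4\<close> by
  s^2 multiplies the n-th polynomial by s^n, which the constant lambda absorbs.\<close>

interpretation ratv: vector_space "\<lambda>(r::rat) (x::complex). of_rat r * x"
  by unfold_locales (simp_all add: distrib_left distrib_right of_rat_add of_rat_mult mult.assoc)

text \<open>A space spanned by \<open>B\<close> has no more than \<open>card B\<close> independent
  elements, and a linear dependency among powers of \<open>x\<close> is a polynomial equation for
  \<open>x\<close>.\<close>

lemma algebraic_of_power_span:
  fixes x :: complex
  assumes "finite B" "\<And>i. x ^ i \<in> ratv.span B"
  shows "algebraic x"
\<comment> \<open>Dependence is a property of a set, so the powers must be distinct in order to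
  number \<open>card B + 1\<close>. Two equal powers give an equation directly.\<close>
proof (cases "inj_on (\<lambda>i. x ^ i) {..card B}")
  case True
  let ?S = "(\<lambda>i. x ^ i) ` {..card B}"
  have "card ?S = Suc (card B)" using True by (simp add: card_image)
  have "ratv.dependent ?S"
  proof (rule ccontr)
    assume "ratv.independent ?S"
    hence "card ?S \<le> card B" using assms ratv.independent_span_bound[of B ?S] by auto
    thus False using \<open>card ?S = Suc (card B)\<close> by simp
  qed
  then obtain u v where u: "v \<in> ?S" "u v \<noteq> 0" "(\<Sum>w\<in>?S. of_rat (u w) * w) = 0"
    using ratv.dependent_finite[of ?S] by auto
  then obtain k where k: "k \<le> card B" "u (x ^ k) \<noteq> 0" by auto
  define p where "p = (\<Sum>i\<le>card B. monom (of_rat (u (x ^ i)) :: complex) i)"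
  have c: "coeff p i = (if i \<le> card B then of_rat (u (x ^ i)) else 0)" for i
  proof -
    have "(\<Sum>j\<le>card B. coeff (monom (of_rat (u (x ^ j)) :: complex) j) i) =
      (\<Sum>j\<le>card B. if j = i then of_rat (u (x ^ i)) else 0)"
      by (intro sum.cong) auto
    thus ?thesis by (auto simp: p_def coeff_sum)
  qed
  have "poly p x = (\<Sum>i\<le>card B. of_rat (u (x ^ i)) * x ^ i)"
    by (simp add: p_def poly_sum poly_monom)
  also have "\<dots> = 0" using u(3) True by (simp add: sum.reindex)
  finally show ?thesis
    using c k by (intro algebraicI'[of p]) (auto simp: poly_eq_iff)
next
  case False
  then obtain i j where ij: "x ^ i = x ^ j" "i \<noteq> j" by (auto simp: inj_on_def)
  show ?thesis
    using ij by (intro algebraicI'[of "monom 1 i - monom 1 j"])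
      (auto simp: poly_monom poly_eq_iff)
qed

lemma number_field_closed:
  assumes "number_field K"
  shows "0 \<in> K" "1 \<in> K" "x \<in> K \<Longrightarrow> y \<in> K \<Longrightarrow> x + y \<in> K" "x \<in> K \<Longrightarrow> y \<in> K \<Longrightarrow> x - y \<in> K"
    "x \<in> K \<Longrightarrow> y \<in> K \<Longrightarrow> x * y \<in> K" "x \<in> K \<Longrightarrow> inverse x \<in> K" "x \<in> K \<Longrightarrow> - x \<in> K"
    "x \<in> K \<Longrightarrow> y \<in> K \<Longrightarrow> x / y \<in> K" "x \<in> K \<Longrightarrow> x ^ n \<in> K" "of_rat r \<in> K"
proof -
  have m: "x - y \<in> K" "x * y \<in> K" if "x \<in> K" "y \<in> K" for x y
    using assms that unfolding number_field_def by blast+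
  have i: "inverse x \<in> K" if "x \<in> K" for x using assms that by (auto simp: number_field_def)
  show one: "1 \<in> K" using assms by (auto simp: number_field_def)
  show z: "0 \<in> K" using m(1)[OF one one] by simp
  show n: "- x \<in> K" if "x \<in> K" for x using m(1)[OF z that] by simp
  show "x + y \<in> K" if "x \<in> K" "y \<in> K" for x y using m(1)[OF that(1) n[OF that(2)]] by simp
  show "x - y \<in> K" "x * y \<in> K" if "x \<in> K" "y \<in> K" for x y using m that by auto
  show "inverse x \<in> K" if "x \<in> K" for x using i that .
  show "x / y \<in> K" if "x \<in> K" "y \<in> K" for x y using m(2)[OF that(1) i[OF that(2)]]
    by (simp add: divide_inverse)
  show "x ^ n \<in> K" if "x \<in> K" for x n by (induction n) (auto intro: one m that)
  obtain B where "K = ratv.span B" using assms by (auto simp: number_field_def)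
  thus "of_rat r \<in> K" using ratv.span_scale[of 1 B r] one by simp
qed

lemma number_field_algebraic:
  assumes "number_field K" "x \<in> K"
  shows "algebraic x"
proof -
  obtain B where B: "finite B" "K = ratv.span B" using assms by (auto simp: number_field_def)
  show ?thesis
    using number_field_closed(9)[OF assms] B by (intro algebraic_of_power_span[OF B(1)]) auto
qed

text \<open>Inverses come for free: all powers of \<open>x\<close> lie in a finite-dimensional
  space, so \<open>x\<close> is algebraic, and an equation with nonzero constant term writes
  \<open>inverse x\<close> as a rational combination of powers of \<open>x\<close>.\<close>

lemma number_fieldI:
  assumes B: "finite B" "K = ratv.span B" and one: "1 \<in> K"
    and mult: "\<And>x y. x \<in> K \<Longrightarrow> y \<in> K \<Longrightarrow> x * y \<in> K"
  shows "number_field K"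
proof -
  have pw: "x ^ n \<in> K" if "x \<in> K" for x n
    by (induction n) (simp_all add: one mult that)
  have inv: "inverse x \<in> K" if x: "x \<in> K" for x
  proof (cases "x = 0")
    case False
    have "algebraic x" using algebraic_of_power_span[OF B(1) pw[OF x, unfolded B(2)]] .
    from algebraicE'_nonzero[OF this False]
    obtain p where p: "coeff p 0 \<noteq> 0" "poly (map_poly of_int p) x = 0" .
    define r where "r = (\<lambda>i. rat_of_int (coeff p i))"
    have r: "coeff (map_poly of_int p) i = complex_of_rat (r i)" for i by (simp add: r_def)
    have "r 0 \<noteq> 0" using p(1) by (simp add: r_def)
    define P where "P = (\<Sum>i<degree (map_poly complex_of_int p). of_rat (r (Suc i)) * x ^ i)"
    have "0 = (\<Sum>i<Suc (degree (map_poly complex_of_int p)). coeff (map_poly of_int p) i * x ^ i)"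
      using p(2) unfolding poly_altdef lessThan_Suc_atMost by (rule sym)
    also have "\<dots> = of_rat (r 0) + x * P"
      unfolding sum.lessThan_Suc_shift P_def sum_distrib_left r
      by (simp add: mult.left_commute)
    finally have "x * P = - of_rat (r 0)" by (metis add_eq_0_iff)
    hence "inverse x = of_rat (- inverse (r 0)) * P"
      using \<open>r 0 \<noteq> 0\<close> False unfolding of_rat_minus of_rat_inverse by (simp add: field_simps)
    moreover have "P \<in> K"
      unfolding B(2) P_def by (intro ratv.span_sum ratv.span_scale pw[OF x, unfolded B(2)])
    ultimately show ?thesis unfolding B(2) by (simp only: ratv.span_scale)
  next
    case True thus ?thesis unfolding B(2) by (simp add: ratv.span_zero)
  qed
  have diff: "x - y \<in> K" if "x \<in> K" "y \<in> K" for x y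
    using that unfolding B(2) by (rule ratv.span_diff)
  show ?thesis unfolding number_field_def
    by (intro conjI ballI exI[of _ B] B(1) one mult inv diff) (simp_all add: B(2))
qed

text \<open>The products \<open>b * x ^ i\<close> with \<open>i < degree p\<close> span a ring,
  because \<open>p\<close> rewrites \<open>x ^ degree p\<close> through lower powers;
  \<open>number_fieldI\<close> makes it a field. As \<open>p\<close> may be reducible, these
  products can be dependent, but only their span matters.\<close>

lemma number_field_adjoin:
  assumes K: "number_field K" and p: "p \<noteq> 0" "\<And>i. coeff p i \<in> K" "poly p x = 0"
  shows "\<exists>K'. number_field K' \<and> K \<subseteq> K' \<and> x \<in> K'"
proof -
  note KC = number_field_closed[OF K]
  obtain B where B: "finite B" "K = ratv.span B" using K by (auto simp: number_field_def)
  define n where "n = degree p"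
  have n: "n > 0" using p(1,3) n_def by (cases "degree p = 0") (auto elim!: degree_eq_zeroE)
  define L where "L = ratv.span {b * x ^ i |b i. b \<in> B \<and> i < n}"
  have Ladd: "of_rat r * u + v \<in> L" if "u \<in> L" "v \<in> L" for r u v
    using that unfolding L_def by (intro ratv.span_add ratv.span_scale)
  have base: "c * x ^ i \<in> L" if "c \<in> K" "i < n" for c i
    using that(1) unfolding B(2)
  proof (induction rule: ratv.span_induct_alt)
    case base thus ?case by (simp add: L_def ratv.span_zero)
  next
    case (step r b y)
    have "b * x ^ i \<in> L" unfolding L_def using step that by (intro ratv.span_base) auto
    hence "of_rat r * (b * x ^ i) + y * x ^ i \<in> L" by (rule Ladd) (use step(2) in \<open>simp add: L_def\<close>)
    thus ?case by (simp add: algebra_simps)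
  qed
  have Lsum: "(\<Sum>i\<in>I. f i) \<in> L" if "\<And>i. i \<in> I \<Longrightarrow> f i \<in> L" for I and f :: "nat \<Rightarrow> complex"
    using that unfolding L_def by (rule ratv.span_sum)
  have xn: "x ^ n = (\<Sum>i<n. - (coeff p i / coeff p n) * x ^ i)"
  proof -
    have "coeff p n \<noteq> 0" using p n_def by auto
    moreover have "0 = (\<Sum>i<n. coeff p i * x ^ i) + coeff p n * x ^ n"
      using p(3) unfolding poly_altdef n_def by (simp add: lessThan_Suc_atMost[symmetric])
    ultimately have "x ^ n = - (\<Sum>i<n. coeff p i * x ^ i) / coeff p n"
      by (simp add: eq_neg_iff_add_eq_0 field_simps)
    thus ?thesis by (simp add: sum_negf sum_divide_distrib)
  qed
  have xb: "c * x ^ Suc i \<in> L" if "c \<in> K" "i < n" for c i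
  proof (cases "Suc i < n")
    case False
    hence "Suc i = n" using that by simp
    have "c * x ^ n = (\<Sum>i<n. (c * - (coeff p i / coeff p n)) * x ^ i)"
      unfolding xn sum_distrib_left by (intro sum.cong) auto
    also have "\<dots> \<in> L" using that p by (intro Lsum base) (auto intro!: KC)
    finally show ?thesis using \<open>Suc i = n\<close> by simp
  qed (use base that in blast)
  have xL: "x * y \<in> L" if "y \<in> L" for y
    using that unfolding L_def
  proof (induction y rule: ratv.span_induct_alt)
    case base thus ?case by (simp add: ratv.span_zero)
  next
    case (step r b y)
    from step(1) obtain c i where ci: "b = c * x ^ i" "c \<in> B" "i < n" by blast
    have "c \<in> K" using ci B ratv.span_base by auto
    hence "c * x ^ Suc i \<in> L" using xb[of c i] ci by blast
    moreover have "x * b = c * x ^ Suc i" by (simp add: ci)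
    ultimately have "x * b \<in> L" by (simp only:)
    hence "of_rat r * (x * b) + x * y \<in> L" by (rule Ladd) (use step(2) in \<open>simp add: L_def\<close>)
    moreover have "x * (of_rat r * b + y) = of_rat r * (x * b) + x * y" by (simp add: algebra_simps)
    ultimately show ?case unfolding L_def by simp
  qed
  have xpL: "x ^ i * y \<in> L" if "y \<in> L" for y i
    by (induction i) (auto simp: that mult.assoc xL)
  have cL: "c * y \<in> L" if c: "c \<in> K" and "y \<in> L" for y c
    using that(2) unfolding L_def
  proof (induction y rule: ratv.span_induct_alt)
    case base thus ?case by (simp add: ratv.span_zero)
  next
    case (step r b y)
    from step(1) obtain d i where ci: "b = d * x ^ i" "d \<in> B" "i < n" by blast
    have "c * d \<in> K" using c ci B ratv.span_base KC(5) by auto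
    hence "c * d * x ^ i \<in> L" using base[of "c * d" i] ci by blast
    hence "c * b \<in> L" by (simp add: ci mult.assoc)
    hence "of_rat r * (c * b) + c * y \<in> L" by (rule Ladd) (use step(2) in \<open>simp add: L_def\<close>)
    moreover have "c * (of_rat r * b + y) = of_rat r * (c * b) + c * y" by (simp add: algebra_simps)
    ultimately show ?case unfolding L_def by simp
  qed
  have LL: "y * w \<in> L" if y: "y \<in> L" and w: "w \<in> L" for y w
    using y unfolding L_def
  proof (induction y rule: ratv.span_induct_alt)
    case base thus ?case by (simp add: ratv.span_zero)
  next
    case (step r b y)
    from step(1) obtain d i where ci: "b = d * x ^ i" "d \<in> B" "i < n" by blast
    have "d \<in> K" using ci B ratv.span_base by auto
    hence "d * (x ^ i * w) \<in> L" using cL[OF _ xpL[OF w], of d i] by blast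
    hence "b * w \<in> L" by (simp add: ci mult.assoc)
    hence "of_rat r * (b * w) + y * w \<in> L" by (rule Ladd) (use step(2) in \<open>simp add: L_def\<close>)
    moreover have "(of_rat r * b + y) * w = of_rat r * (b * w) + y * w" by (simp add: algebra_simps)
    ultimately show ?case unfolding L_def by simp
  qed
  have "K \<subseteq> L" using base[of _ 0] n by auto
  moreover have "x \<in> L" using xb[of 1 0] KC n by auto
  moreover have "number_field L"
    using B(1) LL \<open>K \<subseteq> L\<close> KC(2)
    by (intro number_fieldI[OF _ L_def] finite_image_set2[of "\<lambda>b. b \<in> B" "\<lambda>i. i < n", simplified]) auto
  ultimately show ?thesis by blast
qed

lemma number_field_Rats: "number_field \<rat>"
proof -
  have "\<rat> = ratv.span {1}" by (auto simp: ratv.span_singleton Rats_def)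
  thus ?thesis by (intro number_fieldI[of "{1}"]) auto
qed

lemma finite_algebraic_number_field:
  assumes "finite S" "\<And>x. x \<in> S \<Longrightarrow> algebraic x"
  shows "\<exists>K. number_field K \<and> S \<subseteq> K"
  using assms
proof (induction S rule: finite_induct)
  case empty thus ?case using number_field_Rats by auto
next
  case (insert x S)
  then obtain K where K: "number_field K" "S \<subseteq> K" by auto
  obtain p where p: "\<And>i. coeff p i \<in> \<rat>" "p \<noteq> 0" "poly p x = 0"
    using insert.prems[of x] by (metis algebraic_altdef insertI1)
  have "coeff p i \<in> K" for i using p(1)[of i] number_field_closed(10)[OF K(1)] by (auto simp: Rats_def)
  from number_field_adjoin[OF K(1) p(2) this p(3)] K show ?case by blast
qed

text \<open>Both numbers lie in one number field, all of whose elements are algebraic.\<close>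

lemma algebraic_add_mult:
  fixes x y :: complex
  assumes "algebraic x" "algebraic y"
  shows algebraic_add: "algebraic (x + y)" and algebraic_mult: "algebraic (x * y)"
    and algebraic_diff: "algebraic (x - y)" and algebraic_divide: "algebraic (x / y)"
proof -
  obtain K where K: "number_field K" "{x, y} \<subseteq> K"
    using finite_algebraic_number_field[of "{x, y}"] assms by auto
  thus "algebraic (x + y)" "algebraic (x * y)" "algebraic (x - y)" "algebraic (x / y)"
    by (simp_all add: number_field_algebraic[OF K(1)] number_field_closed[OF K(1)])
qed

lemma algebraic_power [intro]: "algebraic (x :: complex) \<Longrightarrow> algebraic (x ^ n)"
  by (induction n) (auto intro: algebraic_mult rat_imp_algebraic)

lemma algebraic_numeral [simp]: "algebraic (numeral n :: complex)"
  by (intro rat_imp_algebraic) auto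

lemma algebraic_1 [simp]: "algebraic (1 :: complex)"
  by (intro rat_imp_algebraic) auto

lemma algebraic_sum:
  fixes f :: "'a \<Rightarrow> complex"
  shows "(\<And>i. i \<in> A \<Longrightarrow> algebraic (f i)) \<Longrightarrow> algebraic (sum f A)"
  by (induction A rule: infinite_finite_induct) (auto intro: algebraic_add)

text \<open>The coefficients generate a number field, to which the root is adjoined.\<close>

lemma algebraic_poly_root:
  fixes p :: "complex poly"
  assumes "p \<noteq> 0" "\<And>i. algebraic (coeff p i)" "poly p x = 0"
  shows "algebraic x"
proof -
  have "finite (coeff p ` {..degree p})" by simp
  from finite_algebraic_number_field[OF this] assms(2)
  obtain K where K: "number_field K" "coeff p ` {..degree p} \<subseteq> K" by blast
  have "coeff p i \<in> K" for i
  proof (cases "i \<le> degree p")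
    case True thus ?thesis using K(2) by blast
  qed (simp add: coeff_eq_0 number_field_closed(1)[OF K(1)])
  from number_field_adjoin[OF K(1) assms(1) this assms(3)]
  show ?thesis by (auto intro: number_field_algebraic)
qed

lemma algebraic_poly:
  fixes p :: "complex poly"
  assumes "\<And>i. algebraic (coeff p i)" "algebraic x"
  shows "algebraic (poly p x)"
  unfolding poly_altdef by (intro algebraic_sum algebraic_mult algebraic_power assms)

section \<open>Algebraic integers: clearing denominators, sums and products\<close>

text \<open>The leading coefficient \<open>a\<close> of an integral equation of degree
  \<open>d\<close> is a denominator: \<open>a ^ (d - 1) * p(x)\<close> is a monic integral
  polynomial in \<open>a * x\<close>.\<close>

lemma algebraic_imp_mult_algebraic_int:
  fixes x :: complex
  assumes "algebraic x"
  shows "\<exists>n::int. n > 0 \<and> algebraic_int (of_int n * x)"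
proof -
  obtain p where p: "\<And>i. coeff p i \<in> \<int>" "p \<noteq> 0" "poly p x = 0"
    using assms by (auto simp: algebraic_def)
  define d where "d = degree p"
  have "d > 0" using p(2,3) d_def by (cases "degree p = 0") (auto elim!: degree_eq_zeroE)
  obtain a where a: "coeff p d = of_int a" using p(1) by (metis Ints_cases)
  have a0: "a \<noteq> 0" using p(2) a d_def by (metis leading_coeff_0_iff of_int_0)
  define q where "q = (\<Sum>i<d. monom (coeff p i * of_int a ^ (d - 1 - i)) i) + monom 1 d"
  have c: "coeff q i = (if i < d then coeff p i * of_int a ^ (d - 1 - i) else if i = d then 1 else 0)" for i
  proof -
    have "(\<Sum>j<d. coeff (monom (coeff p j * of_int a ^ (d - 1 - j)) j) i) =
      (\<Sum>j<d. if j = i then coeff p i * of_int a ^ (d - 1 - i) else 0)"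
      by (intro sum.cong) auto
    thus ?thesis by (auto simp: q_def coeff_sum)
  qed
  have deg: "degree q = d"
    by (rule antisym[OF degree_le le_degree]) (auto simp: c)
  have "poly q (of_int a * x) = (\<Sum>i<d. coeff p i * of_int a ^ (d - 1) * x ^ i) + of_int a ^ d * x ^ d"
    by (auto simp: q_def poly_sum poly_monom power_mult_distrib mult_ac simp flip: power_add intro!: sum.cong)
  also have "of_int a ^ d * x ^ d = of_int a ^ (d - 1) * (coeff p d * x ^ d)"
    using \<open>d > 0\<close> by (simp add: a power_eq_if)
  also have "(\<Sum>i<d. coeff p i * of_int a ^ (d - 1) * x ^ i) + of_int a ^ (d - 1) * (coeff p d * x ^ d)
      = of_int a ^ (d - 1) * poly p x"
    unfolding poly_altdef d_def by (simp add: lessThan_Suc_atMost[symmetric] sum_distrib_left algebra_simps)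
  also have "\<dots> = 0" using p by simp
  finally have "algebraic_int (of_int a * x)"
    using p(1) by (intro algebraic_int.intros[of q]) (auto simp: c deg intro!: Ints_mult Ints_power)
  hence "algebraic_int (of_int \<bar>a\<bar> * x)"
    by (cases "a \<ge> 0") auto
  thus ?thesis using a0 by (intro exI[of _ "\<bar>a\<bar>"]) auto
qed

text \<open>The vector of the \<open>b i\<close> is an eigenvector of an integer matrix, so
  \<open>x\<close> is a root of its monic characteristic polynomial. The entry \<open>b i0\<close>
  keeps the vector from being zero.\<close>

lemma algebraic_int_of_module:
  fixes x :: complex and b :: "nat \<Rightarrow> complex" and c :: "nat \<Rightarrow> nat \<Rightarrow> int"
  assumes b: "i0 < n" "b i0 \<noteq> 0"
    and x: "\<And>i. i < n \<Longrightarrow> x * b i = (\<Sum>j<n. of_int (c i j) * b j)"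
  shows "algebraic_int x"
proof -
  define A where "A = mat n n (\<lambda>(i,j). c i j)"
  have A: "A \<in> carrier_mat n n" by (simp add: A_def)
  let ?C = "of_int_hom.mat_hom A :: complex mat"
  have C: "?C \<in> carrier_mat n n" using A by simp
  define v where "v = vec n b"
  have v: "v \<in> carrier_vec n" "v \<noteq> 0\<^sub>v n" using b by (auto simp: v_def vec_eq_iff)
  have "?C *\<^sub>v v = x \<cdot>\<^sub>v v"
    using x by (intro eq_vecI) (auto simp: A_def v_def scalar_prod_def atLeast0LessThan)
  hence "eigenvalue ?C x" using v C by (auto simp: eigenvalue_def eigenvector_def)
  hence "poly (char_poly ?C) x = 0" using eigenvalue_root_char_poly[OF C] by simp
  hence "poly (map_poly of_int (char_poly A)) x = 0"
    by (simp add: of_int_hom.char_poly_hom[OF A])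
  moreover have "lead_coeff (char_poly A) = 1" using degree_monic_char_poly[OF A] by simp
  ultimately show ?thesis unfolding algebraic_int_altdef_ipoly by (intro exI[of _ "char_poly A"]) auto
qed

lemma algebraic_int_of_finite_module:
  fixes x :: complex and b :: "'i \<Rightarrow> complex" and c :: "'i \<Rightarrow> 'i \<Rightarrow> int"
  assumes I: "finite I" "i0 \<in> I" "b i0 \<noteq> 0"
    and x: "\<And>i. i \<in> I \<Longrightarrow> x * b i = (\<Sum>j\<in>I. of_int (c i j) * b j)"
  shows "algebraic_int x"
proof -
  obtain h where h: "bij_betw h {0..<card I} I" using ex_bij_betw_nat_finite[OF I(1)] by blast
  hence h': "bij_betw h {..<card I} I" by (simp add: atLeast0LessThan)
  obtain k where k: "k < card I" "h k = i0"
    using h' I(2) unfolding bij_betw_def by (metis image_iff lessThan_iff)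
  show ?thesis
  proof (rule algebraic_int_of_module[of k "card I" "\<lambda>i. b (h i)" x "\<lambda>i j. c (h i) (h j)"])
    fix i assume "i < card I"
    hence "h i \<in> I" using bij_betwE[OF h'] by blast
    thus "x * b (h i) = (\<Sum>j<card I. of_int (c (h i) (h j)) * b (h j))"
      using sum.reindex_bij_betw[OF h', of "\<lambda>j. of_int (c (h i) j) * b j"] x by simp
  qed (use k I in auto)
qed

text \<open>The matrix \<open>c\<close> is the companion matrix of a monic integral equation: all
  rows but the last shift the exponent, the last one reduces \<open>x ^ n\<close>.\<close>

lemma algebraic_int_power_reduce:
  fixes x :: complex
  assumes "algebraic_int x"
  shows "\<exists>n>0. \<exists>c :: nat \<Rightarrow> nat \<Rightarrow> int. \<forall>i<n. x * x ^ i = (\<Sum>j<n. of_int (c i j) * x ^ j)"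
proof -
  obtain p where p: "poly (map_poly of_int p) x = 0" "lead_coeff p = (1::int)"
    using assms unfolding algebraic_int_altdef_ipoly by blast
  define n where "n = degree p"
  have deg: "degree (map_poly of_int p :: complex poly) = n" by (simp add: n_def)
  have n: "n > 0"
  proof (rule ccontr)
    assume "\<not> n > 0"
    then obtain a where "p = [:a:]" by (auto simp: n_def elim: degree_eq_zeroE)
    thus False using p by simp
  qed
  have "0 = (\<Sum>j<n. of_int (coeff p j) * x ^ j) + of_int (coeff p n) * x ^ n"
    using p(1) unfolding poly_altdef deg by (simp add: lessThan_Suc_atMost[symmetric])
  hence xn: "x ^ n = (\<Sum>j<n. of_int (- coeff p j) * x ^ j)"
    using p(2) by (simp add: n_def[symmetric] sum_negf eq_neg_iff_add_eq_0 add.commute)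
  define c where "c = (\<lambda>i j. if Suc i < n then (if j = Suc i then 1 else 0) else - coeff p j)"
  have "x * x ^ i = (\<Sum>j<n. of_int (c i j) * x ^ j)" if "i < n" for i
  proof (cases "Suc i < n")
    case True
    have "(\<Sum>j<n. of_int (c i j) * x ^ j) = (\<Sum>j<n. if j = Suc i then x ^ Suc i else 0)"
      using True by (intro sum.cong) (auto simp: c_def)
    thus ?thesis using True by simp
  next
    case False
    hence "Suc i = n" using that by simp
    hence "x * x ^ i = x ^ n" by auto
    also have "\<dots> = (\<Sum>j<n. of_int (c i j) * x ^ j)" unfolding xn using False by (simp add: c_def)
    finally show ?thesis .
  qed
  thus ?thesis using n by blast
qed

text \<open>The products \<open>x ^ i * y ^ j\<close> span a module stable under \<open>x\<close>
  and \<open>y\<close>. With companion matrices C and D, the product acts by the Kronecker product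
  of C and D, the sum by C (x) 1 + 1 (x) D.\<close>

lemma
  fixes x y :: complex
  assumes "algebraic_int x" "algebraic_int y"
  shows algebraic_int_add: "algebraic_int (x + y)" and algebraic_int_mult: "algebraic_int (x * y)"
proof -
  obtain n c where n: "n > 0" and c: "\<And>i. i < n \<Longrightarrow> x * x ^ i = (\<Sum>j<n. of_int (c i j) * x ^ j)"
    using algebraic_int_power_reduce[OF assms(1)] by blast
  obtain m d where m: "m > 0" and d: "\<And>i. i < m \<Longrightarrow> y * y ^ i = (\<Sum>j<m. of_int (d i j) * y ^ j)"
    using algebraic_int_power_reduce[OF assms(2)] by blast
  let ?I = "{..<n} \<times> {..<m}"
  let ?b = "\<lambda>(i,j). x ^ i * y ^ j"
  have delta: "(\<Sum>j<k. of_int (of_bool (i = j)) * z ^ j) = z ^ i" if "i < k" for i k and z :: complex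
  proof -
    have "(\<Sum>j<k. of_int (of_bool (i = j)) * z ^ j) = (\<Sum>j<k. if j = i then z ^ i else 0)"
      by (intro sum.cong) auto
    thus ?thesis using that by simp
  qed
  have prod: "(\<Sum>i'<n. f i' * x ^ i') * (\<Sum>j'<m. g j' * y ^ j') =
      (\<Sum>k\<in>?I. (f (fst k) * g (snd k)) * ?b k)" for f g :: "nat \<Rightarrow> complex"
    unfolding sum_product sum.cartesian_product by (intro sum.cong) auto
  show "algebraic_int (x * y)"
  proof (rule algebraic_int_of_finite_module[of ?I "(0,0)" ?b _ "\<lambda>k l. c (fst k) (fst l) * d (snd k) (snd l)"])
    fix k assume k: "k \<in> ?I"
    hence kn: "fst k < n" and km: "snd k < m" by auto
    have "(x * y) * ?b k = (x * x ^ fst k) * (y * y ^ snd k)" by (simp add: split_beta)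
    also have "\<dots> = (\<Sum>l\<in>?I. of_int (c (fst k) (fst l) * d (snd k) (snd l)) * ?b l)"
      unfolding c[OF kn] d[OF km] prod by simp
    finally show "(x * y) * ?b k = \<dots>" .
  qed (use n m in auto)
  show "algebraic_int (x + y)"
  proof (rule algebraic_int_of_finite_module[of ?I "(0,0)" ?b _
      "\<lambda>k l. c (fst k) (fst l) * of_bool (snd k = snd l) + of_bool (fst k = fst l) * d (snd k) (snd l)"])
    fix k assume k: "k \<in> ?I"
    hence kn: "fst k < n" and km: "snd k < m" by auto
    have "(x + y) * ?b k = (x * x ^ fst k) * y ^ snd k + x ^ fst k * (y * y ^ snd k)"
      by (simp add: split_beta algebra_simps)
    also have "(x * x ^ fst k) * y ^ snd k =
        (\<Sum>l\<in>?I. (of_int (c (fst k) (fst l)) * of_int (of_bool (snd k = snd l))) * ?b l)"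
      using prod[of "\<lambda>i. of_int (c (fst k) i)" "\<lambda>j. of_int (of_bool (snd k = j))"]
      by (simp only: c[OF kn] delta[OF km])
    also have "x ^ fst k * (y * y ^ snd k) =
        (\<Sum>l\<in>?I. (of_int (of_bool (fst k = fst l)) * of_int (d (snd k) (snd l))) * ?b l)"
      using prod[of "\<lambda>i. of_int (of_bool (fst k = i))" "\<lambda>j. of_int (d (snd k) j)"]
      by (simp only: d[OF km] delta[OF kn])
    finally show "(x + y) * ?b k = (\<Sum>l\<in>?I. of_int (c (fst k) (fst l) * of_bool (snd k = snd l) + of_bool (fst k = fst l) * d (snd k) (snd l)) * ?b l)"
      unfolding sum.distrib[symmetric]
      by (simp only: of_int_add of_int_mult distrib_right)
  qed (use n m in auto)
qed

lemma finite_algebraic_common_denominator: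
  fixes S :: "complex set"
  assumes "finite S" "\<And>x. x \<in> S \<Longrightarrow> algebraic x"
  shows "\<exists>n::int. n > 0 \<and> (\<forall>x\<in>S. algebraic_int (of_int n * x))"
  using assms
proof (induction S rule: finite_induct)
  case empty thus ?case by (intro exI[of _ 1]) auto
next
  case (insert x S)
  then obtain n where n: "n > 0" "\<And>x. x \<in> S \<Longrightarrow> algebraic_int (of_int n * x)" by blast
  obtain k where k: "k > 0" "algebraic_int (of_int k * x)"
    using algebraic_imp_mult_algebraic_int insert.prems by blast
  have "algebraic_int (of_int k * (of_int n * y))" if "y \<in> S" for y
    using that by (intro algebraic_int_mult n(2) int_imp_algebraic_int) auto
  moreover have "algebraic_int (of_int n * (of_int k * x))"
    by (rule algebraic_int_mult[OF int_imp_algebraic_int k(2)]) auto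
  ultimately show ?case using n k
    by (intro exI[of _ "k * n"]) (auto simp: mult_ac)
qed

section \<open>The polynomial recursion for solutions of the Ramanujan system\<close>

fun vz_poly :: "complex poly \<Rightarrow> complex poly \<Rightarrow> complex poly \<Rightarrow> complex poly \<Rightarrow> nat \<Rightarrow> complex poly" where
  "vz_poly a1 a2 a3 a4 0 = 1"
| "vz_poly a1 a2 a3 a4 (Suc 0) = a1"
| "vz_poly a1 a2 a3 a4 (Suc (Suc n)) =
     (a1 + of_nat (Suc n) * a2) * vz_poly a1 a2 a3 a4 (Suc n) + a3 * pderiv (vz_poly a1 a2 a3 a4 (Suc n))
     + of_nat (Suc n * (Suc n + 11)) * a4 * vz_poly a1 a2 a3 a4 n"

text \<open>The general recursion also covers \<open>n = 0\<close>: the truncated index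
  \<open>n - 1\<close> does no harm because its factor \<open>n * (n + 11)\<close> vanishes, and the
  derivative of 1 is 0.\<close>

lemma vz_poly_Suc:
  "vz_poly a1 a2 a3 a4 (Suc n) = (a1 + of_nat n * a2) * vz_poly a1 a2 a3 a4 n
     + a3 * pderiv (vz_poly a1 a2 a3 a4 n) + of_nat (n * (n + 11)) * a4 * vz_poly a1 a2 a3 a4 (n - 1)"
  by (cases n) auto

text \<open>Coefficients in \<open>c\<^sup>n F\<^sup>(\<^sup>n\<^sup>) = (\<Sum>j\<le>n. vz_coeff n j * (\<phi>/12)\<^bsup>n-j\<^esup> F B\<^sup>j q\<^sub>j(T))\<close>: the expansion of the derivatives
  of a form of weight 12 in its Serre-type derivatives.\<close>
definition vz_coeff :: "nat \<Rightarrow> nat \<Rightarrow> complex" where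
  "vz_coeff n j = of_nat (n choose j) * fact (n + 11) / fact (j + 11)"

lemma fact_add_12: "fact (Suc n + 11) = (12 + of_nat n) * (fact (n + 11) :: complex)"
proof -
  have "Suc n + 11 = Suc (n + 11)" by simp
  thus ?thesis unfolding fact_Suc by (simp only: fact_Suc) simp
qed

lemma vz_coeff_eq_0: "n < j \<Longrightarrow> vz_coeff n j = 0"
  by (simp add: vz_coeff_def)

lemma vz_coeff_self: "vz_coeff n n = 1"
  by (simp add: vz_coeff_def)

text \<open>This is the balance that cancels the terms containing \<open>A\<close> in
  \<open>vz_sum_step\<close>: those from differentiating a power of \<open>\<psi>\<close> against
  those from the last term of the three-term relation.\<close>

lemma vz_coeff_step:
  assumes "i < n"
  shows "vz_coeff n i * of_nat (n - i) = vz_coeff n (Suc i) * of_nat (Suc i * (Suc i + 11))"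
proof -
  have "(n choose i) * (n - i) = (n choose Suc i) * Suc i"
    by (metis binomial_absorb_comp binomial_absorption mult.commute)
  hence c: "of_nat (n choose i) * of_nat (n - i) = (of_nat (n choose Suc i) * of_nat (Suc i) :: complex)"
    by (metis of_nat_mult)
  have f: "fact (Suc i + 11) = (of_nat (Suc i + 11) * fact (i + 11) :: complex)"
    unfolding fact_add_12 by simp
  have "vz_coeff n i * of_nat (n - i) = (of_nat (n choose i) * of_nat (n - i)) * fact (n + 11) / fact (i + 11)"
    by (simp add: vz_coeff_def)
  also have "\<dots> = vz_coeff n (Suc i) * of_nat (Suc i * (Suc i + 11))"
    unfolding c vz_coeff_def f of_nat_mult
    by (simp add: divide_simps del: fact_Suc of_nat_Suc of_nat_add)
  finally show ?thesis .
qed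

lemma vz_coeff_Suc_0: "vz_coeff (Suc n) 0 = vz_coeff n 0 * of_nat (n + 12)"
  unfolding vz_coeff_def fact_add_12 by simp

text \<open>With j = i + 1 the factor n + 13 + i is (n - j) + (12 + 2 j): the exponent brought down
  from \<open>\<psi> ^ (n - j)\<close> plus the weight of the j-th form. The identity is Pascal's
  rule, adjusted by the absorption identity for binomials.\<close>

lemma vz_coeff_Suc_Suc:
  "vz_coeff (Suc n) (Suc i) = vz_coeff n (Suc i) * of_nat (n + 13 + i) + vz_coeff n i"
proof (cases "i \<le> n")
  case True
  have "(n choose i) * (n - i) = (n choose Suc i) * Suc i"
    by (metis binomial_absorb_comp binomial_absorption mult.commute)
  hence "of_nat (n choose i) * of_nat (n - i) = (of_nat (n choose Suc i) * of_nat (Suc i) :: complex)"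
    by (metis of_nat_mult)
  hence c: "of_nat (n choose i) * (of_nat n - of_nat i) = (of_nat (n choose Suc i) * (1 + of_nat i) :: complex)"
    using True by (simp add: of_nat_diff)
  note f = fact_add_12[of i] and g = fact_add_12[of n]
  have nz: "(12 + of_nat i :: complex) \<noteq> 0"
    by (metis Suc_not_Zero add_Suc numeral_eq_Suc of_nat_add of_nat_eq_0_iff of_nat_numeral)
  have "vz_coeff (Suc n) (Suc i) = (of_nat (n choose i) + of_nat (n choose Suc i)) * (12 + of_nat n) *
      (fact (n + 11) / fact (Suc i + 11))"
    unfolding vz_coeff_def g by simp
  also have "(of_nat (n choose i) + of_nat (n choose Suc i)) * (12 + of_nat n) =
      of_nat (n choose Suc i) * (of_nat n + 13 + of_nat i) + of_nat (n choose i) * (12 + of_nat i :: complex)"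
  proof -
    have "(of_nat (n choose i) + of_nat (n choose Suc i)) * (12 + of_nat n) -
      (of_nat (n choose Suc i) * (of_nat n + 13 + of_nat i) + of_nat (n choose i) * (12 + of_nat i)) =
      of_nat (n choose i) * (of_nat n - of_nat i) - (of_nat (n choose Suc i) * (1 + of_nat i) :: complex)"
      by (simp add: algebra_simps)
    thus ?thesis unfolding c by simp
  qed
  also have "\<dots> * (fact (n + 11) / fact (Suc i + 11)) = vz_coeff n (Suc i) * of_nat (n + 13 + i) +
      of_nat (n choose i) * ((12 + of_nat i) * (fact (n + 11) / fact (Suc i + 11)))"
  proof -
    have e: "(x * y + z * v) * X = x * X * y + z * (v * X)" for x y z v X :: complex
      by (simp add: algebra_simps)
    have "vz_coeff n (Suc i) = of_nat (n choose Suc i) * (fact (n + 11) / fact (Suc i + 11))"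
      by (simp add: vz_coeff_def)
    thus ?thesis unfolding e by simp
  qed
  also have "(12 + of_nat i) * (fact (n + 11) / fact (Suc i + 11)) = (fact (n + 11) / fact (i + 11) :: complex)"
    unfolding f using nz by simp
  finally show ?thesis by (simp add: vz_coeff_def)
qed (simp add: vz_coeff_eq_0)

lemma vz_sum_step_aux:
  fixes v :: complex
  shows "v * (m * p * (x\<^sup>2 + A) * fj + (x * p) * (f1 + j * x * fj - l * A * fm)) =
    v * (m + j) * (x * (x * p)) * fj + v * (x * p) * f1 + A * (v * m * p * fj) - A * (v * l * (x * p) * fm)"
  by (simp add: algebra_simps power2_eq_square)

text \<open>The left side is the derivative of the expansion, computed with
  \<open>\<psi>' = \<psi>\<^sup>2 + A\<close> and the three-term rule for the derivative of
  \<open>f j\<close>. Terms with \<open>A\<close> cancel after an index shift, and the remaining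
  ones are collected by the recurrence of \<open>vz_coeff\<close>.\<close>

lemma vz_sum_step:
  fixes f :: "nat \<Rightarrow> complex"
  shows "(\<Sum>j\<le>n. vz_coeff n j * (of_nat (n - j) * \<psi> ^ (n - j - 1) * (\<psi>\<^sup>2 + A) * f j
      + \<psi> ^ (n - j) * (f (Suc j) + of_nat (12 + 2 * j) * \<psi> * f j - of_nat (j * (j + 11)) * A * f (j - 1))))
    = (\<Sum>j\<le>Suc n. vz_coeff (Suc n) j * \<psi> ^ (Suc n - j) * f j)" (is "?L = ?R")
proof -
  let ?X = "\<lambda>j. vz_coeff n j * of_nat (n - j) * \<psi> ^ (n - j - 1) * f j"
  let ?Y = "\<lambda>j. vz_coeff n j * of_nat (j * (j + 11)) * \<psi> ^ (n - j) * f (j - 1)"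
  have A: "(\<Sum>j\<le>n. ?X j) = (\<Sum>j\<le>n. ?Y j)"
  proof (cases n)
    case (Suc m)
    have "(\<Sum>j\<le>n. ?X j) = (\<Sum>j\<le>m. ?X j)" by (simp add: Suc)
    also have "\<dots> = (\<Sum>j\<le>m. ?Y (Suc j))"
      using vz_coeff_step[of _ n] by (intro sum.cong refl) (simp add: Suc)
    also have "\<dots> = (\<Sum>j\<le>n. ?Y j)" unfolding Suc sum.atMost_Suc_shift by simp
    finally show ?thesis .
  qed simp
  let ?Z = "\<lambda>j. vz_coeff n j * of_nat (n + 12 + j) * \<psi> ^ (Suc n - j) * f j"
  have t: "vz_coeff n j * (of_nat (n - j) * \<psi> ^ (n - j - 1) * (\<psi>\<^sup>2 + A) * f j
      + \<psi> ^ (n - j) * (f (Suc j) + of_nat (12 + 2 * j) * \<psi> * f j - of_nat (j * (j + 11)) * A * f (j - 1)))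
      = ?Z j + vz_coeff n j * \<psi> ^ (n - j) * f (Suc j) + A * ?X j - A * ?Y j" if "j \<le> n" for j
  proof (cases "j = n")
    case False
    define p where "p = \<psi> ^ (n - j - 1)"
    have e: "n - j = Suc (n - j - 1)" "Suc n - j = Suc (Suc (n - j - 1))" using False that by auto
    have p: "\<psi> ^ (n - j) = \<psi> * p" "\<psi> ^ (Suc n - j) = \<psi> * (\<psi> * p)"
      unfolding p_def by (subst e, simp only: power_Suc)+
    have "of_nat (n + 12 + j) = (of_nat (n - j) + of_nat (12 + 2 * j) :: complex)"
      unfolding of_nat_add[symmetric] using that by (intro arg_cong[where f = of_nat]) simp
    thus ?thesis unfolding p p_def[symmetric] by (simp only: vz_sum_step_aux)
  qed (simp add: vz_coeff_def algebra_simps)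
  have "?L = (\<Sum>j\<le>n. ?Z j) + (\<Sum>j\<le>n. vz_coeff n j * \<psi> ^ (n - j) * f (Suc j))
      + A * (\<Sum>j\<le>n. ?X j) - A * (\<Sum>j\<le>n. ?Y j)"
    unfolding sum_distrib_left sum.distrib[symmetric] sum_subtractf[symmetric]
    by (intro sum.cong refl t) auto
  also have "\<dots> = (\<Sum>j\<le>Suc n. ?Z j) + (\<Sum>j\<le>n. vz_coeff n j * \<psi> ^ (n - j) * f (Suc j))"
    unfolding A by (simp add: vz_coeff_eq_0)
  also have "\<dots> = ?Z 0 + (\<Sum>j\<le>n. (vz_coeff n (Suc j) * of_nat (n + 13 + j) + vz_coeff n j) * \<psi> ^ (n - j) * f (Suc j))"
  proof -
    have Z: "(\<Sum>j\<le>Suc n. ?Z j) = ?Z 0 + (\<Sum>j\<le>n. ?Z (Suc j))" by (rule sum.atMost_Suc_shift)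
    have "(\<Sum>j\<le>n. ?Z (Suc j)) + (\<Sum>j\<le>n. vz_coeff n j * \<psi> ^ (n - j) * f (Suc j)) =
      (\<Sum>j\<le>n. (vz_coeff n (Suc j) * of_nat (n + 13 + j) + vz_coeff n j) * \<psi> ^ (n - j) * f (Suc j))"
      unfolding sum.distrib[symmetric]
    proof (intro sum.cong refl)
      fix j
      have "n + 12 + Suc j = n + 13 + j" "Suc n - Suc j = n - j" by simp_all
      thus "?Z (Suc j) + vz_coeff n j * \<psi> ^ (n - j) * f (Suc j) =
        (vz_coeff n (Suc j) * of_nat (n + 13 + j) + vz_coeff n j) * \<psi> ^ (n - j) * f (Suc j)"
        by (simp only: distrib_right)
    qed
    thus ?thesis unfolding Z by (simp only: add.assoc)
  qed
  also have "\<dots> = ?R"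
    unfolding sum.atMost_Suc_shift by (simp add: vz_coeff_Suc_0 vz_coeff_Suc_Suc)
  finally show ?thesis .
qed

lemma higher_deriv_vz_poly_aux:
  fixes d :: complex
  shows "F * (B * b) * (q' * (B * a3 * d)) + (F * (k * ((2 * u * B + B * B * a2) * d * b)) + (12 * u + B * a1) * F * d * (B * b)) * q
    = (F * (B * (B * b)) * ((a1 + k * a2) * q + a3 * q' + l * a4 * r) + (12 + 2 * k) * u * (F * (B * b) * q)
       - l * (B * B * a4) * (F * b * r)) * d"
  by (simp add: algebra_simps)

text \<open>The function \<open>F * B ^ n * q\<^sub>n(T)\<close> behaves like a form of weight 12 +
  2 n: its derivative is the next such function, plus (12 + 2 n) \<open>\<phi>\<close>/12 times
  itself, minus n (n + 11) \<open>B\<^sup>2 * a4\<close> times the previous one. The recursion for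
  \<open>vz_poly\<close> is exactly what makes this true. Since \<open>\<phi>\<close> vanishes at
  \<open>w0\<close>, only the top term of the expansion of the n-th derivative survives
  there.\<close>

lemma higher_deriv_vz_poly:
  fixes F \<phi> B T :: "complex \<Rightarrow> complex"
  assumes S: "open S" "w0 \<in> S" and c: "c \<noteq> 0"
    and F: "\<And>w. w \<in> S \<Longrightarrow> (F has_field_derivative (\<phi> w + B w * poly a1 (T w)) * F w / c) (at w)"
    and B: "\<And>w. w \<in> S \<Longrightarrow> (B has_field_derivative (\<phi> w * B w / 6 + (B w)\<^sup>2 * poly a2 (T w)) / c) (at w)"
    and T: "\<And>w. w \<in> S \<Longrightarrow> (T has_field_derivative B w * poly a3 (T w) / c) (at w)"
    and \<phi>: "\<And>w. w \<in> S \<Longrightarrow> (\<phi> has_field_derivative ((\<phi> w)\<^sup>2 / 12 + 12 * (B w)\<^sup>2 * poly a4 (T w)) / c) (at w)"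
    and init: "\<phi> w0 = 0" "B w0 = 1"
  shows "(deriv ^^ n) F w0 = F w0 * poly (vz_poly a1 a2 a3 a4 n) (T w0) / c ^ n"
proof -
  let ?q = "vz_poly a1 a2 a3 a4"
  define f where "f = (\<lambda>n w. F w * B w ^ n * poly (?q n) (T w))"
  define \<psi> where "\<psi> = (\<lambda>w. \<phi> w / 12)"
  define A where "A = (\<lambda>w. (B w)\<^sup>2 * poly a4 (T w))"
  define G where "G = (\<lambda>n w. \<Sum>j\<le>n. vz_coeff n j * \<psi> w ^ (n - j) * f j w)"
  have df: "(f n has_field_derivative (f (Suc n) w + of_nat (12 + 2 * n) * \<psi> w * f n w
      - of_nat (n * (n + 11)) * A w * f (n - 1) w) / c) (at w)" if w: "w \<in> S" for n w
  proof -
    have "(f n has_field_derivative (F w * B w ^ n * (poly (pderiv (?q n)) (T w) * (B w * poly a3 (T w) / c))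
        + (F w * (of_nat n * ((\<phi> w * B w / 6 + (B w)\<^sup>2 * poly a2 (T w)) / c * B w ^ (n - Suc 0)))
        + (\<phi> w + B w * poly a1 (T w)) * F w / c * B w ^ n) * poly (?q n) (T w))) (at w)"
      unfolding f_def
      by (intro DERIV_mult' DERIV_chain'[OF T[OF w]] F[OF w] DERIV_power B[OF w] poly_DERIV)
    also have "F w * B w ^ n * (poly (pderiv (?q n)) (T w) * (B w * poly a3 (T w) / c))
        + (F w * (of_nat n * ((\<phi> w * B w / 6 + (B w)\<^sup>2 * poly a2 (T w)) / c * B w ^ (n - Suc 0)))
        + (\<phi> w + B w * poly a1 (T w)) * F w / c * B w ^ n) * poly (?q n) (T w)
        = (f (Suc n) w + of_nat (12 + 2 * n) * \<psi> w * f n w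
      - of_nat (n * (n + 11)) * A w * f (n - 1) w) / c"
    proof (cases n)
      case 0 thus ?thesis using c by (simp add: f_def \<psi>_def A_def divide_simps) (simp add: algebra_simps)
    next
      case (Suc m)
      have "f (Suc n) w = F w * (B w * (B w * B w ^ m)) * ((poly a1 (T w) + of_nat n * poly a2 (T w)) * poly (?q n) (T w)
          + poly a3 (T w) * poly (pderiv (?q n)) (T w) + of_nat (n * (n + 11)) * poly a4 (T w) * poly (?q m) (T w))"
        unfolding f_def vz_poly_Suc Suc by simp
      moreover have "f n w = F w * (B w * B w ^ m) * poly (?q n) (T w)" "f (n - 1) w = F w * B w ^ m * poly (?q m) (T w)"
        by (simp_all add: f_def Suc)
      moreover have "of_nat (12 + 2 * n) = (12 + 2 * of_nat n :: complex)" by simp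
      moreover have "B w ^ n = B w * B w ^ m" "n - Suc 0 = m" by (simp_all add: Suc)
      moreover have "\<phi> w * B w / 6 = 2 * \<psi> w * B w" "\<phi> w = 12 * \<psi> w" by (simp_all add: \<psi>_def)
      ultimately show ?thesis
        unfolding A_def divide_inverse[of _ c] power2_eq_square by (simp only: higher_deriv_vz_poly_aux)
    qed
    finally show ?thesis .
  qed
  have d\<psi>: "(\<psi> has_field_derivative ((\<psi> w)\<^sup>2 + A w) / c) (at w)" if w: "w \<in> S" for w
  proof -
    have "(\<psi> has_field_derivative (((\<phi> w)\<^sup>2 / 12 + 12 * (B w)\<^sup>2 * poly a4 (T w)) / c) / 12) (at w)"
      unfolding \<psi>_def by (intro DERIV_cdivide \<phi> w)
    also have "(((\<phi> w)\<^sup>2 / 12 + 12 * (B w)\<^sup>2 * poly a4 (T w)) / c) / 12 = ((\<psi> w)\<^sup>2 + A w) / c"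
      using c by (simp add: \<psi>_def A_def field_simps power2_eq_square)
    finally show ?thesis .
  qed
  have dG: "(G n has_field_derivative G (Suc n) w / c) (at w)" if w: "w \<in> S" for n w
  proof -
    have "(G n has_field_derivative (\<Sum>j\<le>n. vz_coeff n j * \<psi> w ^ (n - j) *
          ((f (Suc j) w + of_nat (12 + 2 * j) * \<psi> w * f j w - of_nat (j * (j + 11)) * A w * f (j - 1) w) / c) +
        vz_coeff n j * (of_nat (n - j) * (((\<psi> w)\<^sup>2 + A w) / c * \<psi> w ^ (n - j - Suc 0))) * f j w)) (at w)"
      unfolding G_def by (intro DERIV_sum DERIV_mult' DERIV_cmult DERIV_power df d\<psi> w)
    also have "(\<Sum>j\<le>n. vz_coeff n j * \<psi> w ^ (n - j) *
          ((f (Suc j) w + of_nat (12 + 2 * j) * \<psi> w * f j w - of_nat (j * (j + 11)) * A w * f (j - 1) w) / c) +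
        vz_coeff n j * (of_nat (n - j) * (((\<psi> w)\<^sup>2 + A w) / c * \<psi> w ^ (n - j - Suc 0))) * f j w) =
      (\<Sum>j\<le>n. vz_coeff n j * (of_nat (n - j) * \<psi> w ^ (n - j - 1) * ((\<psi> w)\<^sup>2 + A w) * f j w
      + \<psi> w ^ (n - j) * (f (Suc j) w + of_nat (12 + 2 * j) * \<psi> w * f j w - of_nat (j * (j + 11)) * A w * f (j - 1) w))) / c"
      unfolding sum_divide_distrib using c by (intro sum.cong refl) (simp add: divide_simps, simp add: algebra_simps)
    also have "\<dots> = G (Suc n) w / c"
      using vz_sum_step[of n "\<psi> w" "A w" "\<lambda>j. f j w"] by (simp add: G_def)
    finally show ?thesis .
  qed
  have "(deriv ^^ n) F w = G n w / c ^ n" if "w \<in> S" for n w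
    using that
  proof (induction n arbitrary: w)
    case 0 thus ?case by (simp add: G_def f_def vz_coeff_self)
  next
    case (Suc n)
    have "((\<lambda>w. G n w / c ^ n) has_field_derivative G (Suc n) w / c / c ^ n) (at w)"
      by (intro DERIV_cdivide dG Suc.prems)
    hence "((deriv ^^ n) F has_field_derivative G (Suc n) w / c / c ^ n) (at w)"
      by (rule has_field_derivative_transform_within_open[OF _ S(1) Suc.prems]) (use Suc.IH in auto)
    thus ?case by (simp add: DERIV_imp_deriv mult.commute)
  qed
  \<comment> \<open>As \<open>\<psi> w0 = 0\<close>, every summand with a positive exponent
    \<open>n - j\<close> vanishes, and \<open>vz_coeff n n = 1\<close>.\<close>
  moreover have "G n w0 = f n w0"
  proof -
    have "G n w0 = (\<Sum>j\<le>n. if j = n then f n w0 else 0)"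
      unfolding G_def by (intro sum.cong) (auto simp: \<psi>_def init vz_coeff_self)
    thus ?thesis by simp
  qed
  ultimately show ?thesis using S by (simp add: f_def init)
qed

section \<open>From Ramanujan's system to polynomial coefficients\<close>

text \<open>Near \<open>w0\<close> the values of \<open>u\<close> are close to 1. Shrinking to the
  region where they have positive real part keeps them off the branch cut, so the principal
  logarithm gives a holomorphic root with value 1 at \<open>w0\<close>.\<close>

lemma local_root:
  fixes u u' :: "complex \<Rightarrow> complex"
  assumes S: "open S" "w0 \<in> S" and u: "\<And>w. w \<in> S \<Longrightarrow> (u has_field_derivative u' w) (at w)" and "u w0 = 1" "k > 0"
  obtains S' B where "open S'" "w0 \<in> S'" "S' \<subseteq> S" "B w0 = 1"
    "\<And>w. w \<in> S' \<Longrightarrow> B w \<noteq> 0" "\<And>w. w \<in> S' \<Longrightarrow> B w ^ k = u w"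
    "\<And>w. w \<in> S' \<Longrightarrow> (B has_field_derivative B w * u' w / (of_nat k * u w)) (at w)"
proof -
  define B where "B = (\<lambda>w. exp (Ln (u w) / of_nat k))"
  define S' where "S' = S \<inter> u -` {z. Re z > 0}"
  have "continuous_on S u"
    using u S(1) by (meson DERIV_isCont continuous_at_imp_continuous_on)
  hence "open S'" unfolding S'_def by (intro continuous_open_preimage S open_halfspace_Re_gt)
  have nz: "u w \<noteq> 0" "u w \<notin> \<real>\<^sub>\<le>\<^sub>0" if "w \<in> S'" for w
    using that by (auto simp: S'_def complex_nonpos_Reals_iff)
  show ?thesis
  proof (rule that[of S' B])
    show "B w ^ k = u w" if "w \<in> S'" for w
      using nz[OF that] \<open>k > 0\<close> by (simp add: B_def exp_of_nat_mult[symmetric])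
    show "(B has_field_derivative B w * u' w / (of_nat k * u w)) (at w)" if "w \<in> S'" for w
    proof -
      have "w \<in> S" using that by (simp add: S'_def)
      have "((\<lambda>w. Ln (u w)) has_field_derivative inverse (u w) * u' w) (at w)"
        by (rule DERIV_chain2[OF has_field_derivative_Ln[OF nz(2)[OF that]] u[OF \<open>w \<in> S\<close>]])
      hence "(B has_field_derivative exp (Ln (u w) / of_nat k) * (inverse (u w) * u' w / of_nat k)) (at w)"
        unfolding B_def by (intro DERIV_chain2[OF DERIV_exp] DERIV_cdivide)
      thus ?thesis by (simp add: B_def field_simps)
    qed
  qed (use \<open>open S'\<close> assms in \<open>auto simp: S'_def B_def\<close>)
qed

text \<open>The derivatives of B, T and phi in the two cases. The first three identities substitute
  P = p + P0 B, Q = Q0 B^2, R = (R0 + T) B^3; the last three substitute P = p + P0 B, Q = T B^2, R =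
  R0 B^3. In the derivative of T all terms with P cancel, T having weight 0; in that of phi the
  mixed terms p B cancel.\<close>

lemma ramanujan_system_change_of_variables:
  fixes c :: complex
  assumes "c \<noteq> 0" "B \<noteq> 0"
  shows
   "Q0 \<noteq> 0 \<Longrightarrow> B * (((p + P0 * B) * (Q0 * B\<^sup>2) - (R0 + T) * B ^ 3) / 3 / c / Q0) / (2 * B\<^sup>2) =
     (p * B / 6 + B\<^sup>2 * (P0 / 6 - R0 / (6 * Q0) - T / (6 * Q0))) / c"
   "Q0 \<noteq> 0 \<Longrightarrow> (((p + P0 * B) * ((R0 + T) * B ^ 3) - (Q0 * B\<^sup>2)\<^sup>2) / 2 / c * B ^ 3 -
      (R0 + T) * B ^ 3 * (3 * ((p * B / 6 + B\<^sup>2 * (P0 / 6 - R0 / (6 * Q0) - T / (6 * Q0))) / c * B\<^sup>2))) / (B ^ 3 * B ^ 3)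
      = B * (R0\<^sup>2 / (2 * Q0) - Q0\<^sup>2 / 2 + T * (R0 / Q0 + T * (1 / (2 * Q0)))) / c"
   "Q0 \<noteq> 0 \<Longrightarrow> ((p + P0 * B)\<^sup>2 - Q0 * B\<^sup>2) / 12 / c - P0 * ((p * B / 6 + B\<^sup>2 * (P0 / 6 - R0 / (6 * Q0) - T / (6 * Q0))) / c)
      = (p\<^sup>2 / 12 + 12 * B\<^sup>2 * ((P0\<^sup>2 - Q0) / 144 - P0 * (P0 / 6 - R0 / (6 * Q0)) / 12 + T * (P0 / (72 * Q0)))) / c"
   "R0 \<noteq> 0 \<Longrightarrow> B * (((p + P0 * B) * (R0 * B ^ 3) - (T * B\<^sup>2)\<^sup>2) / 2 / c / R0) / (3 * B ^ 3) =
     (p * B / 6 + B\<^sup>2 * (P0 / 6 - T * (T * (1 / (6 * R0))))) / c"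
   "R0 \<noteq> 0 \<Longrightarrow> (((p + P0 * B) * (T * B\<^sup>2) - R0 * B ^ 3) / 3 / c * B\<^sup>2 -
      T * B\<^sup>2 * (2 * ((p * B / 6 + B\<^sup>2 * (P0 / 6 - T * (T * (1 / (6 * R0))))) / c * B))) / (B\<^sup>2 * B\<^sup>2)
      = B * (- R0 / 3 + T * (T * (T * (1 / (3 * R0))))) / c"
   "R0 \<noteq> 0 \<Longrightarrow> ((p + P0 * B)\<^sup>2 - T * B\<^sup>2) / 12 / c - P0 * ((p * B / 6 + B\<^sup>2 * (P0 / 6 - T * (T * (1 / (6 * R0))))) / c)
      = (p\<^sup>2 / 12 + 12 * B\<^sup>2 * (- (P0\<^sup>2 / 144) + T * (- 1 / 144 + T * (P0 / (72 * R0))))) / c"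
  using assms by (simp_all add: divide_simps) (simp_all add: algebra_simps eval_nat_numeral)

lemma ramanujan_system_vz_poly:
  fixes F P Q R :: "complex \<Rightarrow> complex"
  assumes S: "open S" "w0 \<in> S" and c: "c \<noteq> 0"
    and F: "\<And>w. w \<in> S \<Longrightarrow> (F has_field_derivative P w * F w / c) (at w)"
    and P: "\<And>w. w \<in> S \<Longrightarrow> (P has_field_derivative ((P w)\<^sup>2 - Q w) / 12 / c) (at w)"
    and Q: "\<And>w. w \<in> S \<Longrightarrow> (Q has_field_derivative (P w * Q w - R w) / 3 / c) (at w)"
    and R: "\<And>w. w \<in> S \<Longrightarrow> (R has_field_derivative (P w * R w - (Q w)\<^sup>2) / 2 / c) (at w)"
    and nz: "Q w0 \<noteq> 0 \<or> R w0 \<noteq> 0"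
    and alg: "algebraic (P w0)" "algebraic (Q w0)" "algebraic (R w0)"
  obtains a1 a2 a3 a4 where
    "\<And>i. algebraic (coeff a1 i)" "\<And>i. algebraic (coeff a2 i)"
    "\<And>i. algebraic (coeff a3 i)" "\<And>i. algebraic (coeff a4 i)"
    "\<And>n. (deriv ^^ n) F w0 = F w0 * poly (vz_poly a1 a2 a3 a4 n) 0 / c ^ n"
proof (cases "Q w0 = 0")
  case False
  define P0 where "P0 = P w0"
  define Q0 where "Q0 = Q w0"
  define R0 where "R0 = R w0"
  have Q0: "Q0 \<noteq> 0" using False by (simp add: Q0_def)
  have "((\<lambda>w. Q w / Q0) has_field_derivative (P w * Q w - R w) / 3 / c / Q0) (at w)" if "w \<in> S" for w
    by (intro DERIV_cdivide Q that)
  from local_root[OF S this, of 2] Q0 obtain S' B where S': "open S'" "w0 \<in> S'" "S' \<subseteq> S" and B: "B w0 = 1"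
    "\<And>w. w \<in> S' \<Longrightarrow> B w \<noteq> 0" "\<And>w. w \<in> S' \<Longrightarrow> B w ^ 2 = Q w / Q0"
    "\<And>w. w \<in> S' \<Longrightarrow> (B has_field_derivative B w * ((P w * Q w - R w) / 3 / c / Q0) / (of_nat 2 * (Q w / Q0))) (at w)"
    by (auto simp: Q0_def)
  define p where "p = (\<lambda>w. P w - P0 * B w)"
  define T where "T = (\<lambda>w. R w / B w ^ 3 - R0)"
  \<comment> \<open>The polynomials are the right sides of the change of variables:
    \<open>a2\<close> is P0/6 - (R0 + T)/(6 Q0), \<open>a3\<close> is ((R0 + T)^2/Q0 - Q0^2)/2, and
    12 \<open>a4\<close> is (P0^2 - Q0)/12 - P0 \<open>a2\<close>.\<close>
  define a1 where "a1 = [:P0:]"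
  define a2 where "a2 = [:P0 / 6 - R0 / (6 * Q0), - (1 / (6 * Q0)):]"
  define a3 where "a3 = [:R0\<^sup>2 / (2 * Q0) - Q0\<^sup>2 / 2, R0 / Q0, 1 / (2 * Q0):]"
  define a4 where "a4 = [:(P0\<^sup>2 - Q0) / 144 - P0 * (P0 / 6 - R0 / (6 * Q0)) / 12, P0 / (72 * Q0):]"
  have e: "P w = p w + P0 * B w" "Q w = Q0 * (B w)\<^sup>2" "R w = (R0 + T w) * B w ^ 3" if "w \<in> S'" for w
    using B(2,3)[OF that] Q0 by (simp_all add: p_def T_def)
  have a: "poly a2 t = P0 / 6 - R0 / (6 * Q0) - t / (6 * Q0)" for t by (simp add: a2_def)
  have dB: "(B has_field_derivative (p w * B w / 6 + (B w)\<^sup>2 * (P0 / 6 - R0 / (6 * Q0) - T w / (6 * Q0))) / c) (at w)"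
    if w: "w \<in> S'" for w
    using B(4)[OF w] ramanujan_system_change_of_variables(1)[OF c B(2)[OF w] Q0, of "p w" P0 R0 "T w"] e[OF w] Q0 by simp
  have "(deriv ^^ n) F w0 = F w0 * poly (vz_poly a1 a2 a3 a4 n) (T w0) / c ^ n" for n
  proof (rule higher_deriv_vz_poly[OF S'(1,2) c, where B = B and T = T and \<phi> = p])
    fix w assume w: "w \<in> S'"
    hence "w \<in> S" using S' by auto
    show "(F has_field_derivative (p w + B w * poly a1 (T w)) * F w / c) (at w)"
      using F[OF \<open>w \<in> S\<close>] by (simp add: a1_def p_def mult.commute)
    show "(B has_field_derivative (p w * B w / 6 + (B w)\<^sup>2 * poly a2 (T w)) / c) (at w)"
      unfolding a by (rule dB[OF w])
    have "(T has_field_derivative (((P w * R w - (Q w)\<^sup>2) / 2 / c * B w ^ 3 -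
      R w * (of_nat 3 * ((p w * B w / 6 + (B w)\<^sup>2 * (P0 / 6 - R0 / (6 * Q0) - T w / (6 * Q0))) / c * B w ^ (3 - Suc 0)))) / (B w ^ 3 * B w ^ 3)) - 0) (at w)"
      unfolding T_def by (intro DERIV_diff DERIV_const DERIV_divide R[OF \<open>w \<in> S\<close>] DERIV_power dB[OF w, unfolded T_def])
        (simp add: B(2)[OF w])
    also have "(((P w * R w - (Q w)\<^sup>2) / 2 / c * B w ^ 3 -
      R w * (of_nat 3 * ((p w * B w / 6 + (B w)\<^sup>2 * (P0 / 6 - R0 / (6 * Q0) - T w / (6 * Q0))) / c * B w ^ (3 - Suc 0)))) / (B w ^ 3 * B w ^ 3)) - 0
      = B w * poly a3 (T w) / c"
      using ramanujan_system_change_of_variables(2)[OF c B(2)[OF w] Q0, of "p w" P0 R0 "T w"] e[OF w] by (simp add: a3_def)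
    finally show "(T has_field_derivative B w * poly a3 (T w) / c) (at w)" .
    have "(p has_field_derivative ((P w)\<^sup>2 - Q w) / 12 / c -
        P0 * ((p w * B w / 6 + (B w)\<^sup>2 * (P0 / 6 - R0 / (6 * Q0) - T w / (6 * Q0))) / c)) (at w)"
      using dB[OF w] unfolding p_def by (intro DERIV_diff DERIV_cmult P[OF \<open>w \<in> S\<close>])
    thus "(p has_field_derivative ((p w)\<^sup>2 / 12 + 12 * (B w)\<^sup>2 * poly a4 (T w)) / c) (at w)"
      using ramanujan_system_change_of_variables(3)[OF c B(2)[OF w] Q0, of "p w" P0 R0 "T w"] e[OF w] by (simp add: a4_def)
  qed (simp_all add: p_def B P0_def)
  moreover have "T w0 = 0" by (simp add: T_def R0_def B)
  moreover have "algebraic P0" "algebraic Q0" "algebraic R0" using alg by (simp_all add: P0_def Q0_def R0_def)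
  hence "algebraic (coeff a1 i)" "algebraic (coeff a2 i)" "algebraic (coeff a3 i)" "algebraic (coeff a4 i)" for i
    unfolding a1_def a2_def a3_def a4_def coeff_pCons
    by (auto split: nat.splits intro!: algebraic_add algebraic_diff algebraic_mult algebraic_divide algebraic_power)
  ultimately show ?thesis using that[of a1 a2 a3 a4] by simp
next
  case True
  define P0 where "P0 = P w0"
  define R0 where "R0 = R w0"
  have R0: "R0 \<noteq> 0" using nz True by (simp add: R0_def)
  have "((\<lambda>w. R w / R0) has_field_derivative (P w * R w - (Q w)\<^sup>2) / 2 / c / R0) (at w)" if "w \<in> S" for w
    by (intro DERIV_cdivide R that)
  from local_root[OF S this, of 3] R0 obtain S' B where S': "open S'" "w0 \<in> S'" "S' \<subseteq> S" and B: "B w0 = 1"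
    "\<And>w. w \<in> S' \<Longrightarrow> B w \<noteq> 0" "\<And>w. w \<in> S' \<Longrightarrow> B w ^ 3 = R w / R0"
    "\<And>w. w \<in> S' \<Longrightarrow> (B has_field_derivative B w * ((P w * R w - (Q w)\<^sup>2) / 2 / c / R0) / (of_nat 3 * (R w / R0))) (at w)"
    by (auto simp: R0_def)
  define p where "p = (\<lambda>w. P w - P0 * B w)"
  \<comment> \<open>Here T vanishes at \<open>w0\<close> without a shift, since Q does.\<close>
  define T where "T = (\<lambda>w. Q w / B w ^ 2)"
  define a1 where "a1 = [:P0:]"
  define a2 where "a2 = [:P0 / 6, 0, - (1 / (6 * R0)):]"
  define a3 where "a3 = [:- R0 / 3, 0, 0, 1 / (3 * R0):]"
  define a4 where "a4 = [:- (P0\<^sup>2 / 144), - 1 / 144, P0 / (72 * R0):]"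
  have e: "P w = p w + P0 * B w" "Q w = T w * (B w)\<^sup>2" "R w = R0 * B w ^ 3" if "w \<in> S'" for w
    using B(2,3)[OF that] R0 by (simp_all add: p_def T_def)
  have a: "poly a2 t = P0 / 6 - t * (t * (1 / (6 * R0)))" for t by (simp add: a2_def)
  have dB: "(B has_field_derivative (p w * B w / 6 + (B w)\<^sup>2 * (P0 / 6 - T w * (T w * (1 / (6 * R0))))) / c) (at w)"
    if w: "w \<in> S'" for w
    using B(4)[OF w] ramanujan_system_change_of_variables(4)[OF c B(2)[OF w] R0, of "p w" P0 "T w"] e[OF w] R0 by simp
  have "(deriv ^^ n) F w0 = F w0 * poly (vz_poly a1 a2 a3 a4 n) (T w0) / c ^ n" for n
  proof (rule higher_deriv_vz_poly[OF S'(1,2) c, where B = B and T = T and \<phi> = p])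
    fix w assume w: "w \<in> S'"
    hence "w \<in> S" using S' by auto
    show "(F has_field_derivative (p w + B w * poly a1 (T w)) * F w / c) (at w)"
      using F[OF \<open>w \<in> S\<close>] by (simp add: a1_def p_def mult.commute)
    show "(B has_field_derivative (p w * B w / 6 + (B w)\<^sup>2 * poly a2 (T w)) / c) (at w)"
      unfolding a by (rule dB[OF w])
    have "(T has_field_derivative (((P w * Q w - R w) / 3 / c * B w ^ 2 -
      Q w * (of_nat 2 * ((p w * B w / 6 + (B w)\<^sup>2 * (P0 / 6 - T w * (T w * (1 / (6 * R0))))) / c * B w ^ (2 - Suc 0)))) / (B w ^ 2 * B w ^ 2))) (at w)"
      unfolding T_def by (intro DERIV_divide Q[OF \<open>w \<in> S\<close>] DERIV_power dB[OF w, unfolded T_def])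
        (simp add: B(2)[OF w])
    also have "(((P w * Q w - R w) / 3 / c * B w ^ 2 -
      Q w * (of_nat 2 * ((p w * B w / 6 + (B w)\<^sup>2 * (P0 / 6 - T w * (T w * (1 / (6 * R0))))) / c * B w ^ (2 - Suc 0)))) / (B w ^ 2 * B w ^ 2))
      = B w * poly a3 (T w) / c"
      using ramanujan_system_change_of_variables(5)[OF c B(2)[OF w] R0, of "p w" P0 "T w"] e[OF w] by (simp add: a3_def)
    finally show "(T has_field_derivative B w * poly a3 (T w) / c) (at w)" .
    have "(p has_field_derivative ((P w)\<^sup>2 - Q w) / 12 / c -
        P0 * ((p w * B w / 6 + (B w)\<^sup>2 * (P0 / 6 - T w * (T w * (1 / (6 * R0))))) / c)) (at w)"
      using dB[OF w] unfolding p_def by (intro DERIV_diff DERIV_cmult P[OF \<open>w \<in> S\<close>])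
    thus "(p has_field_derivative ((p w)\<^sup>2 / 12 + 12 * (B w)\<^sup>2 * poly a4 (T w)) / c) (at w)"
      using ramanujan_system_change_of_variables(6)[OF c B(2)[OF w] R0, of "p w" P0 "T w"] e[OF w] by (simp add: a4_def)
  qed (simp_all add: p_def B P0_def)
  moreover have "T w0 = 0" by (simp add: T_def True)
  moreover have "algebraic P0" "algebraic R0" using alg by (simp_all add: P0_def R0_def)
  hence "algebraic (coeff a1 i)" "algebraic (coeff a2 i)" "algebraic (coeff a3 i)" "algebraic (coeff a4 i)" for i
    unfolding a1_def a2_def a3_def a4_def coeff_pCons
    by (auto split: nat.splits intro!: algebraic_add algebraic_diff algebraic_mult algebraic_divide algebraic_power)
  ultimately show ?thesis using that[of a1 a2 a3 a4] by simp
qed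

section \<open>Scaling and integrality of the recursion\<close>

text \<open>The n-th polynomial is isobaric of weight n when \<open>a1\<close>, \<open>a2\<close>,
  \<open>a3\<close> count 1 and \<open>a4\<close> counts 2. This clears denominators at the price of
  a factor \<open>s ^ n\<close>.\<close>

lemma vz_poly_smult:
  "vz_poly (Polynomial.smult s a1) (Polynomial.smult s a2) (Polynomial.smult s a3) (Polynomial.smult (s\<^sup>2) a4) n = Polynomial.smult (s ^ n) (vz_poly a1 a2 a3 a4 n)"
proof (induction n rule: less_induct)
  case (less n)
  show ?case
  proof (cases n)
    case (Suc m)
    have "s ^ Suc m = s * s ^ m" "m \<noteq> 0 \<Longrightarrow> s\<^sup>2 * s ^ (m - 1) = s ^ Suc m"
      by (auto simp: power2_eq_square gr0_conv_Suc)
    thus ?thesis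
      unfolding Suc vz_poly_Suc using less[of m] less[of "m - 1"] Suc
      by (cases m) (simp_all add: pderiv_smult smult_add_right algebra_simps power2_eq_square)
  qed simp
qed

lemma polys_over_vz_poly:
  assumes K: "number_field K" and a: "{a1, a2, a3, a4} \<subseteq> polys_over (ring_of_integers K)"
  shows "vz_poly a1 a2 a3 a4 n \<in> polys_over (ring_of_integers K)"
proof -
  let ?O = "ring_of_integers K"
  have add: "x + y \<in> ?O" and mult: "x * y \<in> ?O" if "x \<in> ?O" "y \<in> ?O" for x y
    using that number_field_closed[OF K] by (auto simp: ring_of_integers_def algebraic_int_add algebraic_int_mult)
  have nat: "of_nat k \<in> ?O" for k
    using number_field_closed(10)[OF K, of "of_nat k"] by (auto simp: ring_of_integers_def intro: int_imp_algebraic_int)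
  have sum: "sum f A \<in> ?O" if "\<And>i. i \<in> A \<Longrightarrow> f i \<in> ?O" for f and A :: "nat set"
    using that nat[of 0] by (induction A rule: infinite_finite_induct) (auto intro: add)
  have padd: "p + q \<in> polys_over ?O" and pmult: "p * q \<in> polys_over ?O"
    if "p \<in> polys_over ?O" "q \<in> polys_over ?O" for p q
    using that by (auto simp: polys_over_def coeff_mult intro!: add mult sum)
  have pnat: "of_nat k \<in> polys_over ?O" for k
    using nat[of 0] nat[of k] by (auto simp: polys_over_def of_nat_poly coeff_pCons split: nat.splits)
  have pder: "pderiv p \<in> polys_over ?O" if "p \<in> polys_over ?O" for p
    using that nat[of "Suc _"] unfolding polys_over_def mem_Collect_eq coeff_pderiv by (metis mult)
  show ?thesis
  proof (induction n rule: less_induct)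
    case (less n)
    show ?case
    proof (cases n)
      case 0 thus ?thesis using pnat[of 1] by simp
    next
      case (Suc m)
      show ?thesis unfolding Suc vz_poly_Suc
        using a less[of m] less[of "m - 1"] Suc
        by (intro padd pmult pnat pder) auto
    qed
  qed
qed

section \<open>A conditionally convergent lattice sum\<close>

text \<open>The product majorant gives absolute summability over all pairs, so the unordered sums
  may be exchanged; what remains is the translation between ordered and unordered sums.\<close>

lemma double_series_swap:
  fixes f :: "nat \<Rightarrow> nat \<Rightarrow> complex"
  assumes a: "summable a" "\<And>n. 0 \<le> a n" and b: "summable b" "\<And>n. 0 \<le> b n"
    and f: "\<And>j k. norm (f j k) \<le> a j * b k"
  shows "\<And>j. summable (f j)" "\<And>k. summable (\<lambda>j. f j k)"
    "summable (\<lambda>j. \<Sum>k. f j k)" "summable (\<lambda>k. \<Sum>j. f j k)"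
    "(\<Sum>j. \<Sum>k. f j k) = (\<Sum>k. \<Sum>j. f j k)"
proof -
  have nj: "summable (\<lambda>k. norm (f j k))" for j
    by (rule summable_comparison_test'[of "\<lambda>k. a j * b k" 0]) (simp_all add: f summable_mult b)
  have nk: "summable (\<lambda>j. norm (f j k))" for k
    by (rule summable_comparison_test'[of "\<lambda>j. a j * b k" 0]) (simp_all add: f summable_mult2[OF a(1)])
  show sj: "summable (f j)" for j by (rule summable_norm_cancel[OF nj])
  show sk: "summable (\<lambda>j. f j k)" for k by (rule summable_norm_cancel[OF nk])
  have bj: "norm (\<Sum>k. f j k) \<le> a j * suminf b" for j
  proof -
    have "norm (\<Sum>k. f j k) \<le> (\<Sum>k. norm (f j k))" by (rule summable_norm[OF nj])
    also have "\<dots> \<le> (\<Sum>k. a j * b k)" by (rule suminf_le[OF f nj summable_mult[OF b(1)]])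
    also have "\<dots> = a j * suminf b" by (rule suminf_mult[OF b(1)])
    finally show ?thesis .
  qed
  have bk: "norm (\<Sum>j. f j k) \<le> suminf a * b k" for k
  proof -
    have "norm (\<Sum>j. f j k) \<le> (\<Sum>j. norm (f j k))" by (rule summable_norm[OF nk])
    also have "\<dots> \<le> (\<Sum>j. a j * b k)" by (rule suminf_le[OF f nk summable_mult2[OF a(1)]])
    also have "\<dots> = suminf a * b k" by (rule suminf_mult2[OF a(1), symmetric])
    finally show ?thesis .
  qed
  have nsj: "summable (\<lambda>j. norm (\<Sum>k. f j k))"
    by (rule summable_comparison_test'[of "\<lambda>j. a j * suminf b" 0]) (simp_all add: bj summable_mult2[OF a(1)])
  have nsk: "summable (\<lambda>k. norm (\<Sum>j. f j k))"
    by (rule summable_comparison_test'[of "\<lambda>k. suminf a * b k" 0]) (simp_all add: bk summable_mult b)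
  show Sj: "summable (\<lambda>j. \<Sum>k. f j k)" by (rule summable_norm_cancel[OF nsj])
  show Sk: "summable (\<lambda>k. \<Sum>j. f j k)" by (rule summable_norm_cancel[OF nsk])
  have ij: "infsum (f j) UNIV = (\<Sum>k. f j k)" for j
    by (rule infsumI[OF norm_summable_imp_has_sum[OF nj summable_sums[OF sj]]])
  have ik: "infsum (\<lambda>j. f j k) UNIV = (\<Sum>j. f j k)" for k
    by (rule infsumI[OF norm_summable_imp_has_sum[OF nk summable_sums[OF sk]]])
  have inj: "infsum (\<lambda>k. norm (f j k)) UNIV = (\<Sum>k. norm (f j k))" for j
    by (rule infsumI[OF norm_summable_imp_has_sum[OF _ summable_sums[OF nj]]]) (simp add: nj)
  have "(\<lambda>x. norm (f (fst x) (snd x))) summable_on (UNIV \<times> UNIV)"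
    unfolding Infinite_Sum.abs_summable_on_Sigma_iff fst_conv snd_conv
  proof (intro conjI ballI)
    show "(\<lambda>k. norm (f j k)) summable_on UNIV" for j
      by (rule norm_summable_imp_summable_on) (use nj in simp)
    have "summable (\<lambda>j. norm (\<Sum>k. norm (f j k)))"
    proof (rule summable_comparison_test'[of "\<lambda>j. a j * suminf b" 0])
      show "norm (norm (\<Sum>k. norm (f j k))) \<le> a j * suminf b" for j
      proof -
        have "(\<Sum>k. norm (f j k)) \<le> (\<Sum>k. a j * b k)" by (rule suminf_le[OF f nj summable_mult[OF b(1)]])
        also have "\<dots> = a j * suminf b" by (rule suminf_mult[OF b(1)])
        finally show ?thesis using suminf_nonneg[OF nj, of j] by simp
      qed
    qed (rule summable_mult2[OF a(1)])
    thus "(\<lambda>j. norm (infsum (\<lambda>k. norm (f j k)) UNIV)) summable_on UNIV"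
      unfolding inj by (intro norm_summable_imp_summable_on) simp
  qed
  hence "(\<lambda>(j, k). f j k) summable_on (UNIV \<times> UNIV)"
    unfolding case_prod_unfold by (rule Infinite_Sum.abs_summable_summable)
  from infsum_swap_banach[OF this]
  have "infsum (\<lambda>j. \<Sum>k. f j k) UNIV = infsum (\<lambda>k. \<Sum>j. f j k) UNIV" unfolding ij ik .
  moreover have "infsum (\<lambda>j. \<Sum>k. f j k) UNIV = (\<Sum>j. \<Sum>k. f j k)"
    by (rule infsumI[OF norm_summable_imp_has_sum[OF nsj summable_sums[OF Sj]]])
  moreover have "infsum (\<lambda>k. \<Sum>j. f j k) UNIV = (\<Sum>k. \<Sum>j. f j k)"
    by (rule infsumI[OF norm_summable_imp_has_sum[OF nsk summable_sums[OF Sk]]])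
  ultimately show "(\<Sum>j. \<Sum>k. f j k) = (\<Sum>k. \<Sum>j. f j k)" by simp
qed

section \<open>Partial fractions of the cotangent and of the inverse squared sine\<close>

text \<open>The logarithmic derivative of the reflection formula of the Gamma function.\<close>

lemma Digamma_reflection:
  fixes w :: complex
  assumes "w \<notin> \<int>"
  shows "Digamma (1 - w) - Digamma w = of_real pi * cos (of_real pi * w) / sin (of_real pi * w)"
proof -
  have Z: "w \<notin> \<int>\<^sub>\<le>\<^sub>0" "1 - w \<notin> \<int>\<^sub>\<le>\<^sub>0"
    using assms by (auto dest!: nonpos_Ints_Int)
  have s: "sin (of_real pi * w) \<noteq> 0"
    using assms by (simp add: sin_eq_0 mult.commute) (metis Ints_of_int)
  have "((\<lambda>w. Gamma w * Gamma (1 - w)) has_field_derivative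
     (Gamma w * Gamma (1 - w) * (Digamma w - Digamma (1 - w)))) (at w)"
    using Z by (auto intro!: derivative_eq_intros simp: algebra_simps)
  hence 1: "((\<lambda>w. of_real pi / sin (of_real pi * w)) has_field_derivative
     (of_real pi / sin (of_real pi * w) * (Digamma w - Digamma (1 - w)))) (at w)"
    by (simp add: Gamma_reflection_complex)
  have 2: "((\<lambda>w. of_real pi / sin (of_real pi * w)) has_field_derivative
     (- (of_real pi * (of_real pi * cos (of_real pi * w))) / (sin (of_real pi * w))\<^sup>2)) (at w)"
    using s by (auto intro!: derivative_eq_intros simp: power2_eq_square)
  have "Digamma (1 - w) - Digamma w = - (sin (of_real pi * w) / of_real pi) *
      (of_real pi / sin (of_real pi * w) * (Digamma w - Digamma (1 - w)))"
    using s by simp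
  also have "\<dots> = of_real pi * cos (of_real pi * w) / sin (of_real pi * w)"
    unfolding DERIV_unique[OF 1 2] using s by (simp add: power2_eq_square)
  finally show ?thesis .
qed

text \<open>Subtracting the Digamma series at \<open>1 + w\<close> from the one at
  \<open>1 - w\<close> pairs the poles at k and -k; the reflection formula evaluates the
  difference.\<close>

lemma cot_partial_fractions:
  fixes w :: complex
  assumes "w \<notin> \<int>"
  shows "(\<lambda>k. 1 / (w + of_nat (Suc k)) + 1 / (w - of_nat (Suc k))) sums
    (of_real pi * cos (of_real pi * w) / sin (of_real pi * w) - 1 / w)"
proof -
  have nz: "w \<noteq> 0" "1 - w \<noteq> 0" "1 + w \<noteq> 0"
    using assms by (auto simp: add_eq_0_iff)
  have s: "(\<lambda>k. inverse (of_nat (Suc k)) - inverse (z + of_nat k)) sums (Digamma z + euler_mascheroni)"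
    if "z \<noteq> 0" for z :: complex
    using summable_sums[OF summable_Digamma[OF that]] by (simp add: Digamma_def)
  from sums_diff[OF s[OF nz(2)] s[OF nz(3)]]
  have "(\<lambda>k. inverse (1 + w + of_nat k) - inverse (1 - w + of_nat k)) sums (Digamma (1 - w) - Digamma (1 + w))"
    by simp
  also have "Digamma (1 - w) - Digamma (1 + w) = of_real pi * cos (of_real pi * w) / sin (of_real pi * w) - 1 / w"
    using Digamma_reflection[OF assms] Digamma_plus1[OF nz(1)] by (simp add: algebra_simps)
  also have "(\<lambda>k. inverse (1 + w + of_nat k) - inverse (1 - w + of_nat k)) =
    (\<lambda>k. 1 / (w + of_nat (Suc k)) + 1 / (w - of_nat (Suc k)))"
  proof
    fix k
    have "w - of_nat (Suc k) = - (1 - w + of_nat k)" by simp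
    thus "inverse (1 + w + of_nat k) - inverse (1 - w + of_nat k) = 1 / (w + of_nat (Suc k)) + 1 / (w - of_nat (Suc k))"
      unfolding inverse_eq_divide by (simp only: divide_minus_right) (simp add: add_ac)
  qed
  finally show ?thesis .
qed

text \<open>The Digamma reflection formula is differentiated once more, and the trigamma series are
  inserted at \<open>1 - w\<close> and \<open>w + 1\<close>.\<close>

lemma sin_partial_fractions:
  fixes w :: complex
  assumes "w \<notin> \<int>"
  shows "(\<lambda>k. 1 / (w + of_nat (Suc k))\<^sup>2 + 1 / (w - of_nat (Suc k))\<^sup>2) sums
    ((of_real pi)\<^sup>2 / (sin (of_real pi * w))\<^sup>2 - 1 / w\<^sup>2)"
proof -
  have nz: "w \<noteq> 0" "1 - w \<noteq> 0" "1 + w \<noteq> 0"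
    using assms by (auto simp: add_eq_0_iff)
  have Z: "w \<notin> \<int>\<^sub>\<le>\<^sub>0" "1 - w \<notin> \<int>\<^sub>\<le>\<^sub>0"
    using assms by (auto dest!: nonpos_Ints_Int)
  have s: "sin (of_real pi * v) \<noteq> 0" if "v \<notin> \<int>" for v :: complex
    using that by (simp add: sin_eq_0 mult.commute) (metis Ints_of_int)
  have "open (- \<int> :: complex set)" by (simp add: open_Compl)
  have 1: "((\<lambda>w. Digamma (1 - w) - Digamma w) has_field_derivative (- Polygamma 1 (1 - w) - Polygamma 1 w)) (at w)"
    using Z by (auto intro!: derivative_eq_intros)
  have "((\<lambda>w. of_real pi * cos (of_real pi * w) / sin (of_real pi * w)) has_field_derivative
      - ((of_real pi)\<^sup>2 / (sin (of_real pi * w))\<^sup>2)) (at w)"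
  proof -
    let ?s = "sin (of_real pi * w)" and ?c = "cos (of_real pi * w)"
    have "((\<lambda>w. of_real pi * cos (of_real pi * w) / sin (of_real pi * w)) has_field_derivative
      (- (of_real pi * of_real pi) * (?s\<^sup>2 + ?c\<^sup>2)) / ?s\<^sup>2) (at w)"
      using s[OF assms] by (auto intro!: derivative_eq_intros simp: power2_eq_square ring_distribs)
    thus ?thesis unfolding sin_cos_squared_add by (simp add: power2_eq_square)
  qed
  hence 2: "((\<lambda>w. Digamma (1 - w) - Digamma w) has_field_derivative
      - ((of_real pi)\<^sup>2 / (sin (of_real pi * w))\<^sup>2)) (at w)"
    by (rule has_field_derivative_transform_within_open[OF _ \<open>open (- \<int>)\<close>])
       (use assms Digamma_reflection in auto)
  have P: "Polygamma 1 (1 - w) + Polygamma 1 (w + 1) = (of_real pi)\<^sup>2 / (sin (of_real pi * w))\<^sup>2 - 1 / w\<^sup>2"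
    using DERIV_unique[OF 1 2] Polygamma_plus1[OF nz(1), of 1]
    by (simp add: power2_eq_square) (simp add: algebra_simps)
  have S: "(\<lambda>k. inverse ((z + of_nat k)\<^sup>2)) sums Polygamma 1 z" if "z \<noteq> 0" for z :: complex
    using summable_sums[OF Polygamma_converges'[OF that, of 2]] by (simp add: Polygamma_def numeral_2_eq_2)
  from sums_add[OF S[OF nz(2)] S[of "w + 1"]] nz
  have "(\<lambda>k. inverse ((1 - w + of_nat k)\<^sup>2) + inverse ((w + 1 + of_nat k)\<^sup>2)) sums
     (Polygamma 1 (1 - w) + Polygamma 1 (w + 1))" by (simp add: add.commute)
  also have "(\<lambda>k. inverse ((1 - w + of_nat k)\<^sup>2) + inverse ((w + 1 + of_nat k)\<^sup>2)) =
     (\<lambda>k. 1 / (w + of_nat (Suc k))\<^sup>2 + 1 / (w - of_nat (Suc k))\<^sup>2)"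
  proof
    fix k
    have "(w - of_nat (Suc k))\<^sup>2 = (1 - w + of_nat k)\<^sup>2" by (simp add: power2_eq_square algebra_simps)
    thus "inverse ((1 - w + of_nat k)\<^sup>2) + inverse ((w + 1 + of_nat k)\<^sup>2) =
      1 / (w + of_nat (Suc k))\<^sup>2 + 1 / (w - of_nat (Suc k))\<^sup>2"
      by (simp add: inverse_eq_divide add_ac)
  qed
  finally show ?thesis unfolding P .
qed

lemma lattice_norm_bound:
  assumes "Im z > 0"
  obtains c where "c > 0" "\<And>x y::real. c * (\<bar>x\<bar> + \<bar>y\<bar>) \<le> norm (of_real x * z + of_real y)"
proof -
  define C where "C = 1 / Im z + 1 + norm z / Im z"
  have C: "C > 0" using assms by (simp add: C_def add_pos_nonneg)
  have "\<bar>x\<bar> + \<bar>y\<bar> \<le> C * norm (of_real x * z + of_real y)" for x y :: real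
  proof -
    let ?w = "of_real x * z + of_real y"
    have "\<bar>x\<bar> * Im z = \<bar>Im ?w\<bar>" using assms by (simp add: abs_mult)
    also have "\<dots> \<le> norm ?w" by (rule abs_Im_le_cmod)
    finally have 1: "\<bar>x\<bar> \<le> norm ?w / Im z" using assms by (simp add: field_simps)
    have "norm (of_real y :: complex) \<le> norm ?w + norm (of_real x * z)"
      using norm_triangle_ineq4[of ?w "of_real x * z"] by simp
    hence "\<bar>y\<bar> \<le> norm ?w + \<bar>x\<bar> * norm z" by (simp add: norm_mult)
    also have "\<dots> \<le> norm ?w + norm ?w / Im z * norm z" by (intro add_mono mult_right_mono 1) auto
    finally show ?thesis using 1 by (simp add: C_def algebra_simps)
  qed
  hence "(1 / C) * (\<bar>x\<bar> + \<bar>y\<bar>) \<le> norm (of_real x * z + of_real y)" for x y :: real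
    using C by (simp add: field_simps)
  thus ?thesis using C by (intro that[of "1 / C"]) auto
qed

lemma summable_inverse_squares: "summable (\<lambda>n. 1 / real (Suc n) ^ 2)"
  using inverse_squares_sums by (auto simp: sums_iff add_ac)

lemma nonreal_not_Ints: "Im w \<noteq> 0 \<Longrightarrow> w \<notin> \<int>"
  by (auto elim!: Ints_cases)

lemma tendsto_inverse_add_of_nat: "(\<lambda>n. 1 / (w + of_nat n)) \<longlonglongrightarrow> (0 :: complex)"
  unfolding inverse_eq_divide[symmetric]
  by (intro filterlim_compose[OF tendsto_inverse_0] tendsto_add_filterlim_at_infinity[OF tendsto_const] tendsto_of_nat)

lemma tendsto_inverse_diff_of_nat: "(\<lambda>n. 1 / (w - of_nat n)) \<longlonglongrightarrow> (0 :: complex)"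
proof -
  have "(\<lambda>n. - (1 / (- w + of_nat n))) \<longlonglongrightarrow> - (0 :: complex)"
    by (intro tendsto_minus tendsto_inverse_add_of_nat)
  moreover have "- (1 / (- w + of_nat n)) = 1 / (w - of_nat n)" for n
    by (simp add: minus_divide_right del: divide_minus_left)
  ultimately show ?thesis by simp
qed

text \<open>In terms of \<open>r = exp (- 2 pi i v)\<close>, of norm below 1, the quotient is i (1 +
  r^n)/(1 - r^n). That the limit is not 0 is the source of the anomalous term in the inversion
  law.\<close>

lemma tendsto_cot:
  assumes "Im v < 0"
  shows "(\<lambda>n. cos (of_real pi * (of_nat n * v)) / sin (of_real pi * (of_nat n * v))) \<longlonglongrightarrow> \<i>"
proof -
  define r where "r = exp (- (2 * of_real pi * \<i> * v))"
  have "norm r < 1" using assms by (simp add: r_def mult_pos_neg)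
  have e: "cos (of_real pi * (of_nat n * v)) / sin (of_real pi * (of_nat n * v)) = \<i> * ((1 + r ^ n) / (1 - r ^ n))" for n
  proof -
    define x where "x = of_real pi * (of_nat n * v)"
    define E where "E = exp (\<i> * x)"
    have E: "E \<noteq> 0" by (simp add: E_def)
    have "r ^ n = exp (- (\<i> * x) + - (\<i> * x))"
      by (simp add: r_def exp_of_nat_mult[symmetric] x_def algebra_simps)
    hence "r ^ n = inverse E * inverse E"
      unfolding exp_add by (simp add: E_def exp_minus)
    moreover have "cos x = (E + inverse E) / 2" "sin x = (E - inverse E) / (2 * \<i>)"
      by (simp_all add: cos_exp_eq sin_exp_eq E_def exp_minus)
    moreover have "E + inverse E = E * (1 + inverse E * inverse E)" "E - inverse E = E * (1 - inverse E * inverse E)"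
      using E by (simp_all add: distrib_left right_diff_distrib mult.assoc[symmetric])
    moreover have "(E * u / 2) / (E * v / (2 * \<i>)) = \<i> * (u / v)" for u v
      using E by (cases "v = 0") (simp_all add: divide_simps)
    ultimately show ?thesis unfolding x_def[symmetric] by simp
  qed
  have "(\<lambda>n. \<i> * ((1 + r ^ n) / (1 - r ^ n))) \<longlonglongrightarrow> \<i> * ((1 + 0) / (1 - 0))"
    using \<open>norm r < 1\<close> by (intro tendsto_intros LIMSEQ_power_zero) auto
  thus ?thesis unfolding e by simp
qed

text \<open>By the partial fractions above, the j-th term is the sum of 1/((j+1) z + n)^2 over all
  integers n: the double series over the rows m > 0, summed along n inside.\<close>

definition inverse_sin2_sum :: "complex \<Rightarrow> complex" where
  "inverse_sin2_sum z = (\<Sum>j. (of_real pi)\<^sup>2 / (sin (of_real pi * (of_nat (Suc j) * z)))\<^sup>2)"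

lemma zeta2_sums: "(\<lambda>n. 1 / (of_nat (Suc n))\<^sup>2) sums ((of_real pi)\<^sup>2 / 6 :: complex)"
proof -
  have "(\<lambda>n. of_real (1 / (real n + 1)\<^sup>2)) sums (of_real (pi\<^sup>2 / 6) :: complex)"
    using inverse_squares_sums by (simp only: sums_of_real_iff) (simp add: add_ac)
  thus ?thesis by (simp add: add_ac)
qed

text \<open>The double series of \<open>1/(m z + n)\<^sup>2\<close> converges only conditionally. Subtracting from each term the telescoping
  \<open>(1/(w - 1) - 1/(w + 1))/2\<close> makes it absolutely convergent, so that the order of summation may be
  exchanged; the limit of the subtracted part yields the anomalous term \<open>\<pi> \<i> z\<close>.\<close>
lemma inverse_sin2_sum_transform:
  assumes z: "Im z > 0"
  shows "inverse_sin2_sum (- 1 / z) = z\<^sup>2 * inverse_sin2_sum z - (of_real pi)\<^sup>2 / 6 - of_real pi * \<i> * z + z\<^sup>2 * ((of_real pi)\<^sup>2 / 6)"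
proof -
  have z0: "z \<noteq> 0" using z by auto
  define t where "t = (\<lambda>w::complex. 1 / w\<^sup>2 - (1 / (w - 1) - 1 / (w + 1)) / 2)"
  \<comment> \<open>Column k collects n = k and n = -k; column 0 holds the single entry n =
    0.\<close>
  define b where "b = (\<lambda>j k. if k = 0 then t (of_nat (Suc j) * z)
      else t (of_nat (Suc j) * z + of_nat k) + t (of_nat (Suc j) * z - of_nat k))"
  \<comment> \<open>The subtracted terms for n = k and n = -k together are half of
    \<open>V (k-1) + V k\<close> minus half of \<open>V k + V (k+1)\<close>, hence telescope in
    k.\<close>
  define V where "V = (\<lambda>n w::complex. 1 / (w + of_nat n) - 1 / (w - of_nat n))"
  define U where "U = (\<lambda>n. \<Sum>j. V n (of_nat (Suc j) * z))"
  have V0: "V 0 w = 0" for w by (simp add: V_def)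
  have b0: "b j 0 = 1 / (of_nat (Suc j) * z)\<^sup>2 + V 1 (of_nat (Suc j) * z) / 2" for j
    by (simp add: b_def t_def V_def diff_divide_distrib)
  have bS: "b j (Suc k) = (1 / (of_nat (Suc j) * z + of_nat (Suc k))\<^sup>2 + 1 / (of_nat (Suc j) * z - of_nat (Suc k))\<^sup>2)
     - ((V k (of_nat (Suc j) * z) + V (Suc k) (of_nat (Suc j) * z)) / 2
        - (V (Suc k) (of_nat (Suc j) * z) + V (Suc (Suc k)) (of_nat (Suc j) * z)) / 2)" for j k
  proof -
    define w where "w = of_nat (Suc j) * z"
    have e: "w + of_nat (Suc k) - 1 = w + of_nat k" "w + of_nat (Suc k) + 1 = w + of_nat (Suc (Suc k))"
      "w - of_nat (Suc k) - 1 = w - of_nat (Suc (Suc k))" "w - of_nat (Suc k) + 1 = w - of_nat k"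
      by simp_all
    show ?thesis unfolding w_def[symmetric] b_def t_def V_def e
      by (simp add: w_def[symmetric] e add_divide_distrib diff_divide_distrib)
  qed
  obtain c where c: "c > 0" "\<And>x y::real. c * (\<bar>x\<bar> + \<bar>y\<bar>) \<le> norm (of_real x * z + of_real y)"
    using lattice_norm_bound[OF z] by blast
  have tb: "norm (t (of_real x * z + of_real y)) \<le> 4 / c ^ 4 * (1 / x\<^sup>2 * (1 / (\<bar>y\<bar> + 1)\<^sup>2))"
    if x: "x \<ge> 1" and y: "y \<in> \<int>" for x y :: real
  proof -
    let ?w = "of_real x * z + of_real y"
    \<comment> \<open>Here \<open>y\<close> being an integer enters: either it is 0, or its absolute
      value is at least 1, and then with \<open>x \<ge> 1\<close> a shift by one at most halves the
      size.\<close>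
    have y1: "x + \<bar>y + s\<bar> \<ge> (x + \<bar>y\<bar>) / 2" if "s = 1 \<or> s = - 1" for s
    proof (cases "y = 0")
      case True thus ?thesis using that x by auto
    next
      case False
      hence "\<bar>y\<bar> \<ge> 1" using y Ints_nonzero_abs_ge1 by blast
      thus ?thesis using that x by (auto simp: abs_if split: if_splits)
    qed
    have n: "norm ?w \<ge> c * (x + \<bar>y\<bar>)" using c(2)[of x y] x by simp
    have n1: "norm (?w + of_real s) \<ge> c * ((x + \<bar>y\<bar>) / 2)" if "s = 1 \<or> s = - 1" for s :: real
    proof -
      have "c * ((x + \<bar>y\<bar>) / 2) \<le> c * (\<bar>x\<bar> + \<bar>y + s\<bar>)"
        using y1[OF that] c(1) x by (intro mult_left_mono) auto
      also have "\<dots> \<le> norm (of_real x * z + of_real (y + s))" by (rule c(2))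
      finally show ?thesis by (simp add: add_ac)
    qed
    have pos: "c * (x + \<bar>y\<bar>) > 0" using c x by (intro mult_pos_pos) auto
    have nz: "?w \<noteq> 0" "?w + 1 \<noteq> 0" "?w - 1 \<noteq> 0"
      using n n1[of 1] n1[of "-1"] pos by auto
    \<comment> \<open>The corrected term decays like the inverse fourth power of the lattice point,
      which can be majorised by a product of two summable factors.\<close>
    have "t ?w = - 1 / (?w\<^sup>2 * ((?w - 1) * (?w + 1)))"
      unfolding t_def using nz by (simp add: divide_simps) (simp add: algebra_simps power2_eq_square)
    hence "norm (t ?w) = 1 / ((norm ?w)\<^sup>2 * (norm (?w - 1) * norm (?w + 1)))"
      by (simp add: norm_divide norm_mult norm_power)
    also have "\<dots> \<le> 1 / ((c * (x + \<bar>y\<bar>))\<^sup>2 * ((c * ((x + \<bar>y\<bar>) / 2)) * (c * ((x + \<bar>y\<bar>) / 2))))"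
    proof (rule frac_le)
      show "0 < (c * (x + \<bar>y\<bar>))\<^sup>2 * ((c * ((x + \<bar>y\<bar>) / 2)) * (c * ((x + \<bar>y\<bar>) / 2)))"
        using c(1) x by (intro mult_pos_pos zero_less_power) auto
      show "(c * (x + \<bar>y\<bar>))\<^sup>2 * ((c * ((x + \<bar>y\<bar>) / 2)) * (c * ((x + \<bar>y\<bar>) / 2)))
          \<le> (norm ?w)\<^sup>2 * (norm (?w - 1) * norm (?w + 1))"
        using n n1[of 1] n1[of "-1"] pos by (intro mult_mono power_mono) auto
    qed auto
    also have "\<dots> = 4 / c ^ 4 * (1 / (x + \<bar>y\<bar>) ^ 4)"
      using c(1) by (simp add: field_simps eval_nat_numeral)
    also have "\<dots> \<le> 4 / c ^ 4 * (1 / (x\<^sup>2 * (\<bar>y\<bar> + 1)\<^sup>2))"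
    proof (intro mult_left_mono divide_left_mono)
      have "x\<^sup>2 * (\<bar>y\<bar> + 1)\<^sup>2 \<le> (x + \<bar>y\<bar>)\<^sup>2 * (x + \<bar>y\<bar>)\<^sup>2"
        using x by (intro mult_mono power_mono) auto
      thus "x\<^sup>2 * (\<bar>y\<bar> + 1)\<^sup>2 \<le> (x + \<bar>y\<bar>) ^ 4" by (simp add: power_add[symmetric])
    qed (use x c in auto)
    finally show ?thesis by simp
  qed
  have bb: "norm (b j k) \<le> (8 / c ^ 4 * (1 / (real (Suc j))\<^sup>2)) * (1 / (real (Suc k))\<^sup>2)" for j k
  proof (cases "k = 0")
    case True
    have "norm (b j k) \<le> 4 / c ^ 4 * (1 / (real (Suc j))\<^sup>2 * 1)"
      using tb[of "real (Suc j)" 0] True by (simp add: b_def)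
    also have "\<dots> \<le> 8 / c ^ 4 * (1 / (real (Suc j))\<^sup>2 * 1)" using c(1) by (intro mult_right_mono divide_right_mono) auto
    finally show ?thesis using True by simp
  next
    case False
    have "norm (b j k) \<le> norm (t (of_nat (Suc j) * z + of_nat k)) + norm (t (of_nat (Suc j) * z - of_nat k))"
      using False by (simp add: b_def norm_triangle_ineq)
    also have "\<dots> \<le> 4 / c ^ 4 * (1 / (real (Suc j))\<^sup>2 * (1 / (real k + 1)\<^sup>2)) + 4 / c ^ 4 * (1 / (real (Suc j))\<^sup>2 * (1 / (real k + 1)\<^sup>2))"
      using tb[of "real (Suc j)" "real k"] tb[of "real (Suc j)" "- real k"]
      by (intro add_mono) simp_all
    finally show ?thesis by (simp add: add_ac)
  qed
  note sw = double_series_swap[OF summable_mult[OF summable_inverse_squares] _ summable_inverse_squares _ bb, simplified]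
  have nInt: "of_nat (Suc j) * z \<notin> \<int>" for j using z by (intro nonreal_not_Ints) simp
  have nInt': "of_nat (Suc k) / z \<notin> \<int>" for k using z by (intro nonreal_not_Ints) (auto simp: Im_divide sum_power2_eq_zero_iff)
  \<comment> \<open>Along a row the subtracted part telescopes away completely, \<open>V k w\<close>
    tending to 0, so rows keep their original sums.\<close>
  have row: "b j sums ((of_real pi)\<^sup>2 / (sin (of_real pi * (of_nat (Suc j) * z)))\<^sup>2)" for j
  proof -
    define w where "w = of_nat (Suc j) * z"
    have "(\<lambda>k. (V k w + V (Suc k) w) / 2) \<longlonglongrightarrow> (0 - 0 + (0 - 0)) / 2"
      unfolding V_def
      by (intro tendsto_intros tendsto_inverse_add_of_nat tendsto_inverse_diff_of_nat
           LIMSEQ_Suc[OF tendsto_inverse_add_of_nat] LIMSEQ_Suc[OF tendsto_inverse_diff_of_nat]) auto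
    from telescope_sums'[OF this]
    have "(\<lambda>k. (V k w + V (Suc k) w) / 2 - (V (Suc k) w + V (Suc (Suc k)) w) / 2) sums (V 1 w / 2)"
      by (simp add: V0)
    from sums_diff[OF sin_partial_fractions[OF nInt, of j] this[unfolded w_def]]
    have "(\<lambda>k. b j (Suc k)) sums ((of_real pi)\<^sup>2 / (sin (of_real pi * w))\<^sup>2 - 1 / w\<^sup>2 - V 1 w / 2)"
      unfolding bS w_def .
    from sums_Suc[OF this] show ?thesis unfolding b0 w_def by (simp add: algebra_simps)
  qed
  \<comment> \<open>Summed down a column, \<open>V\<close> is the cotangent series at the point
    \<open>(k + 1)/z\<close>, divided by z.\<close>
  have U: "(\<lambda>j. V (Suc k) (of_nat (Suc j) * z)) sums
      ((of_real pi * cos (of_real pi * (of_nat (Suc k) * (1 / z))) / sin (of_real pi * (of_nat (Suc k) * (1 / z))) - z / of_nat (Suc k)) / z)" for k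
  proof -
    have "(\<lambda>j. (1 / (of_nat (Suc k) / z + of_nat (Suc j)) + 1 / (of_nat (Suc k) / z - of_nat (Suc j))) / z) sums
      ((of_real pi * cos (of_real pi * (of_nat (Suc k) / z)) / sin (of_real pi * (of_nat (Suc k) / z)) - 1 / (of_nat (Suc k) / z)) / z)"
      by (intro sums_divide cot_partial_fractions nInt')
    also have "(\<lambda>j. (1 / (of_nat (Suc k) / z + of_nat (Suc j)) + 1 / (of_nat (Suc k) / z - of_nat (Suc j))) / z) =
      (\<lambda>j. V (Suc k) (of_nat (Suc j) * z))"
    proof
      fix j
      have "(of_nat (Suc k) / z + of_nat (Suc j)) * z = of_nat (Suc j) * z + of_nat (Suc k)"
        "(of_nat (Suc k) / z - of_nat (Suc j)) * z = - (of_nat (Suc j) * z - of_nat (Suc k))"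
        using z0 by (simp_all add: distrib_right left_diff_distrib del: of_nat_Suc)
      thus "(1 / (of_nat (Suc k) / z + of_nat (Suc j)) + 1 / (of_nat (Suc k) / z - of_nat (Suc j))) / z = V (Suc k) (of_nat (Suc j) * z)"
        unfolding V_def add_divide_distrib divide_divide_eq_left by (simp only: divide_minus_right) simp
    qed
    finally show ?thesis by simp
  qed
  have Usum: "summable (\<lambda>j. V k (of_nat (Suc j) * z))" for k
    using U[of "k - 1"] by (cases k) (auto simp: V0 sums_iff)
  have U0: "U 0 = 0" by (simp add: U_def V0)
  \<comment> \<open>Across the columns the subtracted part does not telescope to 0: the limit
    \<open>pi i / z\<close> is left over, and after multiplication by \<open>z\<^sup>2\<close> it is
    the term \<open>pi i z\<close> of the law.\<close>
  have Ulim: "(\<lambda>k. U (Suc k)) \<longlonglongrightarrow> of_real pi * \<i> / z"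
  proof -
    have "Im (1 / z) < 0" using z by (simp add: Im_divide divide_neg_pos sum_power2_gt_zero_iff)
    from LIMSEQ_Suc[OF tendsto_cot[OF this]]
    have 1: "(\<lambda>k. cos (of_real pi * (of_nat (Suc k) * (1 / z))) / sin (of_real pi * (of_nat (Suc k) * (1 / z)))) \<longlonglongrightarrow> \<i>" .
    have 2: "(\<lambda>k. 1 / (of_nat (Suc k))) \<longlonglongrightarrow> (0::complex)"
      using LIMSEQ_Suc[OF tendsto_inverse_add_of_nat[of 0]] by simp
    have "(\<lambda>k. (of_real pi * (cos (of_real pi * (of_nat (Suc k) * (1 / z))) / sin (of_real pi * (of_nat (Suc k) * (1 / z)))) - z * (1 / of_nat (Suc k))) / z)
        \<longlonglongrightarrow> (of_real pi * \<i> - z * 0) / z"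
      using z0 by (intro tendsto_intros 1 2)
    moreover have "U (Suc k) = (of_real pi * (cos (of_real pi * (of_nat (Suc k) * (1 / z))) / sin (of_real pi * (of_nat (Suc k) * (1 / z)))) - z * (1 / of_nat (Suc k))) / z" for k
      using U[of k] unfolding U_def by (simp add: sums_iff)
    ultimately show ?thesis by simp
  qed
  have "(\<lambda>k. (U k + U (Suc k)) / 2) \<longlonglongrightarrow> (of_real pi * \<i> / z + of_real pi * \<i> / z) / 2"
    using Ulim LIMSEQ_imp_Suc[OF Ulim] by (intro tendsto_intros) auto
  from telescope_sums'[OF this]
  have tele: "(\<lambda>k. (U k + U (Suc k)) / 2 - (U (Suc k) + U (Suc (Suc k))) / 2) sums (U 1 / 2 - of_real pi * \<i> / z)"
    by (simp add: U0 mult.commute)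
  have zz: "(\<lambda>j. 1 / (of_nat (Suc j) * z)\<^sup>2) sums ((of_real pi)\<^sup>2 / 6 / z\<^sup>2)"
    using sums_divide[OF zeta2_sums, of "z\<^sup>2"] by (simp add: power_mult_distrib)
  have col0: "(\<Sum>j. b j 0) = (of_real pi)\<^sup>2 / 6 / z\<^sup>2 + U 1 / 2"
    unfolding b0 using sums_add[OF zz sums_divide[OF summable_sums[OF Usum[of 1]], of 2]]
    by (simp add: U_def sums_iff)
  have colS: "(\<Sum>j. b j (Suc k)) = ((of_real pi)\<^sup>2 / (sin (of_real pi * (of_nat (Suc k) / z)))\<^sup>2 - z\<^sup>2 / (of_nat (Suc k))\<^sup>2) / z\<^sup>2
      - ((U k + U (Suc k)) / 2 - (U (Suc k) + U (Suc (Suc k))) / 2)" for k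
  proof -
    have "(\<lambda>j. (1 / (of_nat (Suc k) / z + of_nat (Suc j))\<^sup>2 + 1 / (of_nat (Suc k) / z - of_nat (Suc j))\<^sup>2) / z\<^sup>2) sums
      (((of_real pi)\<^sup>2 / (sin (of_real pi * (of_nat (Suc k) / z)))\<^sup>2 - 1 / (of_nat (Suc k) / z)\<^sup>2) / z\<^sup>2)"
      by (intro sums_divide sin_partial_fractions nInt')
    also have "(\<lambda>j. (1 / (of_nat (Suc k) / z + of_nat (Suc j))\<^sup>2 + 1 / (of_nat (Suc k) / z - of_nat (Suc j))\<^sup>2) / z\<^sup>2) =
      (\<lambda>j. 1 / (of_nat (Suc j) * z + of_nat (Suc k))\<^sup>2 + 1 / (of_nat (Suc j) * z - of_nat (Suc k))\<^sup>2)"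
    proof
      fix j
      have "(of_nat (Suc k) / z + of_nat (Suc j)) * z = of_nat (Suc j) * z + of_nat (Suc k)"
        "(of_nat (Suc k) / z - of_nat (Suc j)) * z = - (of_nat (Suc j) * z - of_nat (Suc k))"
        using z0 by (simp_all add: distrib_right left_diff_distrib del: of_nat_Suc)
      thus "(1 / (of_nat (Suc k) / z + of_nat (Suc j))\<^sup>2 + 1 / (of_nat (Suc k) / z - of_nat (Suc j))\<^sup>2) / z\<^sup>2
        = 1 / (of_nat (Suc j) * z + of_nat (Suc k))\<^sup>2 + 1 / (of_nat (Suc j) * z - of_nat (Suc k))\<^sup>2"
        unfolding add_divide_distrib divide_divide_eq_left power_mult_distrib[symmetric] by (simp only: power2_minus)
    qed
    finally have A: "(\<lambda>j. 1 / (of_nat (Suc j) * z + of_nat (Suc k))\<^sup>2 + 1 / (of_nat (Suc j) * z - of_nat (Suc k))\<^sup>2) sums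
      (((of_real pi)\<^sup>2 / (sin (of_real pi * (of_nat (Suc k) / z)))\<^sup>2 - z\<^sup>2 / (of_nat (Suc k))\<^sup>2) / z\<^sup>2)"
      by (simp add: power_divide)
    have Us: "(\<lambda>j. V k (of_nat (Suc j) * z)) sums U k" for k
      unfolding U_def by (rule summable_sums[OF Usum])
    have "(\<lambda>j. b j (Suc k)) sums (((of_real pi)\<^sup>2 / (sin (of_real pi * (of_nat (Suc k) / z)))\<^sup>2 - z\<^sup>2 / (of_nat (Suc k))\<^sup>2) / z\<^sup>2
      - ((U k + U (Suc k)) / 2 - (U (Suc k) + U (Suc (Suc k))) / 2))"
      unfolding bS by (intro sums_diff sums_divide sums_add A Us)
    thus ?thesis by (simp add: sums_iff)
  qed
  have X: "(\<Sum>k. \<Sum>j. b j k) = inverse_sin2_sum z"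
    unfolding sw(5)[symmetric] inverse_sin2_sum_def using row by (simp add: sums_iff)
  have "(\<lambda>k. \<Sum>j. b j k) sums inverse_sin2_sum z" using sw(4) X by (simp add: sums_iff)
  hence "(\<lambda>k. \<Sum>j. b j (Suc k)) sums (inverse_sin2_sum z - (\<Sum>j. b j 0))"
    by (subst sums_Suc_iff) simp
  from sums_mult[OF sums_add[OF this tele], of "z\<^sup>2"]
  have "(\<lambda>k. (of_real pi)\<^sup>2 / (sin (of_real pi * (of_nat (Suc k) / z)))\<^sup>2 - z\<^sup>2 / (of_nat (Suc k))\<^sup>2) sums
     (z\<^sup>2 * (inverse_sin2_sum z - ((of_real pi)\<^sup>2 / 6 / z\<^sup>2 + U 1 / 2) + (U 1 / 2 - of_real pi * \<i> / z)))"
    unfolding colS col0 using z0 by simp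
  from sums_add[OF this sums_mult[OF zeta2_sums, of "z\<^sup>2"]]
  have "(\<lambda>k. (of_real pi)\<^sup>2 / (sin (of_real pi * (of_nat (Suc k) / z)))\<^sup>2) sums
     (z\<^sup>2 * (inverse_sin2_sum z - ((of_real pi)\<^sup>2 / 6 / z\<^sup>2 + U 1 / 2) + (U 1 / 2 - of_real pi * \<i> / z)) + z\<^sup>2 * ((of_real pi)\<^sup>2 / 6))"
    by simp
  also have "z\<^sup>2 * (inverse_sin2_sum z - ((of_real pi)\<^sup>2 / 6 / z\<^sup>2 + U 1 / 2) + (U 1 / 2 - of_real pi * \<i> / z)) + z\<^sup>2 * ((of_real pi)\<^sup>2 / 6)
    = z\<^sup>2 * inverse_sin2_sum z - (of_real pi)\<^sup>2 / 6 - of_real pi * \<i> * z + z\<^sup>2 * ((of_real pi)\<^sup>2 / 6)"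
    using z0 by (simp add: field_simps power2_eq_square)
  also have "(\<lambda>k. (of_real pi)\<^sup>2 / (sin (of_real pi * (of_nat (Suc k) / z)))\<^sup>2) =
    (\<lambda>k. (of_real pi)\<^sup>2 / (sin (of_real pi * (of_nat (Suc k) * (- 1 / z))))\<^sup>2)"
    by simp
  finally show ?thesis unfolding inverse_sin2_sum_def by (simp add: sums_iff)
qed

section \<open>Transformation of the product under inversion\<close>

definition euler_prod :: "complex \<Rightarrow> complex" where
  "euler_prod q = (\<Prod>n. 1 - q ^ Suc n)"

lemma convergent_euler_prod:
  assumes "norm (q::complex) < 1"
  shows "convergent_prod (\<lambda>n. 1 - q ^ Suc n)"
proof (rule abs_convergent_prod_imp_convergent_prod)
  have "summable (\<lambda>n. norm q ^ Suc n)"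
    using assms summable_geometric[of "norm q"] by (simp only: summable_Suc_iff) simp
  thus "abs_convergent_prod (\<lambda>n. 1 - q ^ Suc n)"
    unfolding abs_convergent_prod_conv_summable by (simp add: norm_mult norm_power)
qed

lemma power_neq_1: "norm (q::complex) < 1 \<Longrightarrow> q ^ Suc n \<noteq> 1"
  by (metis norm_one norm_power power_Suc_less_one norm_ge_zero order_less_irrefl power_0_Suc less_eq_real_def zero_neq_one norm_eq_zero)

lemma euler_prod_nonzero: "norm q < 1 \<Longrightarrow> euler_prod q \<noteq> 0"
  unfolding euler_prod_def using power_neq_1 by (intro prodinf_nonzero convergent_euler_prod) auto

text \<open>The geometric series in \<open>r\<close> is the majorant. Uniformity serves three
  purposes: holomorphy, limits of Taylor coefficients, and termwise logarithmic
  differentiation.\<close>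

lemma uniform_limit_euler_prod:
  assumes "r < 1"
  shows "uniform_limit (cball 0 r) (\<lambda>N q. \<Prod>n<N. 1 - q ^ Suc n) euler_prod sequentially"
proof (cases "r \<ge> 0")
  case True
  have "uniformly_convergent_on (cball 0 r) (\<lambda>N q::complex. \<Sum>n<N. norm (- (q ^ Suc n)))"
  proof (rule Weierstrass_m_test')
    show "norm (norm (- (q ^ Suc n))) \<le> r ^ Suc n" if "q \<in> cball 0 r" for n and q :: complex
      using that power_mono[of "norm q" r "Suc n"] by (simp add: norm_mult norm_power)
    show "summable (\<lambda>n. r ^ Suc n)"
      using assms True summable_geometric[of r] by (simp only: summable_Suc_iff) simp
  qed
  hence "uniformly_convergent_on (cball 0 r) (\<lambda>N q::complex. \<Prod>n<N. 1 + - (q ^ Suc n))"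
    by (intro uniformly_convergent_on_prod continuous_intros) auto
  then obtain l where l: "uniform_limit (cball 0 r) (\<lambda>N q::complex. \<Prod>n<N. 1 - q ^ Suc n) l sequentially"
    by (auto simp: uniformly_convergent_on_def)
  have "l q = euler_prod q" if "q \<in> cball 0 r" for q
  proof -
    have "(\<lambda>N. \<Prod>n<N. 1 - q ^ Suc n) \<longlonglongrightarrow> l q" by (rule tendsto_uniform_limitI[OF l that])
    moreover have "(\<lambda>N. \<Prod>n<N. 1 - q ^ Suc n) \<longlonglongrightarrow> euler_prod q"
      unfolding euler_prod_def using that assms
      by (intro has_prod_imp_tendsto' convergent_prod_has_prod convergent_euler_prod) auto
    ultimately show ?thesis by (rule LIMSEQ_unique)
  qed
  thus ?thesis by (rule uniform_limit_cong'[THEN iffD1, OF refl _ l])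
next
  case False thus ?thesis by (simp add: uniform_limit_iff cball_empty)
qed

lemma holomorphic_euler_prod: "euler_prod holomorphic_on ball 0 1"
proof (rule holomorphic_uniform_sequence)
  show "(\<lambda>q. \<Prod>n<N. 1 - q ^ Suc n) holomorphic_on ball 0 1" for N
    by (intro holomorphic_intros)
  fix q :: complex assume q: "q \<in> ball 0 1"
  define d where "d = (1 - norm q) / 2"
  have "d > 0" "(1 + norm q) / 2 < 1" using q by (auto simp: d_def)
  moreover have "cball q d \<subseteq> cball 0 ((1 + norm q) / 2)"
  proof
    fix t assume "t \<in> cball q d"
    hence "norm (t - q) \<le> d" by (simp add: dist_norm norm_minus_commute)
    hence "norm t \<le> norm q + d" using norm_triangle_sub[of t q] by simp
    thus "t \<in> cball 0 ((1 + norm q) / 2)" by (simp add: d_def field_simps)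
  qed
  moreover from this \<open>(1 + norm q) / 2 < 1\<close> have "cball q d \<subseteq> ball 0 1" by (force simp: subset_iff)
  ultimately show "\<exists>d>0. cball q d \<subseteq> ball 0 1 \<and>
      uniform_limit (cball q d) (\<lambda>N q. \<Prod>n<N. 1 - q ^ Suc n) euler_prod sequentially"
    using uniform_limit_on_subset[OF uniform_limit_euler_prod] by blast
qed simp

text \<open>The partial products are polynomials with integer coefficients, so the n-th derivative
  at 0 is a limit of integers and hence an integer. Dividing by \<open>fact n\<close> leaves a
  rational number, which is enough for algebraicity.\<close>

lemma fps_nth_euler_prod: "fps_nth (fps_expansion euler_prod 0) n \<in> \<rat>"
proof -
  define p :: "nat \<Rightarrow> complex poly" where "p = (\<lambda>N. \<Prod>n<N. 1 - monom 1 (Suc n))"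
  have Int: "coeff (p N) i \<in> \<int>" for N i
  proof (induction N arbitrary: i)
    case (Suc N)
    show ?case unfolding p_def using Suc[unfolded p_def]
      by (auto simp: coeff_mult intro!: Ints_sum Ints_mult Ints_diff)
  qed (simp add: p_def)
  have d: "(deriv ^^ m) (poly u) = poly ((pderiv ^^ m) u)" for m and u :: "complex poly"
    by (induction m) (auto simp: DERIV_imp_deriv)
  have c: "poly ((pderiv ^^ m) u) 0 = fact m * coeff u m" for m and u :: "complex poly"
  proof (induction m arbitrary: u)
    case (Suc m)
    have "poly ((pderiv ^^ Suc m) u) 0 = poly ((pderiv ^^ m) (pderiv u)) 0"
      by (simp only: funpow_Suc_right o_def)
    thus ?case unfolding Suc by (simp add: coeff_pderiv)
  qed (simp add: poly_0_coeff_0)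
  have "(\<lambda>N. (deriv ^^ n) (poly (p N)) 0) \<longlonglongrightarrow> (deriv ^^ n) euler_prod 0"
  proof (rule higher_deriv_complex_uniform_limit[where A = "ball 0 (1/2)"])
    have "(\<lambda>N q. \<Prod>n<N. 1 - q ^ Suc n) = (\<lambda>N. poly (p N))"
      by (simp add: p_def poly_prod poly_monom fun_eq_iff)
    thus "uniform_limit (ball 0 (1/2)) (\<lambda>N. poly (p N)) euler_prod sequentially"
      using uniform_limit_on_subset[OF uniform_limit_euler_prod[of "1/2"], of "ball 0 (1/2)"] by simp
  qed (auto intro!: always_eventually holomorphic_intros)
  hence "(\<lambda>N. fact n * coeff (p N) n) \<longlonglongrightarrow> (deriv ^^ n) euler_prod 0" unfolding d c .
  hence "(deriv ^^ n) euler_prod 0 \<in> \<int>"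
    by (rule closed_sequentially[OF closed_Ints, rotated])
       (metis Int Ints_mult Ints_of_nat of_nat_fact)
  moreover have "fact n \<in> (\<rat> :: complex set)" by (metis of_nat_fact Rats_of_nat)
  ultimately show ?thesis by (auto simp: fps_expansion_def elim!: Ints_cases intro!: Rats_divide)
qed

section \<open>The Eisenstein series of weight 2 as logarithmic derivative of Delta\<close>

text \<open>The factor 6/pi^2 is 1/zeta(2): the rows m > 0 and m < 0 contribute equally, row 0
  contributes 2 zeta(2), and the total is divided by 2 zeta(2).\<close>

definition eisenstein_E2 :: "complex \<Rightarrow> complex" where
  "eisenstein_E2 z = 1 + 6 * inverse_sin2_sum z / (of_real pi)\<^sup>2"

lemma eisenstein_E2_transform:
  assumes "Im z > 0"
  shows "eisenstein_E2 (- 1 / z) = z\<^sup>2 * eisenstein_E2 z - 6 * \<i> * z / of_real pi"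
  unfolding eisenstein_E2_def inverse_sin2_sum_transform[OF assms]
  by (simp add: field_simps power2_eq_square)

lemma norm_qexp: "Im z > 0 \<Longrightarrow> norm (exp (2 * of_real pi * \<i> * z)) < 1"
  by (simp add: mult_pos_pos)

text \<open>Both sides are the double sum of k q^(j k) over j, k > 0, with the order of summation
  exchanged.\<close>

lemma lambert_series_eq:
  fixes q :: complex
  assumes q: "norm q < 1"
  shows "(\<Sum>k. of_nat (Suc k) * q ^ Suc k / (1 - q ^ Suc k)) = (\<Sum>j. q ^ Suc j / (1 - q ^ Suc j)\<^sup>2)"
proof -
  define f where "f = (\<lambda>j k. of_nat (Suc k) * q ^ (Suc j * Suc k))"
  have bd: "norm (f j k) \<le> norm q ^ j * (real (Suc k) * norm q ^ k)" for j k
  proof -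
    have "norm q ^ (Suc j * Suc k) \<le> norm q ^ (j + k)"
      using q by (intro power_decreasing) auto
    thus ?thesis by (simp add: f_def norm_mult norm_power power_add mult_left_mono algebra_simps
          del: of_nat_Suc mult_Suc mult_Suc_right)
  qed
  have s1: "summable (\<lambda>j. norm q ^ j)" using q by (intro summable_geometric) auto
  have s2: "summable (\<lambda>k. real (Suc k) * norm q ^ k)"
    using geometric_deriv_sums[of "norm q"] q by (auto simp: sums_iff)
  note sw = double_series_swap(5)[OF s1 _ s2 _ bd, simplified]
  have row: "(\<Sum>k. f j k) = q ^ Suc j / (1 - q ^ Suc j)\<^sup>2" for j
  proof -
    have "norm (q ^ Suc j) < 1" using q by (metis norm_power power_Suc_less_one norm_ge_zero power_0_Suc zero_less_one less_eq_real_def)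
    from sums_mult[OF geometric_deriv_sums[OF this], of "q ^ Suc j"]
    have "(\<lambda>k. q ^ Suc j * (of_nat (Suc k) * (q ^ Suc j) ^ k)) sums (q ^ Suc j / (1 - q ^ Suc j)\<^sup>2)" by simp
    moreover have "q ^ Suc j * (of_nat (Suc k) * (q ^ Suc j) ^ k) = f j k" for k
      unfolding f_def power_mult by simp
    ultimately show ?thesis by (simp add: sums_iff)
  qed
  have col: "(\<Sum>j. f j k) = of_nat (Suc k) * q ^ Suc k / (1 - q ^ Suc k)" for k
  proof -
    have "norm (q ^ Suc k) < 1" using q by (metis norm_power power_Suc_less_one norm_ge_zero power_0_Suc zero_less_one less_eq_real_def)
    from sums_mult[OF geometric_sums[OF this], of "of_nat (Suc k) * q ^ Suc k"]
    have "(\<lambda>j. of_nat (Suc k) * q ^ Suc k * (q ^ Suc k) ^ j) sums (of_nat (Suc k) * q ^ Suc k / (1 - q ^ Suc k))" by simp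
    moreover have "of_nat (Suc k) * q ^ Suc k * (q ^ Suc k) ^ j = f j k" for j
    proof -
      have "q ^ (Suc j * Suc k) = q ^ Suc k * (q ^ Suc k) ^ j"
        unfolding power_mult[symmetric] power_add[symmetric] by (intro arg_cong[where f = "power q"]) simp
      thus ?thesis unfolding f_def by (simp only: mult.assoc)
    qed
    ultimately show ?thesis by (simp add: sums_iff)
  qed
  show ?thesis using sw unfolding row col by simp
qed

text \<open>Writing the sine by exponentials gives pi^2/sin^2 = -4 pi^2 q^j/(1 - q^j)^2, whence the
  constant -24 = 6 * (-4).\<close>

lemma eisenstein_E2_lambert:
  assumes z: "Im z > 0"
  defines "q \<equiv> exp (2 * of_real pi * \<i> * z)"
  shows "eisenstein_E2 z = 1 - 24 * (\<Sum>k. of_nat (Suc k) * q ^ Suc k / (1 - q ^ Suc k))"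
proof -
  have s: "(of_real pi)\<^sup>2 / (sin (of_real pi * (of_nat (Suc j) * z)))\<^sup>2 = - 4 * (of_real pi)\<^sup>2 * (q ^ Suc j / (1 - q ^ Suc j)\<^sup>2)" for j
  proof -
    define x where "x = of_real pi * (of_nat (Suc j) * z)"
    define E where "E = exp (\<i> * x)"
    have E: "E \<noteq> 0" by (simp add: E_def)
    have "q ^ Suc j = exp (\<i> * x + \<i> * x)"
      unfolding q_def exp_of_nat_mult[symmetric] x_def by (simp add: algebra_simps)
    hence qE: "q ^ Suc j = E * E" by (simp only: exp_add E_def)
    have "sin x = (E - inverse E) / (2 * \<i>)" by (simp add: sin_exp_eq E_def exp_minus)
    also have "\<dots> = - (1 - E * E) / (2 * \<i> * E)" using E by (simp add: field_simps)
    finally have "(sin x)\<^sup>2 = - ((1 - E * E)\<^sup>2 / (4 * (E * E)))"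
      by (simp add: power_divide power_mult_distrib) (simp add: power2_eq_square algebra_simps)
    thus ?thesis unfolding x_def[symmetric] qE by simp
  qed
  have q: "norm q < 1" unfolding q_def by (rule norm_qexp[OF z])
  have sm: "summable (\<lambda>j. q ^ Suc j / (1 - q ^ Suc j)\<^sup>2)"
  proof (rule summable_comparison_test'[of "\<lambda>j. norm q ^ j / (1 - norm q)\<^sup>2" 0])
    show "summable (\<lambda>j. norm q ^ j / (1 - norm q)\<^sup>2)"
      using q by (intro summable_divide summable_geometric) auto
    fix j
    have "norm q ^ Suc j \<le> norm q ^ j" "norm q ^ Suc j \<le> norm q ^ 1" using q by (intro power_decreasing; simp)+
    moreover have "norm (1 - q ^ Suc j) \<ge> 1 - norm q ^ Suc j"
      using norm_triangle_ineq2[of 1 "q ^ Suc j"] by (simp only: norm_one norm_power)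
    ultimately show "norm (q ^ Suc j / (1 - q ^ Suc j)\<^sup>2) \<le> norm q ^ j / (1 - norm q)\<^sup>2"
      unfolding norm_divide norm_power using q by (intro frac_le power_mono zero_less_power) auto
  qed
  have "inverse_sin2_sum z = - 4 * (of_real pi)\<^sup>2 * (\<Sum>j. q ^ Suc j / (1 - q ^ Suc j)\<^sup>2)"
    unfolding inverse_sin2_sum_def s by (rule suminf_mult[OF sm])
  thus ?thesis unfolding lambert_series_eq[OF q] eisenstein_E2_def by simp
qed

lemma has_field_derivative_euler_prod:
  assumes q: "norm q < 1"
  shows "(euler_prod has_field_derivative
     - (\<Sum>k. of_nat (Suc k) * q ^ k / (1 - q ^ Suc k)) * euler_prod q) (at q)"
proof -
  define r where "r = (1 + norm q) / 2"
  have r: "norm q < r" "r < 1" using q by (auto simp: r_def)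
  have "(\<lambda>k. deriv (\<lambda>q. 1 - q ^ Suc k) q / (1 - q ^ Suc k)) sums (deriv euler_prod q / euler_prod q)"
  proof (rule logderiv_prodinf_complex_uniform_limit[where A = "ball 0 r"])
    show "uniform_limit (ball 0 r) (\<lambda>n x. \<Prod>k<n. 1 - x ^ Suc k) euler_prod sequentially"
      by (rule uniform_limit_on_subset[OF uniform_limit_euler_prod[OF r(2)]]) auto
  qed (use q r euler_prod_nonzero in \<open>auto intro!: holomorphic_intros\<close>)
  moreover have "deriv (\<lambda>q. 1 - q ^ Suc k) q = - (of_nat (Suc k) * q ^ k)" for k
  proof (rule DERIV_imp_deriv)
    have "((\<lambda>q. 1 - q ^ Suc k) has_field_derivative 0 - of_nat (Suc k) * (1 * q ^ (Suc k - Suc 0))) (at q)"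
      by (intro DERIV_diff DERIV_const DERIV_power DERIV_ident)
    thus "((\<lambda>q. 1 - q ^ Suc k) has_field_derivative - (of_nat (Suc k) * q ^ k)) (at q)" by simp
  qed
  ultimately have "(\<lambda>k. - (of_nat (Suc k) * q ^ k / (1 - q ^ Suc k))) sums (deriv euler_prod q / euler_prod q)"
    by simp
  hence "deriv euler_prod q / euler_prod q = - (\<Sum>k. of_nat (Suc k) * q ^ k / (1 - q ^ Suc k))"
    using sums_minus by (fastforce simp: sums_iff)
  hence "deriv euler_prod q = - (\<Sum>k. of_nat (Suc k) * q ^ k / (1 - q ^ Suc k)) * euler_prod q"
    using euler_prod_nonzero[OF q] by (simp add: field_simps)
  thus ?thesis using holomorphic_derivI[OF holomorphic_euler_prod open_ball, of q] q by simp
qed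

lemma Ramanujan_Delta_eq:
  assumes "Im z > 0"
  shows "Ramanujan_Delta z = exp (2 * of_real pi * \<i> * z) * euler_prod (exp (2 * of_real pi * \<i> * z)) ^ 24"
  unfolding Ramanujan_Delta_def Let_def euler_prod_def
  by (subst prodinf_power[OF convergent_euler_prod[OF norm_qexp[OF assms]]]) simp

lemma Ramanujan_Delta_nonzero: "Im z > 0 \<Longrightarrow> Ramanujan_Delta z \<noteq> 0"
  by (simp add: Ramanujan_Delta_eq euler_prod_nonzero norm_qexp del: norm_exp_eq_Re)

lemma open_upper_halfplane: "open {z. Im z > 0}"
  by (rule open_halfspace_Im_gt)

lemma has_field_derivative_Ramanujan_Delta:
  assumes z: "Im z > 0"
  shows "(Ramanujan_Delta has_field_derivative 2 * of_real pi * \<i> * eisenstein_E2 z * Ramanujan_Delta z) (at z)"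
proof -
  let ?e = "\<lambda>z. exp (2 * of_real pi * \<i> * z)"
  define L where "L = (\<Sum>k. of_nat (Suc k) * ?e z ^ k / (1 - ?e z ^ Suc k))"
  note q = norm_qexp[OF z]
  have de: "(?e has_field_derivative 2 * of_real pi * \<i> * ?e z) (at z)"
    by (auto intro!: derivative_eq_intros)
  have dE: "((\<lambda>z. euler_prod (?e z)) has_field_derivative (- L * euler_prod (?e z)) * (2 * of_real pi * \<i> * ?e z)) (at z)"
    unfolding L_def
    by (rule DERIV_chain2[where f = euler_prod and g = ?e, OF _ de], rule has_field_derivative_euler_prod[OF q])
  have "((\<lambda>z. ?e z * euler_prod (?e z) ^ 24) has_field_derivative
      ?e z * (of_nat 24 * ((- L * euler_prod (?e z)) * (2 * of_real pi * \<i> * ?e z) * euler_prod (?e z) ^ (24 - Suc 0)))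
      + 2 * of_real pi * \<i> * ?e z * euler_prod (?e z) ^ 24) (at z)"
    by (intro DERIV_mult' DERIV_power dE de)
  also have "?e z * (of_nat 24 * ((- L * euler_prod (?e z)) * (2 * of_real pi * \<i> * ?e z) * euler_prod (?e z) ^ (24 - Suc 0)))
      + 2 * of_real pi * \<i> * ?e z * euler_prod (?e z) ^ 24
      = 2 * of_real pi * \<i> * (1 - 24 * (?e z * L)) * (?e z * euler_prod (?e z) ^ 24)"
    by (simp add: algebra_simps eval_nat_numeral)
  also have "?e z * L = (\<Sum>k. of_nat (Suc k) * ?e z ^ Suc k / (1 - ?e z ^ Suc k))"
  proof -
    have "summable (\<lambda>k. of_nat (Suc k) * ?e z ^ k / (1 - ?e z ^ Suc k))"
    proof (rule summable_comparison_test'[of "\<lambda>k. real (Suc k) * norm (?e z) ^ k / (1 - norm (?e z))" 0])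
      show "summable (\<lambda>k. real (Suc k) * norm (?e z) ^ k / (1 - norm (?e z)))"
        using geometric_deriv_sums[of "norm (?e z)"] q by (intro summable_divide) (auto simp: sums_iff simp del: norm_exp_eq_Re)
      fix k
      have "norm (?e z) ^ Suc k \<le> norm (?e z)"
        using power_decreasing[of 1 "Suc k" "norm (?e z)"] less_imp_le[OF q] unfolding power_one_right by simp
      hence "1 - norm (?e z) \<le> norm (1 - ?e z ^ Suc k)"
        using norm_triangle_ineq2[of 1 "?e z ^ Suc k"] unfolding norm_one norm_power by linarith
      thus "norm (of_nat (Suc k) * ?e z ^ k / (1 - ?e z ^ Suc k)) \<le> real (Suc k) * norm (?e z) ^ k / (1 - norm (?e z))"
        unfolding norm_divide norm_mult norm_power norm_of_nat
        using q by (intro frac_le mult_left_mono) (auto simp del: norm_exp_eq_Re of_nat_Suc)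
    qed
    from suminf_mult[OF this, of "?e z"] show ?thesis unfolding L_def by (simp add: mult_ac)
  qed
  also note eisenstein_E2_lambert[OF z, symmetric]
  also note Ramanujan_Delta_eq[OF z, symmetric]
  finally show ?thesis
    by (rule has_field_derivative_transform_within_open[OF _ open_upper_halfplane])
       (use z Ramanujan_Delta_eq in auto)
qed

lemma Im_minus_inverse: "Im z > 0 \<Longrightarrow> Im (- 1 / z) > 0"
  by (simp add: Im_divide divide_pos_pos sum_power2_gt_zero_iff)

lemma Ramanujan_Delta_plus_1: "Ramanujan_Delta (z + 1) = Ramanujan_Delta z"
  by (simp add: Ramanujan_Delta_def distrib_left exp_add)

text \<open>The quotient of the two sides has derivative 0: the anomalous term of E2 contributes
  12/z, which cancels the logarithmic derivative of \<open>z ^ 12\<close>. The constant is found at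
  the fixed point i, where i^12 = 1.\<close>

theorem Ramanujan_Delta_inversion:
  assumes "Im z > 0"
  shows "Ramanujan_Delta (- 1 / z) = z ^ 12 * Ramanujan_Delta z"
proof -
  define H where "H = {z. Im z > 0}"
  define g where "g = (\<lambda>z. Ramanujan_Delta (- 1 / z) / (z ^ 12 * Ramanujan_Delta z))"
  have "(g has_field_derivative 0) (at z)" if z: "z \<in> H" for z
  proof -
    have z': "Im z > 0" and z0: "z \<noteq> 0" using z by (auto simp: H_def)
    let ?c = "2 * of_real pi * \<i> :: complex"
    let ?D = "Ramanujan_Delta z" and ?D' = "Ramanujan_Delta (- 1 / z)"
    have nz: "?D \<noteq> 0" using Ramanujan_Delta_nonzero[OF z'] .
    have d1: "((\<lambda>z. - 1 / z) has_field_derivative 1 / z\<^sup>2) (at z)"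
      using z0 by (auto intro!: derivative_eq_intros simp: power2_eq_square)
    have d2: "((\<lambda>z. z ^ 12) has_field_derivative of_nat 12 * z ^ 11) (at z)"
      by (auto intro!: derivative_eq_intros)
    have "(g has_field_derivative
      (?c * eisenstein_E2 (- 1 / z) * ?D' * (1 / z\<^sup>2) * (z ^ 12 * ?D)
        - ?D' * (z ^ 12 * (?c * eisenstein_E2 z * ?D) + of_nat 12 * z ^ 11 * ?D)) / ((z ^ 12 * ?D) * (z ^ 12 * ?D))) (at z)"
      unfolding g_def
      by (intro DERIV_divide DERIV_mult' d2 has_field_derivative_Ramanujan_Delta z'
            DERIV_chain2[OF has_field_derivative_Ramanujan_Delta[OF Im_minus_inverse[OF z']] d1])
         (use z0 nz in auto)
    also have "?c * eisenstein_E2 (- 1 / z) * ?D' * (1 / z\<^sup>2) * (z ^ 12 * ?D)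
        - ?D' * (z ^ 12 * (?c * eisenstein_E2 z * ?D) + of_nat 12 * z ^ 11 * ?D) = 0"
      unfolding eisenstein_E2_transform[OF z'] using z0
      by (simp add: field_simps eval_nat_numeral)
    finally show ?thesis by simp
  qed
  moreover have "convex H" unfolding H_def by (rule convex_halfspace_Im_gt)
  ultimately obtain c where c: "\<And>z. z \<in> H \<Longrightarrow> g z = c"
    using has_field_derivative_zero_constant[of H g] by (metis has_field_derivative_at_within)
  have "g \<i> = 1" using Ramanujan_Delta_nonzero[of \<i>] by (simp add: g_def)
  hence "g z = 1" using c[of \<i>] c[of z] assms by (simp add: H_def)
  moreover have "z \<noteq> 0" using assms by auto
  ultimately show ?thesis using Ramanujan_Delta_nonzero[OF assms] by (simp add: g_def)
qed

section \<open>Holomorphic modular functions\<close>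

definition alg_fps :: "complex fps \<Rightarrow> bool" where
  "alg_fps F \<longleftrightarrow> (\<forall>n. algebraic (fps_nth F n))"

text \<open>Plays the role of a \<open>q\<close>-expansion with algebraic coefficients: \<open>G\<close> is evaluated at \<open>exp (2 \<pi> \<i> z/N)\<close>.\<close>
definition alg_holomorphic :: "(complex \<Rightarrow> complex) \<Rightarrow> bool" where
  "alg_holomorphic G \<longleftrightarrow> G holomorphic_on ball 0 1 \<and> alg_fps (fps_expansion G 0)"

lemma alg_fps_mult: "alg_fps F \<Longrightarrow> alg_fps G \<Longrightarrow> alg_fps (F * G)"
  by (auto simp: alg_fps_def fps_mult_nth intro!: algebraic_sum algebraic_mult)

lemma alg_fps_add: "alg_fps F \<Longrightarrow> alg_fps G \<Longrightarrow> alg_fps (F + G)"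
  by (simp add: alg_fps_def algebraic_add)

lemma alg_fps_diff: "alg_fps F \<Longrightarrow> alg_fps G \<Longrightarrow> alg_fps (F - G)"
  by (simp add: alg_fps_def algebraic_diff)

lemma alg_fps_power: "alg_fps F \<Longrightarrow> alg_fps (F ^ n)"
  by (induction n) (auto intro: alg_fps_mult simp: alg_fps_def[of 1])

lemma alg_fps_inverse:
  assumes "alg_fps F" "fps_nth F 0 \<noteq> 0"
  shows "alg_fps (inverse F)"
  unfolding alg_fps_def
proof
  fix n show "algebraic (fps_nth (inverse F) n)"
  proof (induction n rule: less_induct)
    case (less n)
    have "fps_nth (F * inverse F) n = (\<Sum>i=0..n. fps_nth F i * fps_nth (inverse F) (n - i))"
      by (rule fps_mult_nth)
    also have "F * inverse F = 1" using assms(2) by (simp add: inverse_mult_eq_1')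
    also have "(\<Sum>i=0..n. fps_nth F i * fps_nth (inverse F) (n - i)) =
        fps_nth F 0 * fps_nth (inverse F) n + (\<Sum>i=1..n. fps_nth F i * fps_nth (inverse F) (n - i))"
      by (simp add: sum.atLeast_Suc_atMost)
    finally have "fps_nth (inverse F) n =
        (fps_nth 1 n - (\<Sum>i=1..n. fps_nth F i * fps_nth (inverse F) (n - i))) / fps_nth F 0"
      using assms(2) by (simp add: field_simps)
    moreover have "algebraic (fps_nth (1 :: complex fps) n)" by simp
    ultimately show ?case
      using assms(1) less by (auto simp: alg_fps_def intro!: algebraic_divide algebraic_diff algebraic_sum algebraic_mult)
  qed
qed

lemma alg_holomorphicI:
  assumes "G holomorphic_on ball 0 1" "G has_fps_expansion F" "alg_fps F"
  shows "alg_holomorphic G"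
  using assms fps_expansion_eqI[OF assms(2)] by (simp add: alg_holomorphic_def)

lemma alg_holomorphicD:
  assumes "alg_holomorphic G"
  shows "G holomorphic_on ball 0 1" "G has_fps_expansion (fps_expansion G 0)" "alg_fps (fps_expansion G 0)"
  using assms has_fps_expansion_fps_expansion[of "ball 0 1" G] by (auto simp: alg_holomorphic_def)

lemma alg_holomorphic_const: "algebraic c \<Longrightarrow> alg_holomorphic (\<lambda>_. c)"
  by (rule alg_holomorphicI[of _ "fps_const c"]) (auto simp: alg_fps_def)

lemma alg_holomorphic_id: "alg_holomorphic (\<lambda>x. x)"
  by (rule alg_holomorphicI[of _ fps_X]) (auto simp: alg_fps_def intro!: fps_expansion_intros)

lemma alg_holomorphic_add: "alg_holomorphic f \<Longrightarrow> alg_holomorphic g \<Longrightarrow> alg_holomorphic (\<lambda>x. f x + g x)"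
  by (rule alg_holomorphicI[OF _ has_fps_expansion_add])
     (auto intro!: holomorphic_intros alg_fps_add dest: alg_holomorphicD)

lemma alg_holomorphic_diff: "alg_holomorphic f \<Longrightarrow> alg_holomorphic g \<Longrightarrow> alg_holomorphic (\<lambda>x. f x - g x)"
  by (rule alg_holomorphicI[OF _ has_fps_expansion_diff])
     (auto intro!: holomorphic_intros alg_fps_diff dest: alg_holomorphicD)

lemma alg_holomorphic_mult: "alg_holomorphic f \<Longrightarrow> alg_holomorphic g \<Longrightarrow> alg_holomorphic (\<lambda>x. f x * g x)"
  by (rule alg_holomorphicI[OF _ has_fps_expansion_mult])
     (auto intro!: holomorphic_intros alg_fps_mult dest: alg_holomorphicD)

lemma alg_holomorphic_power: "alg_holomorphic f \<Longrightarrow> alg_holomorphic (\<lambda>x. f x ^ n)"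
  by (induction n) (auto intro: alg_holomorphic_mult alg_holomorphic_const)

lemma alg_holomorphic_deriv: "alg_holomorphic f \<Longrightarrow> alg_holomorphic (deriv f)"
  by (rule alg_holomorphicI[OF _ has_fps_expansion_deriv])
     (auto intro!: holomorphic_deriv algebraic_mult algebraic_add dest: alg_holomorphicD simp: alg_fps_def)

lemma alg_holomorphic_at_0: "alg_holomorphic G \<Longrightarrow> algebraic (G 0)"
  using alg_holomorphicD(3)[of G] by (auto simp: alg_fps_def fps_expansion_def dest: spec[of _ 0])

lemma alg_holomorphic_inverse:
  assumes f: "alg_holomorphic f" and nz: "\<And>x. norm x < 1 \<Longrightarrow> f x \<noteq> 0"
  shows "alg_holomorphic (\<lambda>x. inverse (f x))"
proof (rule alg_holomorphicI)
  have "fps_nth (fps_expansion f 0) 0 \<noteq> 0" using nz[of 0] by (simp add: fps_expansion_def)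
  thus "(\<lambda>x. inverse (f x)) has_fps_expansion inverse (fps_expansion f 0)"
    "alg_fps (inverse (fps_expansion f 0))"
    using alg_holomorphicD[OF f] by (auto intro!: has_fps_expansion_inverse alg_fps_inverse)
qed (use nz alg_holomorphicD(1)[OF f] in \<open>auto intro!: holomorphic_intros\<close>)

text \<open>Serves the substitutions \<open>x \<mapsto> x ^ N\<close> and root of unity times
  \<open>x ^ (a * a)\<close>, which arise when forms at an integral matrix are expanded in the N-th
  root of q.\<close>

lemma alg_holomorphic_compose_monomial:
  assumes f: "alg_holomorphic f" and c: "algebraic c" "norm c \<le> 1" and k: "k > 0"
  shows "alg_holomorphic (\<lambda>x. f (c * x ^ k))"
proof (rule alg_holomorphicI)
  let ?M = "fps_const c * fps_X ^ k"
  have lt: "norm (c * x ^ k) < 1" if "norm x < 1" for x :: complex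
  proof -
    have "norm x ^ k < 1" using that k by (simp add: power_less_one_iff)
    thus ?thesis using c(2) mult_left_le_one_le[of "norm x ^ k" "norm c"] by (simp add: norm_mult norm_power)
  qed
  show "(\<lambda>x. f (c * x ^ k)) holomorphic_on ball 0 1"
    using lt by (intro holomorphic_on_compose_gen[OF _ alg_holomorphicD(1)[OF f], unfolded o_def] holomorphic_intros) auto
  have "(\<lambda>x. c * x ^ k) has_fps_expansion ?M" by (intro fps_expansion_intros)
  moreover have "fps_nth ?M 0 = 0" using k by simp
  ultimately show "(\<lambda>x. f (c * x ^ k)) has_fps_expansion (fps_compose (fps_expansion f 0) ?M)"
    using has_fps_expansion_compose[OF alg_holomorphicD(2)[OF f]] by (simp add: o_def)
  have "alg_fps ?M" using c(1) by (auto simp: alg_fps_def)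
  thus "alg_fps (fps_compose (fps_expansion f 0) ?M)"
    using alg_holomorphicD(3)[OF f] alg_fps_power[of ?M]
    by (auto simp: alg_fps_def fps_compose_nth intro!: algebraic_sum algebraic_mult)
qed

text \<open>Dividing out a zero at 0 shifts the power series, so the coefficients stay algebraic and
  the radius of convergence does not shrink. Pole orders at the cusp are lowered in this
  way.\<close>

lemma alg_holomorphic_shift:
  assumes f: "alg_holomorphic f" and "f 0 = 0"
  obtains g where "alg_holomorphic g" "\<And>x. norm x < 1 \<Longrightarrow> f x = x * g x"
proof -
  define F where "F = fps_expansion f 0"
  have hol: "f holomorphic_on eball 0 1"
    using alg_holomorphicD(1)[OF f] by (simp add: one_ereal_def)
  have R: "fps_conv_radius F \<ge> 1" unfolding F_def by (rule conv_radius_fps_expansion[OF hol])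
  have ev: "eval_fps F x = f x" if "norm x < 1" for x
    unfolding F_def using eval_fps_expansion'[OF hol] that by (simp add: one_ereal_def)
  have F0: "fps_nth F 0 = 0" using assms by (simp add: F_def fps_expansion_def)
  define g where "g = eval_fps (fps_shift 1 F)"
  have R': "fps_conv_radius (fps_shift 1 F) \<ge> 1" using R by simp
  have "ball 0 1 \<subseteq> eball 0 (fps_conv_radius (fps_shift 1 F))"
    using eball_mono[OF R', of 0] by (simp add: one_ereal_def)
  hence "g holomorphic_on ball 0 1" unfolding g_def by (rule holomorphic_on_eval_fps)
  moreover have "g has_fps_expansion fps_shift 1 F"
    unfolding g_def using R' by (intro eval_fps_has_fps_expansion) (auto intro: less_le_trans[of _ 1])
  moreover have "alg_fps (fps_shift 1 F)" using alg_holomorphicD(3)[OF f] by (simp add: alg_fps_def F_def)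
  ultimately have "alg_holomorphic g" by (rule alg_holomorphicI)
  moreover have "f x = x * g x" if "norm x < 1" for x
  proof -
    have r: "ereal (norm x) < fps_conv_radius (fps_shift 1 F)"
      by (rule less_le_trans[OF _ R']) (use that in simp)
    have FX: "F = fps_X * fps_shift 1 F" using F0 by (intro fps_ext) auto
    have "eval_fps F x = eval_fps (fps_X * fps_shift 1 F) x"
      by (rule arg_cong[where f = "\<lambda>F. eval_fps F x", OF FX])
    also have "\<dots> = eval_fps fps_X x * eval_fps (fps_shift 1 F) x"
      using r by (intro eval_fps_mult) auto
    finally have "eval_fps F x = eval_fps fps_X x * eval_fps (fps_shift 1 F) x" .
    thus ?thesis using ev[OF that] by (simp add: g_def)
  qed
  ultimately show ?thesis by (rule that)
qed

section \<open>Reduction into a half-plane and the maximum principle\<close>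

text \<open>After a translation the real part is at most 1/2 in absolute value. If the imaginary
  part is below 1/2 too, then |z|^2 <= 1/2 and inversion at least doubles the imaginary
  part.\<close>

lemma modular_reduction:
  assumes T: "\<And>z. Im z > 0 \<Longrightarrow> f (z + 1) = f z" and S: "\<And>z. Im z > 0 \<Longrightarrow> f (- 1 / z) = f z"
    and z: "Im z > 0"
  shows "\<exists>z'. Im z' \<ge> 1 / 2 \<and> f z' = f z"
proof -
  have Tn: "f (z + of_nat n) = f z" if "Im z > 0" for z n
    using that T[of "z + of_nat n" for n] by (induction n) (auto simp: add_ac)
  have Ti: "f (z + of_int n) = f z" if z: "Im z > 0" for z n
  proof (cases "n \<ge> 0")
    case True thus ?thesis using Tn[OF z, of "nat n"] by simp
  next
    case False thus ?thesis using Tn[of "z + of_int n" "nat (- n)"] z by simp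
  qed
  \<comment> \<open>The exponent \<open>n\<close> bounds the number of doublings still
    required.\<close>
  have "\<exists>z'. Im z' \<ge> 1 / 2 \<and> f z' = f z" if "Im z > 0" "Im z * 2 ^ n \<ge> 1 / 2" for n z
    using that
  proof (induction n arbitrary: z)
    case (Suc n)
    define w where "w = z + of_int (- round (Re z))"
    have w: "Im w = Im z" "f w = f z" unfolding w_def by (simp, rule Ti[OF Suc.prems(1)])
    have re: "\<bar>Re w\<bar> \<le> 1 / 2" using of_int_round_abs_le[of "Re z"] by (simp add: w_def abs_minus_commute)
    show ?case
    proof (cases "Im w \<ge> 1 / 2")
      case False
      have "(Re w)\<^sup>2 \<le> (1/2)\<^sup>2" using re by (metis abs_ge_zero power2_abs power_mono)
      moreover have "(Im w)\<^sup>2 \<le> (1/2)\<^sup>2" using False Suc.prems w by (intro power_mono) auto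
      ultimately have le: "(Re w)\<^sup>2 + (Im w)\<^sup>2 \<le> 1 / 2" by (simp add: power2_eq_square)
      have Iw: "Im w > 0" using w Suc.prems by simp
      hence pos: "(Re w)\<^sup>2 + (Im w)\<^sup>2 > 0" by (simp add: sum_power2_gt_zero_iff)
      have "Im (- 1 / w) = Im w / ((Re w)\<^sup>2 + (Im w)\<^sup>2)" by (simp add: Im_divide)
      moreover have "2 * Im w \<le> Im w / ((Re w)\<^sup>2 + (Im w)\<^sup>2)"
        using mult_left_mono[OF le, of "Im w"] Iw pos by (simp add: pos_le_divide_eq)
      ultimately have "Im (- 1 / w) \<ge> 2 * Im w" by simp
      moreover from this have "Im (- 1 / w) * 2 ^ n \<ge> 2 * Im w * 2 ^ n" by (intro mult_right_mono) auto
      ultimately have "Im (- 1 / w) > 0" "Im (- 1 / w) * 2 ^ n \<ge> 1 / 2"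
        using Iw Suc.prems w by (auto simp: mult_ac)
      from Suc.IH[OF this] show ?thesis using S[OF Iw] w by simp
    qed (use w in auto)
  qed auto
  moreover obtain n where n: "1 / 2 / Im z < 2 ^ n" using real_arch_pow[of 2 "1 / 2 / Im z"] by auto
  have "1 / 2 \<le> Im z * 2 ^ n" using z n by (simp add: field_simps)
  ultimately show ?thesis using z by blast
qed

lemma qexp_surj:
  assumes "y \<noteq> 0" "norm y < 1" "N > 0"
  obtains z where "Im z > 0" "y = exp (2 * of_real pi * \<i> * z / of_nat N)"
proof
  define z where "z = of_nat N * Ln y / (2 * of_real pi * \<i>)"
  show "y = exp (2 * of_real pi * \<i> * z / of_nat N)" using assms by (simp add: z_def)
  have "ln (norm y) < 0" using assms by simp
  moreover have "Im z = - (of_nat N * ln (norm y)) / (2 * pi)"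
    using assms by (simp add: z_def Im_divide power2_eq_square field_simps)
  ultimately show "Im z > 0" using assms by (simp add: divide_neg_pos mult_pos_neg)
qed

lemma norm_qexp_N: "norm (exp (2 * of_real pi * \<i> * z / of_nat N)) = exp (- (2 * pi * Im z / real N))"
  by (simp add: Re_divide_of_nat)

text \<open>By reduction, every value of \<open>G\<close> on the punctured unit disc is already
  taken on the compact disc of radius exp(-pi/N), the image of Im z >= 1/2 together with the cusp.
  So |G| has a maximum at an interior point of the unit disc.\<close>

lemma modular_holomorphic_constant:
  assumes T: "\<And>z. Im z > 0 \<Longrightarrow> f (z + 1) = f z" and S: "\<And>z. Im z > 0 \<Longrightarrow> f (- 1 / z) = f z"
    and f: "\<And>z. Im z > 0 \<Longrightarrow> f z = G (exp (2 * of_real pi * \<i> * z / of_nat N))"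
    and G: "G holomorphic_on ball 0 1" and N: "N > 0" and z: "Im z > 0"
  shows "f z = G 0"
proof -
  let ?x = "\<lambda>z. exp (2 * of_real pi * \<i> * z / of_nat N)"
  define \<rho> where "\<rho> = exp (- (pi / real N))"
  have \<rho>: "0 < \<rho>" "\<rho> < 1" using N by (auto simp: \<rho>_def)
  have x1: "norm (?x z) < 1" if "Im z > 0" for z
    unfolding norm_qexp_N using that N by simp
  have "continuous_on (cball 0 \<rho>) (\<lambda>x. norm (G x))"
    using \<rho> by (intro continuous_intros holomorphic_on_imp_continuous_on holomorphic_on_subset[OF G]) auto
  from continuous_attains_sup[OF _ _ this] \<rho>
  obtain \<xi> where \<xi>: "\<xi> \<in> cball 0 \<rho>" "\<And>y. y \<in> cball 0 \<rho> \<Longrightarrow> norm (G y) \<le> norm (G \<xi>)" by auto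
  have "norm (G y) \<le> norm (G \<xi>)" if y: "y \<in> ball 0 1" for y
  proof (cases "y = 0")
    case False
    then obtain z where z: "Im z > 0" "y = ?x z" using qexp_surj[OF False _ N] y by auto
    obtain z' where z': "Im z' \<ge> 1 / 2" "f z' = f z" using modular_reduction[OF T S z(1)] by blast
    have "norm (?x z') \<le> \<rho>"
      unfolding norm_qexp_N \<rho>_def using z'(1) N by (simp add: divide_right_mono field_simps)
    hence "norm (G (?x z')) \<le> norm (G \<xi>)" by (intro \<xi>) auto
    moreover have "G y = G (?x z')" using f[of z] f[of z'] z z' by simp
    ultimately show ?thesis by simp
  qed (use \<xi> \<rho> in auto)
  hence "G constant_on ball 0 1"
    using \<xi>(1) \<rho> by (intro maximum_modulus_principle[OF G _ _ open_ball order.refl, of \<xi>]) auto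
  then obtain c where c: "\<And>y. y \<in> ball 0 1 \<Longrightarrow> G y = c" by (auto simp: constant_on_def)
  show ?thesis using f[OF z] c[of "?x z"] c[of 0] x1[OF z] by simp
qed

section \<open>Eisenstein series and the Ramanujan differential equations\<close>

lemma norm_qexp_lt_1: "Im z > 0 \<Longrightarrow> N > 0 \<Longrightarrow> norm (exp (2 * of_real pi * \<i> * z / of_nat N)) < 1"
  unfolding norm_qexp_N by simp

text \<open>The logarithmic derivative with respect to log q of q times the 24th power of the Euler
  product.\<close>

definition E2_fun :: "complex \<Rightarrow> complex" where
  "E2_fun q = 1 + 24 * (q * deriv euler_prod q * inverse (euler_prod q))"

text \<open>Ramanujan's equation for the derivative of E2, solved for E4; the next definition does
  the same with the equation for E4. Two of the three equations thus hold by construction, and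
  algebraic coefficients are inherited.\<close>

definition E4_fun :: "complex \<Rightarrow> complex" where
  "E4_fun q = E2_fun q ^ 2 - 12 * (q * deriv E2_fun q)"

definition E6_fun :: "complex \<Rightarrow> complex" where
  "E6_fun q = E2_fun q * E4_fun q - 3 * (q * deriv E4_fun q)"

definition eisenstein_E4 :: "complex \<Rightarrow> complex" where
  "eisenstein_E4 z = E4_fun (exp (2 * of_real pi * \<i> * z))"

definition eisenstein_E6 :: "complex \<Rightarrow> complex" where
  "eisenstein_E6 z = E6_fun (exp (2 * of_real pi * \<i> * z))"

lemma alg_holomorphic_euler_prod: "alg_holomorphic euler_prod"
  unfolding alg_holomorphic_def alg_fps_def
  using holomorphic_euler_prod fps_nth_euler_prod rat_imp_algebraic by blast

lemmas alg_holomorphic_intros =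
  alg_holomorphic_add alg_holomorphic_diff alg_holomorphic_mult alg_holomorphic_power
  alg_holomorphic_const alg_holomorphic_id alg_holomorphic_deriv alg_holomorphic_inverse
  alg_holomorphic_euler_prod algebraic_numeral algebraic_1

lemma alg_holomorphic_E2_fun: "alg_holomorphic E2_fun"
  unfolding E2_fun_def[abs_def] by (intro alg_holomorphic_intros euler_prod_nonzero)

lemma alg_holomorphic_E4_fun: "alg_holomorphic E4_fun"
  unfolding E4_fun_def[abs_def] by (intro alg_holomorphic_intros alg_holomorphic_E2_fun)

lemma alg_holomorphic_E6_fun: "alg_holomorphic E6_fun"
  unfolding E6_fun_def[abs_def] by (intro alg_holomorphic_intros alg_holomorphic_E2_fun alg_holomorphic_E4_fun)

text \<open>Both expressions are logarithmic derivatives of the same nonvanishing function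
  Delta.\<close>

lemma eisenstein_E2_eq:
  assumes z: "Im z > 0"
  shows "eisenstein_E2 z = E2_fun (exp (2 * of_real pi * \<i> * z))"
proof -
  define q where "q = exp (2 * of_real pi * \<i> * z)"
  have q: "norm q < 1" unfolding q_def by (rule norm_qexp[OF z])
  have "deriv euler_prod q = - (\<Sum>k. of_nat (Suc k) * q ^ k / (1 - q ^ Suc k)) * euler_prod q"
    by (rule DERIV_imp_deriv[OF has_field_derivative_euler_prod[OF q]])
  have "(Ramanujan_Delta has_field_derivative 2 * of_real pi * \<i> * eisenstein_E2 z * Ramanujan_Delta z) (at z)"
    by (rule has_field_derivative_Ramanujan_Delta[OF z])
  moreover have "(Ramanujan_Delta has_field_derivative 2 * of_real pi * \<i> * E2_fun q * Ramanujan_Delta z) (at z)"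
  proof -
    let ?e = "\<lambda>z. exp (2 * of_real pi * \<i> * z)"
    have de: "(?e has_field_derivative 2 * of_real pi * \<i> * ?e z) (at z)"
      by (auto intro!: derivative_eq_intros)
    have dE: "((\<lambda>z. euler_prod (?e z)) has_field_derivative deriv euler_prod q * (2 * of_real pi * \<i> * ?e z)) (at z)"
    proof (rule DERIV_chain2[where f = euler_prod and g = ?e, OF _ de])
      show "(euler_prod has_field_derivative deriv euler_prod q) (at (?e z))"
        unfolding q_def[symmetric] using holomorphic_derivI[OF holomorphic_euler_prod open_ball, of q] q by simp
    qed
    have "((\<lambda>z. ?e z * euler_prod (?e z) ^ 24) has_field_derivative
      ?e z * (of_nat 24 * (deriv euler_prod q * (2 * of_real pi * \<i> * ?e z) * euler_prod (?e z) ^ (24 - Suc 0)))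
      + 2 * of_real pi * \<i> * ?e z * euler_prod (?e z) ^ 24) (at z)"
      by (intro DERIV_mult' DERIV_power dE de)
    also have "?e z * (of_nat 24 * (deriv euler_prod q * (2 * of_real pi * \<i> * ?e z) * euler_prod (?e z) ^ (24 - Suc 0)))
      + 2 * of_real pi * \<i> * ?e z * euler_prod (?e z) ^ 24 = 2 * of_real pi * \<i> * E2_fun q * Ramanujan_Delta z"
      using euler_prod_nonzero[OF q] unfolding Ramanujan_Delta_eq[OF z] q_def[symmetric] E2_fun_def
      by (simp add: field_simps eval_nat_numeral)
    finally show ?thesis
      by (rule has_field_derivative_transform_within_open[OF _ open_upper_halfplane])
        (use z Ramanujan_Delta_eq in auto)
  qed
  ultimately have "2 * of_real pi * \<i> * eisenstein_E2 z * Ramanujan_Delta z = 2 * of_real pi * \<i> * E2_fun q * Ramanujan_Delta z"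
    by (rule DERIV_unique)
  thus ?thesis using Ramanujan_Delta_nonzero[OF z] by (simp add: q_def)
qed

lemma has_field_derivative_qexp:
  assumes g: "alg_holomorphic g" and z: "Im z > 0" and f: "\<And>z. Im z > 0 \<Longrightarrow> f z = g (exp (2 * of_real pi * \<i> * z))"
  defines "q \<equiv> exp (2 * of_real pi * \<i> * z)"
  shows "(f has_field_derivative 2 * of_real pi * \<i> * (q * deriv g q)) (at z)"
proof -
  let ?e = "\<lambda>z. exp (2 * of_real pi * \<i> * z)"
  have q: "norm q < 1" unfolding q_def by (rule norm_qexp[OF z])
  have de: "(?e has_field_derivative 2 * of_real pi * \<i> * ?e z) (at z)"
    by (auto intro!: derivative_eq_intros)
  have dg: "(g has_field_derivative deriv g q) (at (?e z))"
    unfolding q_def[symmetric] using holomorphic_derivI[OF alg_holomorphicD(1)[OF g] open_ball, of q] q by simp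
  have "((\<lambda>z. g (?e z)) has_field_derivative deriv g q * (2 * of_real pi * \<i> * ?e z)) (at z)"
    by (rule DERIV_chain2[where f = g and g = ?e, OF dg de])
  hence "(f has_field_derivative deriv g q * (2 * of_real pi * \<i> * ?e z)) (at z)"
    by (rule has_field_derivative_transform_within_open[OF _ open_upper_halfplane]) (use f z in auto)
  thus ?thesis by (simp add: q_def mult_ac)
qed

lemma has_field_derivative_E2:
  assumes z: "Im z > 0"
  shows "(eisenstein_E2 has_field_derivative 2 * of_real pi * \<i> * ((eisenstein_E2 z ^ 2 - eisenstein_E4 z) / 12)) (at z)"
  using has_field_derivative_qexp[OF alg_holomorphic_E2_fun z eisenstein_E2_eq]
  unfolding eisenstein_E4_def E4_fun_def eisenstein_E2_eq[OF z] by simp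

lemma has_field_derivative_E4:
  assumes z: "Im z > 0"
  shows "(eisenstein_E4 has_field_derivative 2 * of_real pi * \<i> * ((eisenstein_E2 z * eisenstein_E4 z - eisenstein_E6 z) / 3)) (at z)"
  using has_field_derivative_qexp[OF alg_holomorphic_E4_fun z eisenstein_E4_def]
  unfolding eisenstein_E6_def E6_fun_def eisenstein_E2_eq[OF z] eisenstein_E4_def[of z] by simp

lemma eisenstein_E2_plus_1: "Im z > 0 \<Longrightarrow> eisenstein_E2 (z + 1) = eisenstein_E2 z"
  by (simp add: eisenstein_E2_eq distrib_left exp_add)

lemma eisenstein_E4_plus_1: "eisenstein_E4 (z + 1) = eisenstein_E4 z"
  by (simp add: eisenstein_E4_def distrib_left exp_add)

lemma eisenstein_E6_plus_1: "eisenstein_E6 (z + 1) = eisenstein_E6 z"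
  by (simp add: eisenstein_E6_def distrib_left exp_add)

lemma has_field_derivative_inversion:
  assumes z: "Im z > 0" and g: "(g has_field_derivative D') (at (- 1 / z))"
  shows "((\<lambda>z. g (- 1 / z)) has_field_derivative D' / z\<^sup>2) (at z)"
proof -
  have "z \<noteq> 0" using z by auto
  hence d1: "((\<lambda>z. - 1 / z) has_field_derivative 1 / z\<^sup>2) (at z)"
    by (auto intro!: derivative_eq_intros simp: power2_eq_square)
  show ?thesis using DERIV_chain2[where f = g and g = "\<lambda>z. - 1 / z", OF g d1] by simp
qed

text \<open>Differentiating the inversion law of E2 gives that of its derivative; in E2^2 - 12 E2'
  (derivative taken with respect to log q) all anomalous terms cancel. The law for E6 arises from
  that of E4 in the same manner.\<close>

lemma eisenstein_E4_inversion:
  assumes z: "Im z > 0"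
  shows "eisenstein_E4 (- 1 / z) = z ^ 4 * eisenstein_E4 z"
proof -
  let ?c = "2 * of_real pi * \<i> :: complex"
  have z0: "z \<noteq> 0" using z by auto
  note z' = Im_minus_inverse[OF z]
  have 1: "((\<lambda>z. eisenstein_E2 (- 1 / z)) has_field_derivative
     ?c * ((eisenstein_E2 (- 1 / z) ^ 2 - eisenstein_E4 (- 1 / z)) / 12) / z\<^sup>2) (at z)"
    by (rule has_field_derivative_inversion[OF z has_field_derivative_E2[OF z']])
  have "((\<lambda>z. z\<^sup>2 * eisenstein_E2 z - 6 * \<i> * z / of_real pi) has_field_derivative
     (z\<^sup>2 * (?c * ((eisenstein_E2 z ^ 2 - eisenstein_E4 z) / 12)) + of_nat 2 * (1 * z ^ (2 - Suc 0)) * eisenstein_E2 z)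
      - 6 * \<i> * 1 / of_real pi) (at z)"
    by (intro DERIV_diff DERIV_mult' DERIV_power DERIV_cdivide DERIV_cmult DERIV_ident has_field_derivative_E2 z)
  hence 2: "((\<lambda>z. eisenstein_E2 (- 1 / z)) has_field_derivative
     (z\<^sup>2 * (?c * ((eisenstein_E2 z ^ 2 - eisenstein_E4 z) / 12)) + of_nat 2 * (1 * z ^ (2 - Suc 0)) * eisenstein_E2 z)
      - 6 * \<i> * 1 / of_real pi) (at z)"
    by (rule has_field_derivative_transform_within_open[OF _ open_upper_halfplane])
       (use z eisenstein_E2_transform in auto)
  have "(eisenstein_E2 (- 1 / z) ^ 2 - eisenstein_E4 (- 1 / z)) =
     (12 * z\<^sup>2 / ?c) * (?c * ((eisenstein_E2 (- 1 / z) ^ 2 - eisenstein_E4 (- 1 / z)) / 12) / z\<^sup>2)"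
    using z0 by simp
  also have "\<dots> = (12 * z\<^sup>2 / ?c) * ((z\<^sup>2 * (?c * ((eisenstein_E2 z ^ 2 - eisenstein_E4 z) / 12)) + 2 * z * eisenstein_E2 z)
      - 6 * \<i> / of_real pi)"
    unfolding DERIV_unique[OF 1 2] by simp
  finally have "eisenstein_E4 (- 1 / z) = (z\<^sup>2 * eisenstein_E2 z - 6 * \<i> * z / of_real pi) ^ 2 -
      (12 * z\<^sup>2 / ?c) * ((z\<^sup>2 * (?c * ((eisenstein_E2 z ^ 2 - eisenstein_E4 z) / 12)) + 2 * z * eisenstein_E2 z)
      - 6 * \<i> / of_real pi)"
    unfolding eisenstein_E2_transform[OF z] by (simp add: algebra_simps)
  also have "\<dots> = z ^ 4 * eisenstein_E4 z"
    using z0 by (simp add: field_simps eval_nat_numeral)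
  finally show ?thesis .
qed

lemma eisenstein_E6_inversion:
  assumes z: "Im z > 0"
  shows "eisenstein_E6 (- 1 / z) = z ^ 6 * eisenstein_E6 z"
proof -
  let ?c = "2 * of_real pi * \<i> :: complex"
  have z0: "z \<noteq> 0" using z by auto
  note z' = Im_minus_inverse[OF z]
  have 1: "((\<lambda>z. eisenstein_E4 (- 1 / z)) has_field_derivative
     ?c * ((eisenstein_E2 (- 1 / z) * eisenstein_E4 (- 1 / z) - eisenstein_E6 (- 1 / z)) / 3) / z\<^sup>2) (at z)"
    by (rule has_field_derivative_inversion[OF z has_field_derivative_E4[OF z']])
  have "((\<lambda>z. z ^ 4 * eisenstein_E4 z) has_field_derivative
     (z ^ 4 * (?c * ((eisenstein_E2 z * eisenstein_E4 z - eisenstein_E6 z) / 3)) + of_nat 4 * (1 * z ^ (4 - Suc 0)) * eisenstein_E4 z)) (at z)"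
    by (intro DERIV_mult' DERIV_power DERIV_ident has_field_derivative_E4 z)
  hence 2: "((\<lambda>z. eisenstein_E4 (- 1 / z)) has_field_derivative
     (z ^ 4 * (?c * ((eisenstein_E2 z * eisenstein_E4 z - eisenstein_E6 z) / 3)) + of_nat 4 * (1 * z ^ (4 - Suc 0)) * eisenstein_E4 z)) (at z)"
    by (rule has_field_derivative_transform_within_open[OF _ open_upper_halfplane])
       (use z eisenstein_E4_inversion in auto)
  have "(eisenstein_E2 (- 1 / z) * eisenstein_E4 (- 1 / z) - eisenstein_E6 (- 1 / z)) =
     (3 * z\<^sup>2 / ?c) * (?c * ((eisenstein_E2 (- 1 / z) * eisenstein_E4 (- 1 / z) - eisenstein_E6 (- 1 / z)) / 3) / z\<^sup>2)"
    using z0 by simp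
  also have "\<dots> = (3 * z\<^sup>2 / ?c) * (z ^ 4 * (?c * ((eisenstein_E2 z * eisenstein_E4 z - eisenstein_E6 z) / 3)) + 4 * z ^ 3 * eisenstein_E4 z)"
    unfolding DERIV_unique[OF 1 2] by simp
  finally have e: "eisenstein_E2 (- 1 / z) * eisenstein_E4 (- 1 / z) - eisenstein_E6 (- 1 / z) =
      (3 * z\<^sup>2 / ?c) * (z ^ 4 * (?c * ((eisenstein_E2 z * eisenstein_E4 z - eisenstein_E6 z) / 3)) + 4 * z ^ 3 * eisenstein_E4 z)" .
  have "b = a - d" if "a - b = d" for a b d :: complex using that by auto
  from this[OF e] have "eisenstein_E6 (- 1 / z) = (z\<^sup>2 * eisenstein_E2 z - 6 * \<i> * z / of_real pi) * (z ^ 4 * eisenstein_E4 z) -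
      (3 * z\<^sup>2 / ?c) * (z ^ 4 * (?c * ((eisenstein_E2 z * eisenstein_E4 z - eisenstein_E6 z) / 3)) + 4 * z ^ 3 * eisenstein_E4 z)"
    unfolding eisenstein_E2_transform[OF z] eisenstein_E4_inversion[OF z] .
  also have "\<dots> = z ^ 6 * eisenstein_E6 z"
    using z0 by (simp add: field_simps eval_nat_numeral)
  finally show ?thesis .
qed

lemma E_fun_0: "E2_fun 0 = 1" "E4_fun 0 = 1" "E6_fun 0 = 1"
  by (simp_all add: E2_fun_def E4_fun_def E6_fun_def)

text \<open>The one equation that is not a definition. Its defect \<open>w\<close> is modular of
  weight 8 and vanishes at the cusp, so \<open>w ^ 3 / Delta ^ 2\<close> has weight 0, is
  holomorphic at the cusp with value 0 there, and is therefore identically 0.\<close>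

lemma has_field_derivative_E6:
  assumes z: "Im z > 0"
  shows "(eisenstein_E6 has_field_derivative 2 * of_real pi * \<i> * ((eisenstein_E2 z * eisenstein_E6 z - eisenstein_E4 z ^ 2) / 2)) (at z)"
proof -
  let ?c = "2 * of_real pi * \<i> :: complex"
  let ?e = "\<lambda>z. exp (?c * z)"
  define W where "W = (\<lambda>q. q * deriv E6_fun q - (E2_fun q * E6_fun q - E4_fun q ^ 2) / 2)"
  define w where "w = (\<lambda>z. W (?e z))"
  have aW: "alg_holomorphic W"
  proof -
    have "W = (\<lambda>q. q * deriv E6_fun q - (E2_fun q * E6_fun q - E4_fun q ^ 2) * (1 / 2))" by (simp add: W_def)
    moreover have "algebraic (1 / 2 :: complex)" by (intro algebraic_divide) auto
    ultimately show ?thesis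
      by (simp only:) (intro alg_holomorphic_intros alg_holomorphic_E2_fun alg_holomorphic_E4_fun alg_holomorphic_E6_fun)
  qed
  have dE6: "(eisenstein_E6 has_field_derivative ?c * (w z + (eisenstein_E2 z * eisenstein_E6 z - eisenstein_E4 z ^ 2) / 2)) (at z)"
    if z: "Im z > 0" for z
    using has_field_derivative_qexp[where f = eisenstein_E6, OF alg_holomorphic_E6_fun z eisenstein_E6_def] z
    by (simp add: w_def W_def eisenstein_E2_eq eisenstein_E4_def eisenstein_E6_def)
  have wT: "w (z + 1) = w z" for z by (simp add: w_def distrib_left exp_add)
  have wS: "w (- 1 / z) = z ^ 8 * w z" if z: "Im z > 0" for z
  proof -
    have z0: "z \<noteq> 0" using z by auto
    note z' = Im_minus_inverse[OF z]
    let ?D = "\<lambda>z. w z + (eisenstein_E2 z * eisenstein_E6 z - eisenstein_E4 z ^ 2) / 2"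
    have 1: "((\<lambda>z. eisenstein_E6 (- 1 / z)) has_field_derivative ?c * ?D (- 1 / z) / z\<^sup>2) (at z)"
      by (rule has_field_derivative_inversion[OF z dE6[OF z']])
    have "((\<lambda>z. z ^ 6 * eisenstein_E6 z) has_field_derivative
       (z ^ 6 * (?c * ?D z) + of_nat 6 * (1 * z ^ (6 - Suc 0)) * eisenstein_E6 z)) (at z)"
      by (intro DERIV_mult' DERIV_power DERIV_ident dE6 z)
    hence 2: "((\<lambda>z. eisenstein_E6 (- 1 / z)) has_field_derivative
       (z ^ 6 * (?c * ?D z) + of_nat 6 * (1 * z ^ (6 - Suc 0)) * eisenstein_E6 z)) (at z)"
      by (rule has_field_derivative_transform_within_open[OF _ open_upper_halfplane])
         (use z eisenstein_E6_inversion in auto)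
    have "?D (- 1 / z) = (z\<^sup>2 / ?c) * (?c * ?D (- 1 / z) / z\<^sup>2)" using z0 by simp
    also have "\<dots> = (z\<^sup>2 / ?c) * (z ^ 6 * (?c * ?D z) + 6 * z ^ 5 * eisenstein_E6 z)"
      unfolding DERIV_unique[OF 1 2] by simp
    finally have "w (- 1 / z) = (z\<^sup>2 / ?c) * (z ^ 6 * (?c * ?D z) + 6 * z ^ 5 * eisenstein_E6 z)
      - ((z\<^sup>2 * eisenstein_E2 z - 6 * \<i> * z / of_real pi) * (z ^ 6 * eisenstein_E6 z) - (z ^ 4 * eisenstein_E4 z) ^ 2) / 2"
      unfolding eisenstein_E2_transform[OF z] eisenstein_E4_inversion[OF z] eisenstein_E6_inversion[OF z]
      by (simp add: algebra_simps)
    also have "\<dots> = z ^ 8 * w z"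
      using z0 by (simp add: field_simps eval_nat_numeral)
    finally show ?thesis .
  qed
  have "W 0 = 0" by (simp add: W_def E_fun_0)
  then obtain W1 where W1: "alg_holomorphic W1" "\<And>q. norm q < 1 \<Longrightarrow> W q = q * W1 q"
    using alg_holomorphic_shift[OF aW] by blast
  \<comment> \<open>\<open>W ^ 3\<close> contributes q^3 and Delta^2 takes away q^2, so one factor q
    is left and \<open>G 0 = 0\<close>.\<close>
  define G where "G = (\<lambda>q. q * W1 q ^ 3 * inverse (euler_prod q ^ 48))"
  have aG: "alg_holomorphic G"
    unfolding G_def by (intro alg_holomorphic_intros W1) (simp add: euler_prod_nonzero)
  have "w z ^ 3 / Ramanujan_Delta z ^ 2 = G 0"
  proof (rule modular_holomorphic_constant[where N = 1 and f = "\<lambda>z. w z ^ 3 / Ramanujan_Delta z ^ 2"])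
    fix z :: complex assume z: "Im z > 0"
    have z0: "z \<noteq> 0" using z by auto
    show "w (z + 1) ^ 3 / Ramanujan_Delta (z + 1) ^ 2 = w z ^ 3 / Ramanujan_Delta z ^ 2"
      by (simp add: wT Ramanujan_Delta_plus_1)
    have "(z ^ 8) ^ 3 = (z ^ 12) ^ 2" by (simp flip: power_mult)
    thus "w (- 1 / z) ^ 3 / Ramanujan_Delta (- 1 / z) ^ 2 = w z ^ 3 / Ramanujan_Delta z ^ 2"
      unfolding wS[OF z] Ramanujan_Delta_inversion[OF z] power_mult_distrib using z0 by simp
    have e: "W (?e z) = ?e z * W1 (?e z)" by (rule W1(2)[OF norm_qexp[OF z]])
    have "(?e z * x) ^ 3 / (?e z * y) ^ 2 = ?e z * x ^ 3 * inverse (y ^ 2)" for x y :: complex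
      by (simp add: eval_nat_numeral divide_simps)
    moreover have "(euler_prod (?e z) ^ 24) ^ 2 = euler_prod (?e z) ^ 48" by (simp flip: power_mult)
    ultimately show "w z ^ 3 / Ramanujan_Delta z ^ 2 = G (exp (2 * of_real pi * \<i> * z / of_nat 1))"
      unfolding w_def e Ramanujan_Delta_eq[OF z] G_def by simp
  qed (use alg_holomorphicD(1)[OF aG] z in auto)
  hence "w z = 0" using Ramanujan_Delta_nonzero[OF z] by (simp add: G_def)
  thus ?thesis using dE6[OF z] by simp
qed

text \<open>The quotient by Delta has weight 0 and no pole at the cusp, hence is constant. The
  constant comes from E2 = 1 - 24 q + ..., which yields E4 = 1 + 240 q + ... and E6 = 1 - 504 q +
  ..., so that 3 * 240 + 2 * 504 = 1728.\<close>

lemma E4_cubed_minus_E6_squared: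
  assumes z: "Im z > 0"
  shows "eisenstein_E4 z ^ 3 - eisenstein_E6 z ^ 2 = 1728 * Ramanujan_Delta z"
proof -
  let ?e = "\<lambda>z. exp (2 * of_real pi * \<i> * z)"
  define V where "V = (\<lambda>q. E4_fun q ^ 3 - E6_fun q ^ 2)"
  have aV: "alg_holomorphic V"
    unfolding V_def by (intro alg_holomorphic_intros alg_holomorphic_E4_fun alg_holomorphic_E6_fun)
  have "V 0 = 0" by (simp add: V_def E_fun_0)
  then obtain V1 where V1: "alg_holomorphic V1" "\<And>q. norm q < 1 \<Longrightarrow> V q = q * V1 q"
    using alg_holomorphic_shift[OF aV] by blast
  have d: "(g has_field_derivative deriv g 0) (at 0)" if "alg_holomorphic g" for g
    using holomorphic_derivI[OF alg_holomorphicD(1)[OF that] open_ball, of 0] by simp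
  have d0: "deriv (\<lambda>q. q * g q) 0 = g 0" if "alg_holomorphic g" for g
    using DERIV_mult'[OF DERIV_ident d[OF that]] by (simp add: DERIV_imp_deriv)
  have "deriv euler_prod 0 = - (\<Sum>k. of_nat (Suc k) * 0 ^ k / (1 - 0 ^ Suc k)) * euler_prod 0"
    by (rule DERIV_imp_deriv[OF has_field_derivative_euler_prod]) simp
  also have "(\<lambda>k. of_nat (Suc k) * 0 ^ k / (1 - 0 ^ Suc k)) = (\<lambda>k. if k = 0 then 1 else 0 :: complex)"
    by (auto simp: fun_eq_iff)
  also have "(\<Sum>k. if k = 0 then 1 else 0 :: complex) = 1"
    using sums_single[of 0 "\<lambda>_. 1 :: complex"] by (simp add: sums_iff)
  finally have dE: "deriv euler_prod 0 * inverse (euler_prod 0) = -1"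
    using euler_prod_nonzero[of 0] by simp
  have "((\<lambda>q. 1 + 24 * (q * (deriv euler_prod q * inverse (euler_prod q)))) has_field_derivative 0 + 24 * (- 1)) (at 0)"
  proof (intro DERIV_add DERIV_const DERIV_cmult)
    have "alg_holomorphic (\<lambda>q. deriv euler_prod q * inverse (euler_prod q))"
      by (intro alg_holomorphic_intros euler_prod_nonzero)
    from DERIV_mult'[OF DERIV_ident d[OF this]]
    show "((\<lambda>q. q * (deriv euler_prod q * inverse (euler_prod q))) has_field_derivative - 1) (at 0)"
      using dE by simp
  qed
  hence e2: "(E2_fun has_field_derivative - 24) (at 0)" unfolding E2_fun_def[abs_def] by (simp add: mult.assoc)
  have "((\<lambda>q. E2_fun q ^ 2 - 12 * (q * deriv E2_fun q)) has_field_derivative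
      of_nat 2 * (- 24 * E2_fun 0 ^ (2 - Suc 0)) - 12 * (0 * deriv (deriv E2_fun) 0 + 1 * deriv E2_fun 0)) (at 0)"
    by (intro DERIV_diff DERIV_power DERIV_cmult DERIV_mult' DERIV_ident e2 d alg_holomorphic_deriv alg_holomorphic_E2_fun)
  hence e4: "(E4_fun has_field_derivative 240) (at 0)"
    unfolding E4_fun_def[abs_def] by (simp add: E_fun_0 DERIV_imp_deriv[OF e2])
  have "((\<lambda>q. E2_fun q * E4_fun q - 3 * (q * deriv E4_fun q)) has_field_derivative
      (E2_fun 0 * 240 + - 24 * E4_fun 0) - 3 * (0 * deriv (deriv E4_fun) 0 + 1 * deriv E4_fun 0)) (at 0)"
    by (intro DERIV_diff DERIV_cmult DERIV_mult' DERIV_ident e2 e4 d alg_holomorphic_deriv alg_holomorphic_E4_fun)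
  hence e6: "(E6_fun has_field_derivative - 504) (at 0)"
    unfolding E6_fun_def[abs_def] by (simp add: E_fun_0 DERIV_imp_deriv[OF e4])
  have "(V has_field_derivative of_nat 3 * (240 * E4_fun 0 ^ (3 - Suc 0)) - of_nat 2 * (- 504 * E6_fun 0 ^ (2 - Suc 0))) (at 0)"
    unfolding V_def by (intro DERIV_diff DERIV_power e4 e6)
  hence "(V has_field_derivative 1728) (at 0)" by (simp add: E_fun_0)
  moreover have "((\<lambda>q. q * V1 q) has_field_derivative V1 0) (at 0)"
    using DERIV_mult'[OF DERIV_ident d[OF V1(1)]] by simp
  hence "(V has_field_derivative V1 0) (at 0)"
    by (rule has_field_derivative_transform_within_open[where S = "ball 0 1"]) (use V1(2) in auto)
  ultimately have V10: "V1 0 = 1728" by (metis DERIV_unique)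
  define G where "G = (\<lambda>q. V1 q * inverse (euler_prod q ^ 24))"
  have aG: "alg_holomorphic G"
    unfolding G_def by (intro alg_holomorphic_intros V1) (simp add: euler_prod_nonzero)
  have "(eisenstein_E4 z ^ 3 - eisenstein_E6 z ^ 2) / Ramanujan_Delta z = G 0"
  proof (rule modular_holomorphic_constant[where N = 1 and f = "\<lambda>z. (eisenstein_E4 z ^ 3 - eisenstein_E6 z ^ 2) / Ramanujan_Delta z"])
    fix z :: complex assume z: "Im z > 0"
    have z0: "z \<noteq> 0" using z by auto
    show "(eisenstein_E4 (z + 1) ^ 3 - eisenstein_E6 (z + 1) ^ 2) / Ramanujan_Delta (z + 1) =
        (eisenstein_E4 z ^ 3 - eisenstein_E6 z ^ 2) / Ramanujan_Delta z"
      by (simp add: eisenstein_E4_plus_1 eisenstein_E6_plus_1 Ramanujan_Delta_plus_1)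
    have "(z ^ 4 * eisenstein_E4 z) ^ 3 - (z ^ 6 * eisenstein_E6 z) ^ 2 = z ^ 12 * (eisenstein_E4 z ^ 3 - eisenstein_E6 z ^ 2)"
      by (simp add: power_mult_distrib power_mult[symmetric] right_diff_distrib)
    thus "(eisenstein_E4 (- 1 / z) ^ 3 - eisenstein_E6 (- 1 / z) ^ 2) / Ramanujan_Delta (- 1 / z) =
        (eisenstein_E4 z ^ 3 - eisenstein_E6 z ^ 2) / Ramanujan_Delta z"
      unfolding eisenstein_E4_inversion[OF z] eisenstein_E6_inversion[OF z] Ramanujan_Delta_inversion[OF z]
      using z0 by simp
    have "eisenstein_E4 z ^ 3 - eisenstein_E6 z ^ 2 = ?e z * V1 (?e z)"
      using V1(2)[OF norm_qexp[OF z]] by (simp add: V_def eisenstein_E4_def eisenstein_E6_def)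
    thus "(eisenstein_E4 z ^ 3 - eisenstein_E6 z ^ 2) / Ramanujan_Delta z = G (exp (2 * of_real pi * \<i> * z / of_nat 1))"
      unfolding Ramanujan_Delta_eq[OF z] G_def by (simp add: divide_inverse)
  qed (use alg_holomorphicD(1)[OF aG] z in auto)
  moreover have "euler_prod 0 = 1"
    unfolding euler_prod_def by simp
  ultimately show ?thesis using Ramanujan_Delta_nonzero[OF z] by (simp add: G_def V10 field_simps)
qed

section \<open>Modular functions with algebraic expansions\<close>

definition modular_j :: "complex \<Rightarrow> complex" where
  "modular_j z = eisenstein_E4 z ^ 3 / Ramanujan_Delta z"

abbreviation qexp :: "nat \<Rightarrow> complex \<Rightarrow> complex" where
  "qexp N z \<equiv> exp (2 * of_real pi * \<i> * z / of_nat N)"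

lemma qexp_power: "N > 0 \<Longrightarrow> qexp N z ^ N = exp (2 * of_real pi * \<i> * z)"
  by (simp add: exp_of_nat_mult[symmetric])

lemma modular_j_plus_1: "modular_j (z + 1) = modular_j z"
  by (simp add: modular_j_def eisenstein_E4_plus_1 Ramanujan_Delta_plus_1)

lemma modular_j_inversion: "Im z > 0 \<Longrightarrow> modular_j (- 1 / z) = modular_j z"
  unfolding modular_j_def eisenstein_E4_inversion Ramanujan_Delta_inversion power_mult_distrib
  by (auto simp flip: power_mult)

definition j_fun :: "complex \<Rightarrow> complex" where
  "j_fun q = E4_fun q ^ 3 * inverse (euler_prod q ^ 24)"

lemma alg_holomorphic_j_fun: "alg_holomorphic j_fun"
  unfolding j_fun_def[abs_def] by (intro alg_holomorphic_intros alg_holomorphic_E4_fun) (simp add: euler_prod_nonzero)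

lemma euler_prod_0 [simp]: "euler_prod 0 = 1"
  unfolding euler_prod_def by simp

lemma j_fun_0: "j_fun 0 = 1"
  by (simp add: j_fun_def E_fun_0)

lemma modular_j_eq:
  assumes "Im z > 0" "N > 0"
  shows "modular_j z = j_fun (qexp N z ^ N) / qexp N z ^ N"
  unfolding qexp_power[OF assms(2)] modular_j_def eisenstein_E4_def Ramanujan_Delta_eq[OF assms(1)] j_fun_def
  by (simp add: divide_inverse)

text \<open>Expansions in the N-th root of q with algebraic coefficients and finitely many negative
  powers. Holomorphy of \<open>G\<close> on the whole disc also excludes poles in the
  half-plane.\<close>

definition qmeromorphic :: "nat \<Rightarrow> (complex \<Rightarrow> complex) \<Rightarrow> bool" where
  "qmeromorphic N f \<longleftrightarrow> (\<exists>k G. alg_holomorphic G \<and> (\<forall>z. Im z > 0 \<longrightarrow> f z = G (qexp N z) / qexp N z ^ k))"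

lemma qmeromorphic_const: "algebraic c \<Longrightarrow> qmeromorphic N (\<lambda>_. c)"
  unfolding qmeromorphic_def by (intro exI[of _ 0] exI[of _ "\<lambda>_. c"]) (auto intro: alg_holomorphic_const)

lemma qmeromorphic_mult:
  assumes "qmeromorphic N f" "qmeromorphic N g"
  shows "qmeromorphic N (\<lambda>z. f z * g z)"
proof -
  obtain k F l G where F: "alg_holomorphic F" "\<And>z. Im z > 0 \<Longrightarrow> f z = F (qexp N z) / qexp N z ^ k"
    and G: "alg_holomorphic G" "\<And>z. Im z > 0 \<Longrightarrow> g z = G (qexp N z) / qexp N z ^ l"
    using assms unfolding qmeromorphic_def by blast
  show ?thesis unfolding qmeromorphic_def
    by (rule exI[of _ "k + l"], rule exI[of _ "\<lambda>x. F x * G x"])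
       (use F G in \<open>auto intro!: alg_holomorphic_mult simp: power_add\<close>)
qed

lemma qmeromorphic_add:
  assumes "qmeromorphic N f" "qmeromorphic N g"
  shows "qmeromorphic N (\<lambda>z. f z + g z)"
proof -
  obtain k F l G where F: "alg_holomorphic F" "\<And>z. Im z > 0 \<Longrightarrow> f z = F (qexp N z) / qexp N z ^ k"
    and G: "alg_holomorphic G" "\<And>z. Im z > 0 \<Longrightarrow> g z = G (qexp N z) / qexp N z ^ l"
    using assms unfolding qmeromorphic_def by blast
  have e: "a / x ^ k + b / x ^ l = (a * x ^ l + b * x ^ k) / x ^ (k + l)" if "x \<noteq> 0" for a b x :: complex
    using that by (simp add: power_add field_simps)
  show ?thesis unfolding qmeromorphic_def
  proof (intro exI conjI allI impI)
    show "alg_holomorphic (\<lambda>x. F x * x ^ l + G x * x ^ k)"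
      by (intro alg_holomorphic_intros F G)
    show "f z + g z = (F (qexp N z) * qexp N z ^ l + G (qexp N z) * qexp N z ^ k) / qexp N z ^ (k + l)"
      if "Im z > 0" for z
      unfolding F(2)[OF that] G(2)[OF that] by (rule e) simp
  qed
qed

lemma qmeromorphic_diff:
  assumes "qmeromorphic N f" "qmeromorphic N g"
  shows "qmeromorphic N (\<lambda>z. f z - g z)"
  using qmeromorphic_add[OF assms(1) qmeromorphic_mult[OF qmeromorphic_const[of "-1"] assms(2)]]
  by simp

text \<open>Induction on the pole order at the cusp: a power of j times the leading coefficient
  removes the leading term, and without a pole the function is constant. The leading coefficients
  are algebraic, hence so is the polynomial.\<close>

lemma modular_function_poly_j:
  assumes T: "\<And>z. Im z > 0 \<Longrightarrow> f (z + 1) = f z" and S: "\<And>z. Im z > 0 \<Longrightarrow> f (- 1 / z) = f z"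
    and N: "N > 0" and f: "qmeromorphic N f"
  shows "\<exists>p. (\<forall>i. algebraic (coeff p i)) \<and> (\<forall>z. Im z > 0 \<longrightarrow> f z = poly p (modular_j z))"
proof -
  obtain k G where "alg_holomorphic G" "\<And>z. Im z > 0 \<Longrightarrow> f z = G (qexp N z) / qexp N z ^ k"
    using f unfolding qmeromorphic_def by blast
  thus ?thesis using T S
  proof (induction k arbitrary: f G)
    case 0
    have "f z = G 0" if "Im z > 0" for z
      by (rule modular_holomorphic_constant[where f = f and N = N and G = G, OF 0(3,4) _ _ N that])
         (use 0(1,2) alg_holomorphicD in auto)
    moreover have "algebraic (G 0)" by (rule alg_holomorphic_at_0[OF 0(1)])
    ultimately show ?case by (intro exI[of _ "[:G 0:]"]) (auto simp: coeff_pCons split: nat.splits)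
  next
    case (Suc k)
    \<comment> \<open>Invariance under z + 1 reads G(zeta x) = zeta^(k+1) G(x) with zeta = e^(2 pi
      i/N). Letting x tend to 0 gives zeta^(k+1) = 1 unless \<open>G 0 = 0\<close>.\<close>
    have dvd: "N dvd Suc k" if "G 0 \<noteq> 0"
    proof -
      define \<zeta> where "\<zeta> = exp (2 * of_real pi * \<i> / of_nat N)"
      have G: "G (\<zeta> * x) = \<zeta> ^ Suc k * G x" if x: "x \<noteq> 0" "norm x < 1" for x
      proof -
        obtain z where z: "Im z > 0" "x = qexp N z" using qexp_surj[OF x N] by blast
        have "qexp N (z + 1) = \<zeta> * x"
          by (simp add: z \<zeta>_def exp_add[symmetric] add_divide_distrib distrib_left add.commute)
        moreover have "Im (z + 1) > 0" using z by simp
        ultimately have "G (\<zeta> * x) / (\<zeta> * x) ^ Suc k = G x / x ^ Suc k"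
          using Suc.prems(2)[of "z + 1"] Suc.prems(2)[of z] Suc.prems(3)[of z] z by simp
        thus ?thesis using x by (simp add: \<zeta>_def power_mult_distrib field_simps)
      qed
      have cont: "isCont G 0"
        using holomorphic_on_imp_continuous_on[OF alg_holomorphicD(1)[OF Suc.prems(1)]]
        by (simp add: continuous_on_eq_continuous_at)
      have "((\<lambda>x. G (\<zeta> * x)) \<longlongrightarrow> G (\<zeta> * 0)) (at 0)"
        using cont by (intro isCont_tendsto_compose[of _ G] tendsto_intros) auto
      hence 1: "((\<lambda>x. G (\<zeta> * x)) \<longlongrightarrow> G 0) (at 0)" by simp
      have 2: "((\<lambda>x. \<zeta> ^ Suc k * G x) \<longlongrightarrow> \<zeta> ^ Suc k * G 0) (at 0)"
        using cont by (intro tendsto_intros) (auto simp: isCont_def)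
      have "eventually (\<lambda>x. \<zeta> ^ Suc k * G x = G (\<zeta> * x)) (at 0)"
        unfolding eventually_at using G by (intro exI[of _ 1]) auto
      from tendsto_unique[OF _ tendsto_cong[THEN iffD1, OF this 2] 1]
      have "\<zeta> ^ Suc k = 1" using that by simp
      hence "exp (2 * of_real pi * \<i> * of_nat (Suc k) / of_nat N) = 1"
        unfolding \<zeta>_def exp_of_nat_mult[symmetric] by (simp add: mult_ac)
      then obtain n :: int where "2 * pi * real (Suc k) / real N = of_int (2 * n) * pi"
        unfolding exp_eq_1 by (auto simp: Im_divide_of_nat)
      hence "(2 * pi) * real (Suc k) = (2 * pi) * (of_int n * real N)"
        using N by (simp add: field_simps)
      hence "real (Suc k) = of_int n * real N" by (subst (asm) mult_left_cancel) auto
      hence "int (Suc k) = n * int N" by (metis of_int_eq_iff of_int_mult of_int_of_nat_eq)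
      thus ?thesis by (metis dvd_triv_right int_dvd_int_iff)
    qed
    \<comment> \<open>The division is exact if \<open>G 0 \<noteq> 0\<close>; otherwise the
      subtracted term is 0 for any \<open>m\<close>.\<close>
    define m where "m = Suc k div N"
    define f' where "f' = (\<lambda>z. f z - G 0 * modular_j z ^ m)"
    define G' where "G' = (\<lambda>x. G x - G 0 * j_fun (1 * x ^ N) ^ m)"
    have aG0: "algebraic (G 0)" by (rule alg_holomorphic_at_0[OF Suc.prems(1)])
    have aG': "alg_holomorphic G'" unfolding G'_def
      by (intro alg_holomorphic_intros Suc.prems aG0 alg_holomorphic_compose_monomial alg_holomorphic_j_fun N) auto
    have "G' 0 = 0" using N by (simp add: G'_def j_fun_0 zero_power)
    then obtain H where H: "alg_holomorphic H" "\<And>x. norm x < 1 \<Longrightarrow> G' x = x * H x"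
      using alg_holomorphic_shift[OF aG'] by blast
    have "f' z = H (qexp N z) / qexp N z ^ k" if z: "Im z > 0" for z
    proof -
      let ?x = "qexp N z"
      have "G 0 * modular_j z ^ m = G 0 * j_fun (1 * ?x ^ N) ^ m / ?x ^ Suc k"
      proof (cases "G 0 = 0")
        case False
        hence "N * m = Suc k" using dvd by (simp add: m_def)
        thus ?thesis unfolding modular_j_eq[OF z N] by (simp add: power_divide power_mult[symmetric] del: power_Suc)
      qed simp
      hence "f' z = G' ?x / ?x ^ Suc k"
        unfolding f'_def Suc.prems(2)[OF z] G'_def by (simp add: diff_divide_distrib)
      thus ?thesis using H(2)[OF norm_qexp_lt_1[OF z N]] by simp
    qed
    moreover have "f' (z + 1) = f' z" "f' (- 1 / z) = f' z" if z: "Im z > 0" for z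
      unfolding f'_def modular_j_plus_1 modular_j_inversion[OF z] Suc.prems(3)[OF z] Suc.prems(4)[OF z] by simp_all
    ultimately obtain p where p: "\<And>i. algebraic (coeff p i)" "\<And>z. Im z > 0 \<Longrightarrow> f' z = poly p (modular_j z)"
      using Suc.IH[OF H(1), of f'] by blast
    show ?case
      by (rule exI[of _ "p + monom (G 0) m"])
         (use p aG0 in \<open>auto simp: poly_monom f'_def algebraic_add algebra_simps\<close>)
  qed
qed

section \<open>Finite families permuted by the modular group\<close>

text \<open>Setting functions to zero off the half-plane makes equality on the half-plane plain equality, so that
  a family of functions can be a finite set.\<close>
definition on_halfplane :: "(complex \<Rightarrow> complex) \<Rightarrow> complex \<Rightarrow> complex" where
  "on_halfplane f z = (if Im z > 0 then f z else 0)"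

definition modular_family :: "nat \<Rightarrow> (complex \<Rightarrow> complex) set \<Rightarrow> bool" where
  "modular_family N F \<longleftrightarrow> N > 0 \<and> finite F \<and> (\<forall>f\<in>F. on_halfplane f = f \<and> qmeromorphic N f \<and>
     on_halfplane (\<lambda>z. f (z + 1)) \<in> F \<and> on_halfplane (\<lambda>z. f (- 1 / z)) \<in> F)"

text \<open>Each of the two maps can be undone on the half-plane, so it is injective, and an
  injective self-map of a finite set is onto. Closure under the two generators alone therefore
  suffices.\<close>

lemma modular_family_bij:
  assumes "modular_family N F"
  shows "bij_betw (\<lambda>f. on_halfplane (\<lambda>z. f (z + 1))) F F" "bij_betw (\<lambda>f. on_halfplane (\<lambda>z. f (- 1 / z))) F F"
proof -
  have fin: "finite F" using assms by (simp add: modular_family_def)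
  have out: "f z = 0" if "f \<in> F" "Im z \<le> 0" for f z
  proof -
    have "f = on_halfplane f" using that assms by (simp add: modular_family_def)
    hence "f z = on_halfplane f z" by (rule fun_cong)
    thus ?thesis using that by (simp add: on_halfplane_def)
  qed
  have *: "bij_betw g F F" if "g ` F \<subseteq> F" "inj_on g F" for g
    using that fin by (simp add: bij_betw_def endo_inj_surj)
  show "bij_betw (\<lambda>f. on_halfplane (\<lambda>z. f (z + 1))) F F"
  proof (rule *)
    show "inj_on (\<lambda>f. on_halfplane (\<lambda>z. f (z + 1))) F"
    proof (rule inj_onI, rule ext)
      fix f g z assume fg: "f \<in> F" "g \<in> F" "on_halfplane (\<lambda>z. f (z + 1)) = on_halfplane (\<lambda>z. g (z + 1))"
      show "f z = g z"
        using fun_cong[OF fg(3), of "z - 1"] out[OF fg(1), of z] out[OF fg(2), of z]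
        by (cases "Im z > 0") (auto simp: on_halfplane_def)
    qed
  qed (use assms in \<open>auto simp: modular_family_def\<close>)
  show "bij_betw (\<lambda>f. on_halfplane (\<lambda>z. f (- 1 / z))) F F"
  proof (rule *)
    show "inj_on (\<lambda>f. on_halfplane (\<lambda>z. f (- 1 / z))) F"
    proof (rule inj_onI, rule ext)
      fix f g z assume fg: "f \<in> F" "g \<in> F" "on_halfplane (\<lambda>z. f (- 1 / z)) = on_halfplane (\<lambda>z. g (- 1 / z))"
      show "f z = g z"
        using fun_cong[OF fg(3), of "- 1 / z"] out[OF fg(1), of z] out[OF fg(2), of z] Im_minus_inverse[of z]
        by (cases "Im z > 0") (auto simp: on_halfplane_def)
    qed
  qed (use assms in \<open>auto simp: modular_family_def\<close>)
qed

lemma modular_family_prod: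
  assumes F: "modular_family N F" and z: "Im z > 0"
  shows "(\<Prod>f\<in>F. h (f (z + 1))) = (\<Prod>f\<in>F. h (f z) :: 'a :: comm_monoid_mult)"
    "(\<Prod>f\<in>F. h (f (- 1 / z))) = (\<Prod>f\<in>F. h (f z))"
  using prod.reindex_bij_betw[OF modular_family_bij(1)[OF F], of "\<lambda>f. h (f z)"]
    prod.reindex_bij_betw[OF modular_family_bij(2)[OF F], of "\<lambda>f. h (f z)"] z
  by (simp_all add: on_halfplane_def)

lemma modular_family_norm:
  assumes F: "modular_family N F" and c: "algebraic c"
  shows "\<exists>p. (\<forall>i. algebraic (coeff p i)) \<and> (\<forall>z. Im z > 0 \<longrightarrow> (\<Prod>f\<in>F. c - f z) = poly p (modular_j z))"
proof (rule modular_function_poly_j[where N = N])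
  have "finite F" "N > 0" "\<And>f. f \<in> F \<Longrightarrow> qmeromorphic N f" using F by (auto simp: modular_family_def)
  thus "qmeromorphic N (\<lambda>z. \<Prod>f\<in>F. c - f z)" "N > 0"
    by (induction F rule: finite_induct)
       (auto intro!: qmeromorphic_const qmeromorphic_mult qmeromorphic_diff c)
qed (use modular_family_prod[OF F, of _ "\<lambda>x. c - x"] in auto)

text \<open>The monic polynomial with roots \<open>f z\<close> has coefficients invariant under the
  modular group, so they are polynomials in j with algebraic coefficients. At \<open>z0\<close> it
  is a nonzero polynomial over the algebraic numbers with root \<open>f z0\<close>.\<close>

lemma modular_family_algebraic:
  assumes F: "modular_family N F" and f: "f \<in> F" and z0: "Im z0 > 0" and j: "algebraic (modular_j z0)"
  shows "algebraic (f z0)"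
proof -
  define P where "P = (\<lambda>z. \<Prod>f\<in>F. [:- f z, 1:])"
  have fin: "finite F" and N: "N > 0" using F by (auto simp: modular_family_def)
  have q: "qmeromorphic N (\<lambda>z. coeff (P z) i)" for i
  proof -
    have "\<And>f. f \<in> F \<Longrightarrow> qmeromorphic N f" using F by (auto simp: modular_family_def)
    with fin show ?thesis unfolding P_def
    proof (induction F arbitrary: i rule: finite_induct)
      case empty show ?case by (auto intro!: qmeromorphic_const simp: coeff_1)
    next
      case (insert f F)
      have IH: "qmeromorphic N (\<lambda>z. coeff (\<Prod>f\<in>F. [:- f z, 1:]) i)" for i
        using insert by blast
      have "(\<lambda>z. coeff (\<Prod>f\<in>insert f F. [:- f z, 1:]) i) =
        (\<lambda>z. (case i of 0 \<Rightarrow> 0 | Suc n \<Rightarrow> coeff (\<Prod>f\<in>F. [:- f z, 1:]) n) - f z * coeff (\<Prod>f\<in>F. [:- f z, 1:]) i)"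
        using insert.hyps by (auto simp: coeff_pCons split: nat.splits)
      moreover have "qmeromorphic N (\<lambda>z. case i of 0 \<Rightarrow> 0 | Suc n \<Rightarrow> coeff (\<Prod>f\<in>F. [:- f z, 1:]) n)"
        by (cases i) (auto intro!: qmeromorphic_const IH)
      ultimately show ?case using IH insert.prems
        by (simp only:) (intro qmeromorphic_diff qmeromorphic_mult; simp)
    qed
  qed
  have "algebraic (coeff (P z0) i)" for i
  proof -
    have "\<exists>p. (\<forall>i. algebraic (coeff p i)) \<and> (\<forall>z. Im z > 0 \<longrightarrow> coeff (P z) i = poly p (modular_j z))"
      using modular_family_prod[OF F, of _ "\<lambda>x. [:- x, 1:]"]
      by (intro modular_function_poly_j[OF _ _ N q]) (auto simp: P_def)
    thus ?thesis using z0 algebraic_poly[OF _ j] by metis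
  qed
  moreover have "P z0 \<noteq> 0" unfolding P_def using fin by (auto simp: prod_zero_iff)
  moreover have "poly (P z0) (f z0) = 0"
    unfolding P_def poly_prod using fin f by (auto intro!: prod_zero)
  ultimately show ?thesis using algebraic_poly_root[of "P z0"] by blast
qed

section \<open>Hecke families and algebraicity at CM points\<close>

text \<open>\<open>Delta|M / Delta\<close> without the factor \<open>det M ^ 6\<close>, which would
  only be a rational constant.\<close>

definition delta_quotient :: "int \<Rightarrow> int \<Rightarrow> int \<Rightarrow> int \<Rightarrow> complex \<Rightarrow> complex" where
  "delta_quotient a b c d z = Ramanujan_Delta ((of_int a * z + of_int b) / (of_int c * z + of_int d))
     / ((of_int c * z + of_int d) ^ 12 * Ramanujan_Delta z)"

lemma linear_form_nonzero:
  assumes "Im z > 0" "a * d - b * c > (0::int)"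
  shows "of_int c * z + of_int d \<noteq> (0::complex)"
proof
  assume 0: "of_int c * z + of_int d = 0"
  hence "Im (of_int c * z + of_int d) = 0" by simp
  hence "c = 0" using assms by simp
  thus False using 0 assms by simp
qed

lemma Im_moebius_int:
  assumes z: "Im z > 0" and det: "a * d - b * c > (0::int)"
  shows "Im ((of_int a * z + of_int b) / (of_int c * z + of_int d)) =
    of_int (a * d - b * c) * Im z / (norm (of_int c * z + of_int d))\<^sup>2"
proof -
  have "Im ((of_int a * z + of_int b) / (of_int c * z + of_int d)) =
     Im ((of_int a * z + of_int b) * cnj (of_int c * z + of_int d)) / (norm (of_int c * z + of_int d))\<^sup>2"
    by (subst complex_div_cnj) (simp only: Im_divide_of_real flip: of_real_power)
  also have "Im ((of_int a * z + of_int b) * cnj (of_int c * z + of_int d)) = of_int (a * d - b * c) * Im z"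
    by (simp add: algebra_simps)
  finally show ?thesis .
qed

lemma Im_moebius_int_pos:
  assumes "Im z > 0" "a * d - b * c > (0::int)"
  shows "Im ((of_int a * z + of_int b) / (of_int c * z + of_int d)) > 0"
proof -
  have "real_of_int (a * d - b * c) > 0" using assms(2) by (simp only: of_int_0_less_iff)
  moreover have "(norm (of_int c * z + of_int d))\<^sup>2 > 0" using linear_form_nonzero[OF assms] by simp
  ultimately show ?thesis
    unfolding Im_moebius_int[OF assms] using assms(1) by (intro divide_pos_pos mult_pos_pos)
qed

text \<open>Translating the argument multiplies the matrix by a generator from the right, as
  inversion does in the next lemma; this permutes the matrices of given determinant.\<close>

lemma delta_quotient_plus_1: "delta_quotient a b c d (z + 1) = delta_quotient a (a + b) c (c + d) z"
  unfolding delta_quotient_def Ramanujan_Delta_plus_1 by (simp add: algebra_simps)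

lemma delta_quotient_inversion:
  assumes z: "Im z > 0"
  shows "delta_quotient a b c d (- 1 / z) = delta_quotient b (- a) d (- c) z"
proof -
  have z0: "z \<noteq> 0" using z by auto
  have 1: "of_int a * (- 1 / z) + of_int b = (of_int b * z + of_int (- a)) / z" for a b
    using z0 by (simp add: field_simps)
  show ?thesis unfolding delta_quotient_def 1 Ramanujan_Delta_inversion[OF z] power_divide
    using z0 by simp
qed

text \<open>Multiplication by a modular matrix from the left changes nothing, by the modularity of
  Delta. Only left cosets matter, and these are finite in number for given determinant.\<close>

lemma delta_quotient_left_plus_1:
  assumes z: "Im z > 0" and det: "a * d - b * c > 0"
  shows "delta_quotient (a + c) (b + d) c d z = delta_quotient a b c d z"
proof -
  let ?j = "of_int c * z + of_int d"
  have "?j \<noteq> 0" using linear_form_nonzero[OF assms] .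
  hence "(of_int (a + c) * z + of_int (b + d)) / ?j = (of_int a * z + of_int b) / ?j + 1"
    by (simp add: field_simps)
  thus ?thesis unfolding delta_quotient_def by (simp only: Ramanujan_Delta_plus_1)
qed

lemma delta_quotient_left_shift:
  assumes z: "Im z > 0" and det: "a * d - b * c > 0"
  shows "delta_quotient (a + n * c) (b + n * d) c d z = delta_quotient a b c d z"
proof -
  have nat: "delta_quotient (a + int k * c) (b + int k * d) c d z = delta_quotient a b c d z"
    if det: "a * d - b * c > 0" for k a b
  proof (induction k)
    case (Suc k)
    have "(a + int k * c) * d - (b + int k * d) * c > 0" using det by (simp add: algebra_simps)
    from delta_quotient_left_plus_1[OF z this] Suc show ?case by (simp add: algebra_simps)
  qed simp
  show ?thesis
  proof (cases "n \<ge> 0")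
    case True thus ?thesis using nat[OF det, of "nat n"] by simp
  next
    case False
    have "(a + n * c) * d - (b + n * d) * c > 0" using det by (simp add: algebra_simps)
    from nat[OF this, of "nat (- n)"] False show ?thesis by (simp add: algebra_simps)
  qed
qed

lemma delta_quotient_left_inversion:
  assumes z: "Im z > 0" and det: "a * d - b * c > 0"
  shows "delta_quotient (- c) (- d) a b z = delta_quotient a b c d z"
proof -
  let ?n = "of_int a * z + of_int b" and ?j = "of_int c * z + of_int d"
  have j: "?j \<noteq> 0" using linear_form_nonzero[OF assms] .
  have I: "Im (?n / ?j) > 0" by (rule Im_moebius_int_pos[OF assms])
  hence n: "?n \<noteq> 0" by auto
  have "(of_int (- c) * z + of_int (- d)) / ?n = - 1 / (?n / ?j)" using n j by (simp add: field_simps)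
  thus ?thesis unfolding delta_quotient_def
    by (simp only: Ramanujan_Delta_inversion[OF I] power_divide) (use n j in simp)
qed

lemma delta_quotient_minus: "delta_quotient (- a) (- b) (- c) (- d) z = delta_quotient a b c d z"
proof -
  have e: "of_int (- a) * z + of_int (- b) = - (of_int a * z + of_int b)" for a b
    by simp
  have "(- x) ^ 12 = x ^ 12" "(- x) / (- y) = x / y" for x y :: complex by simp_all
  thus ?thesis unfolding delta_quotient_def e by (simp only:)
qed

text \<open>Hermite normal form: the Euclidean algorithm on the first column, by multiplications
  from the left, reduces the lower left entry to 0; a sign change and a translation then normalise
  \<open>a\<close> and \<open>b\<close>.\<close>

lemma delta_quotient_triangular:
  assumes "a * d - b * c = N" "N > 0"
  shows "\<exists>a' b' d'. a' * d' = N \<and> 0 < a' \<and> 0 \<le> b' \<and> b' < d' \<and>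
     (\<forall>z. Im z > 0 \<longrightarrow> delta_quotient a b c d z = delta_quotient a' b' 0 d' z)"
  using assms
proof (induction "nat \<bar>c\<bar>" arbitrary: a b c d rule: less_induct)
  case less
  show ?case
  proof (cases "c = 0")
    case False
    define n where "n = - (a div c)"
    have am: "a + n * c = a mod c" using minus_div_mult_eq_mod[of a c] by (simp add: n_def)
    have eq: "delta_quotient a b c d z = delta_quotient (- c) (- d) (a mod c) (b + n * d) z" if z: "Im z > 0" for z
    proof -
      have "(a + n * c) * d - (b + n * d) * c > 0" using less.prems by (simp add: algebra_simps)
      from delta_quotient_left_inversion[OF z this] delta_quotient_left_shift[OF z, of a d b c n] less.prems
      show ?thesis unfolding am by simp
    qed
    have det: "(- c) * (b + n * d) - (- d) * (a mod c) = N"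
      using less.prems(1) unfolding am[symmetric] by (simp add: algebra_simps)
    have "nat \<bar>a mod c\<bar> < nat \<bar>c\<bar>" using abs_mod_less[OF False, of a] by simp
    from less.hyps[OF this det less.prems(2)] eq show ?thesis by auto
  next
    case True
    have tri: "\<exists>a' b' d'. a' * d' = N \<and> 0 < a' \<and> 0 \<le> b' \<and> b' < d' \<and>
     (\<forall>z. Im z > 0 \<longrightarrow> delta_quotient a b 0 d z = delta_quotient a' b' 0 d' z)" if "a > 0" "a * d = N" for a b d
    proof -
      have d: "d > 0" using that less.prems(2) by (metis zero_less_mult_pos)
      define n where "n = - (b div d)"
      have bm: "b + n * d = b mod d" using minus_div_mult_eq_mod[of b d] by (simp add: n_def)
      have "delta_quotient a b 0 d z = delta_quotient a (b mod d) 0 d z" if "Im z > 0" for z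
        using delta_quotient_left_shift[OF that, of a d b 0 n] \<open>a * d = N\<close> less.prems(2) by (simp add: bm)
      thus ?thesis using that d by (intro exI[of _ a] exI[of _ "b mod d"] exI[of _ d]) auto
    qed
    show ?thesis
    proof (cases "a > 0")
      case True thus ?thesis using tri[of a d b] less.prems \<open>c = 0\<close> by simp
    next
      case False
      hence "- a > 0" using less.prems \<open>c = 0\<close> by (cases "a = 0") auto
      from tri[OF this, of "- d" "- b"] delta_quotient_minus[of a b 0 d] less.prems \<open>c = 0\<close>
      show ?thesis by simp
    qed
  qed
qed

definition tri_root :: "int \<Rightarrow> int \<Rightarrow> complex" where
  "tri_root b d = exp (2 * of_real pi * \<i> * of_int b / of_int d)"

lemma norm_tri_root: "norm (tri_root b d) = 1"
  unfolding tri_root_def norm_exp_eq_Re by simp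

lemma algebraic_tri_root:
  assumes "d > 0"
  shows "algebraic (tri_root b d)"
proof -
  have "of_nat (nat d) = (of_int d :: complex)" using assms by (simp add: of_nat_nat)
  hence e: "of_nat (nat d) * (2 * of_real pi * \<i> * of_int b / of_int d) = 2 * of_int b * of_real pi * \<i>"
    using assms by simp
  have "tri_root b d ^ nat d = exp (of_nat (nat d) * (2 * of_real pi * \<i> * of_int b / of_int d))"
    unfolding tri_root_def exp_of_nat_mult ..
  also have "\<dots> = 1" unfolding e using exp_integer_2pi[of "real_of_int b"] by simp
  finally have "poly (monom 1 (nat d) - 1) (tri_root b d) = 0" by (simp add: poly_monom)
  moreover have "coeff (monom 1 (nat d) - 1) (nat d) = (1 :: complex)" using assms by (simp add: coeff_1)
  hence "monom 1 (nat d) - 1 \<noteq> (0 :: complex poly)" by (metis coeff_0 zero_neq_one)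
  moreover have "algebraic (coeff (monom 1 (nat d) - 1) i :: complex)" for i
    unfolding coeff_diff coeff_monom coeff_1 by (rule algebraic_diff) auto
  ultimately show ?thesis using algebraic_poly_root by blast
qed

text \<open>As \<open>a * d = N\<close>, the ratio a/d equals a^2/N, so the value of q at the image
  point is a root of unity times the power \<open>a * a\<close> of the N-th root of q.\<close>

lemma qexp_triangular:
  assumes "a * d = int N" "a > 0" "N > 0"
  shows "exp (2 * of_real pi * \<i> * ((of_int a * z + of_int b) / of_int d)) = tri_root b d * qexp N z ^ nat (a * a)"
proof -
  have d: "d > 0" using assms by (metis of_nat_0_less_iff zero_less_mult_pos)
  have nN: "of_nat N = (of_int a * of_int d :: complex)"
    using assms(1) by (metis of_int_mult of_int_of_nat_eq)
  have na: "of_nat (nat (a * a)) = (of_int a * of_int a :: complex)" using assms(2) by (simp add: of_nat_nat)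
  have "qexp N z ^ nat (a * a) = exp (of_nat (nat (a * a)) * (2 * of_real pi * \<i> * z / of_nat N))"
    by (rule exp_of_nat_mult[symmetric])
  also have "of_nat (nat (a * a)) * (2 * of_real pi * \<i> * z / of_nat N) = 2 * of_real pi * \<i> * z * of_int a / of_int d"
    unfolding na nN using assms(2) by simp
  finally have q: "qexp N z ^ nat (a * a) = exp (2 * of_real pi * \<i> * z * of_int a / of_int d)" .
  show ?thesis unfolding tri_root_def q exp_add[symmetric]
    by (intro arg_cong[where f = exp]) (simp add: add_divide_distrib distrib_left mult_ac)
qed

definition tri_fun :: "int \<Rightarrow> int \<Rightarrow> int \<Rightarrow> nat \<Rightarrow> complex \<Rightarrow> complex" where
  "tri_fun a b d N x = tri_root b d * euler_prod (tri_root b d * x ^ nat (a * a)) ^ 24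
     * inverse (of_int d ^ 12) * inverse (euler_prod (1 * x ^ N) ^ 24)"

lemma alg_holomorphic_tri_fun:
  assumes "a > 0" "d > 0" "N > 0"
  shows "alg_holomorphic (tri_fun a b d N)"
proof -
  have "algebraic (inverse (of_int d ^ 12) :: complex)" by (intro algebraic_inverse algebraic_power) auto
  moreover have "alg_holomorphic (\<lambda>x. euler_prod (tri_root b d * x ^ nat (a * a)))"
    using assms by (intro alg_holomorphic_compose_monomial alg_holomorphic_euler_prod algebraic_tri_root)
      (simp_all add: norm_tri_root)
  moreover have "alg_holomorphic (\<lambda>x. euler_prod (1 * x ^ N))"
    using assms by (intro alg_holomorphic_compose_monomial alg_holomorphic_euler_prod) simp_all
  moreover have "euler_prod (1 * x ^ N) ^ 24 \<noteq> 0" if "norm x < 1" for x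
    using that assms by (simp add: euler_prod_nonzero norm_power power_less_one_iff)
  ultimately show ?thesis unfolding tri_fun_def[abs_def]
    by (intro alg_holomorphic_mult alg_holomorphic_power alg_holomorphic_const alg_holomorphic_inverse algebraic_tri_root assms(2))
qed

text \<open>Since \<open>tri_fun\<close> does not vanish at 0, the order at the cusp is
  \<open>a * a - N\<close>. It is nonzero when N is not a square.\<close>

lemma delta_quotient_tri:
  assumes N: "a * d = int N" "a > 0" "N > 0" and z: "Im z > 0"
  shows "delta_quotient a b 0 d z = tri_fun a b d N (qexp N z) * qexp N z ^ nat (a * a) / qexp N z ^ N"
proof -
  have d: "d > 0" using N by (metis of_nat_0_less_iff zero_less_mult_pos)
  let ?x = "qexp N z" and ?w = "(of_int a * z + of_int b) / of_int d"
  have I: "Im ?w > 0" using Im_moebius_int_pos[OF z, of a d b 0] N by simp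
  have D: "Ramanujan_Delta z = ?x ^ N * euler_prod (1 * ?x ^ N) ^ 24"
    unfolding Ramanujan_Delta_eq[OF z] mult_1 qexp_power[OF N(3)] ..
  have e: "(t * X * A) / (D * (Y * F)) = t * A * inverse D * inverse F * X / Y" for t X A D Y F :: complex
    by (simp add: divide_inverse)
  have "delta_quotient a b 0 d z = Ramanujan_Delta ?w / (of_int d ^ 12 * Ramanujan_Delta z)"
    by (simp add: delta_quotient_def)
  also have "\<dots> = tri_fun a b d N ?x * ?x ^ nat (a * a) / ?x ^ N"
    unfolding Ramanujan_Delta_eq[OF I] D qexp_triangular[OF N] tri_fun_def
    by (rule e)
  finally show ?thesis .
qed

definition hecke_family :: "nat \<Rightarrow> (complex \<Rightarrow> complex) set" where
  "hecke_family N = {on_halfplane (delta_quotient a b c d) | a b c d. a * d - b * c = int N}"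

lemma hecke_family_triangular:
  assumes "f \<in> hecke_family N" "N > 0"
  obtains a b d where "a * d = int N" "0 < a" "0 \<le> b" "b < d" "f = on_halfplane (delta_quotient a b 0 d)"
proof -
  obtain a b c d where f: "f = on_halfplane (delta_quotient a b c d)" "a * d - b * c = int N"
    using assms unfolding hecke_family_def by blast
  have "int N > 0" using assms by simp
  from delta_quotient_triangular[OF f(2) this] obtain a' b' d' where
    "a' * d' = int N" "0 < a'" "0 \<le> b'" "b' < d'" "\<And>z. Im z > 0 \<Longrightarrow> delta_quotient a b c d z = delta_quotient a' b' 0 d' z"
    by blast
  moreover from this have "f = on_halfplane (delta_quotient a' b' 0 d')"
    unfolding f by (auto simp: on_halfplane_def fun_eq_iff)
  ultimately show ?thesis using that by blast
qed

lemma finite_hecke_family: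
  assumes "N > 0"
  shows "finite (hecke_family N)"
proof (rule finite_subset)
  show "hecke_family N \<subseteq> (\<lambda>(a,b,d). on_halfplane (delta_quotient a b 0 d)) ` ({0..int N} \<times> {0..int N} \<times> {0..int N})"
  proof
    fix f assume "f \<in> hecke_family N"
    then obtain a b d where *: "a * d = int N" "0 < a" "0 \<le> b" "b < d" "f = on_halfplane (delta_quotient a b 0 d)"
      using hecke_family_triangular assms by blast
    have "a * 1 \<le> a * d" "1 * d \<le> a * d" using * by (intro mult_left_mono mult_right_mono; simp)+
    thus "f \<in> (\<lambda>(a,b,d). on_halfplane (delta_quotient a b 0 d)) ` ({0..int N} \<times> {0..int N} \<times> {0..int N})"
      using * by (intro image_eqI[of _ _ "(a,b,d)"]) auto
  qed
qed auto

lemma on_halfplane_idem: "on_halfplane (on_halfplane f) = on_halfplane f"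
  by (auto simp: on_halfplane_def fun_eq_iff)

lemma hecke_family_closed:
  assumes "f \<in> hecke_family N"
  shows "on_halfplane (\<lambda>z. f (z + 1)) \<in> hecke_family N" "on_halfplane (\<lambda>z. f (- 1 / z)) \<in> hecke_family N"
proof -
  obtain a b c d where f: "f = on_halfplane (delta_quotient a b c d)" "a * d - b * c = int N"
    using assms unfolding hecke_family_def by blast
  have "on_halfplane (\<lambda>z. f (z + 1)) = on_halfplane (delta_quotient a (a + b) c (c + d))"
    by (auto simp: f on_halfplane_def fun_eq_iff delta_quotient_plus_1)
  moreover have "a * (c + d) - (a + b) * c = int N" using f(2) by (simp add: algebra_simps)
  ultimately show "on_halfplane (\<lambda>z. f (z + 1)) \<in> hecke_family N" unfolding hecke_family_def by blast
  have "on_halfplane (\<lambda>z. f (- 1 / z)) = on_halfplane (delta_quotient b (- a) d (- c))"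
  proof
    fix z show "on_halfplane (\<lambda>z. f (- 1 / z)) z = on_halfplane (delta_quotient b (- a) d (- c)) z"
      using Im_minus_inverse[of z] delta_quotient_inversion[of z a b c d]
      by (cases "Im z > 0") (simp_all add: on_halfplane_def f)
  qed
  moreover have "b * (- c) - (- a) * d = int N" using f(2) by (simp add: algebra_simps)
  ultimately show "on_halfplane (\<lambda>z. f (- 1 / z)) \<in> hecke_family N" unfolding hecke_family_def by blast
qed

lemma modular_family_hecke:
  assumes "N > 0"
  shows "modular_family N (hecke_family N)"
  unfolding modular_family_def
proof (intro conjI ballI hecke_family_closed finite_hecke_family assms)
  fix f assume f: "f \<in> hecke_family N"
  show "on_halfplane f = f" using f by (auto simp: hecke_family_def on_halfplane_idem)
  obtain a b d where *: "a * d = int N" "0 < a" "0 \<le> b" "b < d" "f = on_halfplane (delta_quotient a b 0 d)"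
    using hecke_family_triangular[OF f assms] by blast
  have "f z = tri_fun a b d N (qexp N z) * qexp N z ^ nat (a * a) / qexp N z ^ N" if "Im z > 0" for z
    using that delta_quotient_tri[OF *(1,2) assms that] by (simp add: * on_halfplane_def)
  moreover have "alg_holomorphic (\<lambda>x. tri_fun a b d N x * x ^ nat (a * a))"
    using * assms by (intro alg_holomorphic_mult alg_holomorphic_power alg_holomorphic_id alg_holomorphic_tri_fun) simp_all
  ultimately show "qmeromorphic N f" unfolding qmeromorphic_def
    by (intro exI[of _ N] exI[of _ "\<lambda>x. tri_fun a b d N x * x ^ nat (a * a)"] conjI allI impI)
qed

section \<open>Logarithmic derivatives of the quotients\<close>

text \<open>The logarithmic derivative of \<open>delta_quotient\<close>, divided by 2 pi i; the
  coefficient 6/(pi i) is 12/(2 pi i), from the twelfth power of the automorphy factor.\<close>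

definition delta_logderiv :: "int \<Rightarrow> int \<Rightarrow> int \<Rightarrow> int \<Rightarrow> complex \<Rightarrow> complex" where
  "delta_logderiv a b c d z = eisenstein_E2 ((of_int a * z + of_int b) / (of_int c * z + of_int d))
       * of_int (a * d - b * c) / (of_int c * z + of_int d)\<^sup>2
     - 6 * of_int c / (of_real pi * \<i> * (of_int c * z + of_int d)) - eisenstein_E2 z"

lemma delta_quotient_nonzero:
  assumes "Im z > 0" "a * d - b * c > 0"
  shows "delta_quotient a b c d z \<noteq> 0"
  unfolding delta_quotient_def
  using Ramanujan_Delta_nonzero[OF Im_moebius_int_pos[OF assms]] Ramanujan_Delta_nonzero[OF assms(1)]
    linear_form_nonzero[OF assms] by simp

lemma has_field_derivative_delta_quotient:
  assumes z: "Im z > 0" and det: "a * d - b * c > 0"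
  shows "(delta_quotient a b c d has_field_derivative
    delta_quotient a b c d z * (2 * of_real pi * \<i> * delta_logderiv a b c d z)) (at z)"
proof -
  let ?c = "2 * of_real pi * \<i> :: complex"
  let ?n = "\<lambda>z. of_int a * z + of_int b :: complex" and ?j = "\<lambda>z. of_int c * z + of_int d :: complex"
  have j: "?j z \<noteq> 0" by (rule linear_form_nonzero[OF assms])
  have D: "Ramanujan_Delta z \<noteq> 0" by (rule Ramanujan_Delta_nonzero[OF z])
  have dw: "((\<lambda>z. ?n z / ?j z) has_field_derivative of_int (a * d - b * c) / (?j z)\<^sup>2) (at z)"
  proof -
    have "((\<lambda>z. ?n z / ?j z) has_field_derivative (of_int a * ?j z - ?n z * of_int c) / (?j z * ?j z)) (at z)"
      using j by (auto intro!: derivative_eq_intros)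
    moreover have "of_int a * ?j z - ?n z * of_int c = of_int (a * d - b * c)" by (simp add: algebra_simps)
    ultimately show ?thesis by (simp only: power2_eq_square)
  qed
  have dj: "(?j has_field_derivative of_int c) (at z)" by (auto intro!: derivative_eq_intros)
  have dD: "((\<lambda>z. Ramanujan_Delta (?n z / ?j z)) has_field_derivative
     ?c * eisenstein_E2 (?n z / ?j z) * Ramanujan_Delta (?n z / ?j z) * (of_int (a * d - b * c) / (?j z)\<^sup>2)) (at z)"
    by (rule DERIV_chain2[where f = Ramanujan_Delta, OF has_field_derivative_Ramanujan_Delta[OF Im_moebius_int_pos[OF assms]] dw])
  have "((\<lambda>z. Ramanujan_Delta (?n z / ?j z) / (?j z ^ 12 * Ramanujan_Delta z)) has_field_derivative
     (?c * eisenstein_E2 (?n z / ?j z) * Ramanujan_Delta (?n z / ?j z) * (of_int (a * d - b * c) / (?j z)\<^sup>2) * (?j z ^ 12 * Ramanujan_Delta z)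
      - Ramanujan_Delta (?n z / ?j z) * (?j z ^ 12 * (?c * eisenstein_E2 z * Ramanujan_Delta z) + of_nat 12 * (of_int c * ?j z ^ (12 - Suc 0)) * Ramanujan_Delta z))
     / ((?j z ^ 12 * Ramanujan_Delta z) * (?j z ^ 12 * Ramanujan_Delta z))) (at z)"
    using j D by (intro DERIV_divide DERIV_mult' DERIV_power dD dj has_field_derivative_Ramanujan_Delta z) auto
  also have "(?c * eisenstein_E2 (?n z / ?j z) * Ramanujan_Delta (?n z / ?j z) * (of_int (a * d - b * c) / (?j z)\<^sup>2) * (?j z ^ 12 * Ramanujan_Delta z)
      - Ramanujan_Delta (?n z / ?j z) * (?j z ^ 12 * (?c * eisenstein_E2 z * Ramanujan_Delta z) + of_nat 12 * (of_int c * ?j z ^ (12 - Suc 0)) * Ramanujan_Delta z))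
     / ((?j z ^ 12 * Ramanujan_Delta z) * (?j z ^ 12 * Ramanujan_Delta z))
     = delta_quotient a b c d z * (?c * delta_logderiv a b c d z)"
  proof -
    have e: "(?c * E * W * (M / j\<^sup>2) * (j ^ 12 * D) - W * (j ^ 12 * (?c * E' * D) + of_nat 12 * (C * j ^ (12 - Suc 0)) * D)) / ((j ^ 12 * D) * (j ^ 12 * D))
      = W / (j ^ 12 * D) * (?c * (E * M / j\<^sup>2 - 6 * C / (of_real pi * \<i> * j) - E'))"
      if "j \<noteq> 0" "D \<noteq> 0" for E W M j D E' C :: complex
    proof -
      define k where "k = j ^ 11"
      have k: "j ^ 12 = j * k" "j ^ (12 - Suc 0) = k" "k \<noteq> 0" using that by (simp_all add: k_def eval_nat_numeral)
      have 12: "of_nat 12 = (12 :: complex)" by simp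
      have "(?c * E * W * (M / j\<^sup>2) * (j * k * D) - W * (j * k * (?c * E' * D) + 12 * (C * k) * D)) / ((j * k * D) * (j * k * D))
        = (?c * E * W * (M / j\<^sup>2) * (j * k * D)) / ((j * k * D) * (j * k * D)) - (W * (j * k * (?c * E' * D))) / ((j * k * D) * (j * k * D))
          - (W * (12 * (C * k) * D)) / ((j * k * D) * (j * k * D))"
        by (simp add: diff_divide_distrib distrib_left add_divide_distrib)
      also have "(?c * E * W * (M / j\<^sup>2) * (j * k * D)) / ((j * k * D) * (j * k * D)) = W / (j * k * D) * (?c * (E * M / j\<^sup>2))"
        using that k(3) by (simp add: mult_ac)
      also have "(W * (j * k * (?c * E' * D))) / ((j * k * D) * (j * k * D)) = W / (j * k * D) * (?c * E')"
        using that k(3) by (simp add: mult_ac)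
      also have "(W * (12 * (C * k) * D)) / ((j * k * D) * (j * k * D)) = W / (j * k * D) * (?c * (6 * C / (of_real pi * \<i> * j)))"
        using that k(3) by (simp add: divide_simps)
      finally show ?thesis unfolding k(1,2) 12 unfolding right_diff_distrib by (simp only: diff_diff_eq add.commute)
    qed
    show ?thesis unfolding delta_quotient_def delta_logderiv_def by (rule e[OF j D])
  qed
  finally show ?thesis unfolding delta_quotient_def[abs_def] .
qed

text \<open>Transfers the triangular representatives from the quotients to their logarithmic
  derivatives.\<close>

lemma delta_logderiv_unique:
  assumes det: "a * d - b * c > 0" "a' * d' - b' * c' > 0"
    and eq: "\<And>z. Im z > 0 \<Longrightarrow> delta_quotient a b c d z = delta_quotient a' b' c' d' z" and z: "Im z > 0"
  shows "delta_logderiv a b c d z = delta_logderiv a' b' c' d' z"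
proof -
  have "(delta_quotient a' b' c' d' has_field_derivative
    delta_quotient a b c d z * (2 * of_real pi * \<i> * delta_logderiv a b c d z)) (at z)"
    by (rule has_field_derivative_transform_within_open[OF has_field_derivative_delta_quotient[OF z det(1)] open_upper_halfplane])
       (use z eq in auto)
  from DERIV_unique[OF this has_field_derivative_delta_quotient[OF z det(2)]]
  show ?thesis using eq[OF z] delta_quotient_nonzero[OF z det(2)] by simp
qed

lemma delta_logderiv_plus_1:
  assumes "Im z > 0"
  shows "delta_logderiv a b c d (z + 1) = delta_logderiv a (a + b) c (c + d) z"
proof -
  have e: "of_int a * (z + 1) + of_int b = of_int a * z + of_int (a + b)" for a b
    by (simp add: algebra_simps)
  have "a * (c + d) - (a + b) * c = a * d - b * c" by (simp add: algebra_simps)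
  thus ?thesis unfolding delta_logderiv_def eisenstein_E2_plus_1[OF assms] e by simp
qed

text \<open>The anomalies of the two E2 terms and the change of the automorphy factor cancel,
  leaving weight 2. Hence the sixth power divided by Delta has weight 0.\<close>

lemma delta_logderiv_inversion:
  assumes z: "Im z > 0" and det: "a * d - b * c > 0"
  shows "delta_logderiv a b c d (- 1 / z) = z\<^sup>2 * delta_logderiv b (- a) d (- c) z"
proof -
  have z0: "z \<noteq> 0" using z by auto
  have 1: "of_int a * (- 1 / z) + of_int b = (of_int b * z + of_int (- a)) / z" for a b
    using z0 by (simp add: field_simps)
  have det': "b * (- c) - (- a) * d = a * d - b * c" by simp
  have j: "of_int d * z + of_int (- c) \<noteq> (0 :: complex)"
    using linear_form_nonzero[OF z, of b "- c" "- a" d] det by (simp add: algebra_simps)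
  have e: "E * M / (j / z)\<^sup>2 - 6 * C / (of_real pi * \<i> * (j / z)) - (z\<^sup>2 * E' - 6 * \<i> * z / of_real pi) =
     z\<^sup>2 * (E * M / j\<^sup>2 - 6 * ((j + C) / z) / (of_real pi * \<i> * j) - E')" if "j \<noteq> 0" for E M j C E' :: complex
    using that z0 by (simp add: divide_simps) (simp add: algebra_simps power2_eq_square)
  have "(of_int d * z + of_int (- c) + of_int c) / z = (of_int d :: complex)" using z0 by simp
  with e[OF j, of _ _ "of_int c"] show ?thesis
    unfolding delta_logderiv_def 1 eisenstein_E2_transform[OF z] det' using z0 by simp
qed

definition logderiv_family :: "nat \<Rightarrow> (complex \<Rightarrow> complex) set" where
  "logderiv_family N = {on_halfplane (\<lambda>z. delta_logderiv a b c d z ^ 6 / Ramanujan_Delta z) | a b c d. a * d - b * c = int N}"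

lemma logderiv_family_triangular:
  assumes "f \<in> logderiv_family N" "N > 0"
  obtains a b d where "a * d = int N" "0 < a" "0 \<le> b" "b < d"
    "f = on_halfplane (\<lambda>z. delta_logderiv a b 0 d z ^ 6 / Ramanujan_Delta z)"
proof -
  obtain a b c d where f: "f = on_halfplane (\<lambda>z. delta_logderiv a b c d z ^ 6 / Ramanujan_Delta z)" "a * d - b * c = int N"
    using assms unfolding logderiv_family_def by blast
  have N: "int N > 0" using assms by simp
  from delta_quotient_triangular[OF f(2) this] obtain a' b' d' where
    *: "a' * d' = int N" "0 < a'" "0 \<le> b'" "b' < d'"
    and eq: "\<And>z. Im z > 0 \<Longrightarrow> delta_quotient a b c d z = delta_quotient a' b' 0 d' z"
    by blast
  have "delta_logderiv a b c d z = delta_logderiv a' b' 0 d' z" if "Im z > 0" for z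
    using delta_logderiv_unique[of a d b c a' d' b' 0] f(2) * N eq that by simp
  hence "f = on_halfplane (\<lambda>z. delta_logderiv a' b' 0 d' z ^ 6 / Ramanujan_Delta z)"
    unfolding f by (auto simp: on_halfplane_def fun_eq_iff)
  with * show ?thesis using that by blast
qed

lemma modular_family_logderiv:
  assumes N: "N > 0"
  shows "modular_family N (logderiv_family N)"
  unfolding modular_family_def
proof (intro conjI ballI assms)
  show "finite (logderiv_family N)"
  proof (rule finite_subset)
    show "logderiv_family N \<subseteq> (\<lambda>(a,b,d). on_halfplane (\<lambda>z. delta_logderiv a b 0 d z ^ 6 / Ramanujan_Delta z)) ` ({0..int N} \<times> {0..int N} \<times> {0..int N})"
    proof
      fix f assume "f \<in> logderiv_family N"
      then obtain a b d where *: "a * d = int N" "0 < a" "0 \<le> b" "b < d"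
        "f = on_halfplane (\<lambda>z. delta_logderiv a b 0 d z ^ 6 / Ramanujan_Delta z)"
        using logderiv_family_triangular assms by blast
      have "a * 1 \<le> a * d" "1 * d \<le> a * d" using * by (intro mult_left_mono mult_right_mono; simp)+
      thus "f \<in> (\<lambda>(a,b,d). on_halfplane (\<lambda>z. delta_logderiv a b 0 d z ^ 6 / Ramanujan_Delta z)) ` ({0..int N} \<times> {0..int N} \<times> {0..int N})"
        using * by (intro image_eqI[of _ _ "(a,b,d)"]) auto
    qed
  qed auto
next
  fix f assume f: "f \<in> logderiv_family N"
  show "on_halfplane f = f" using f by (auto simp: logderiv_family_def on_halfplane_idem)
  obtain a b c d where fe: "f = on_halfplane (\<lambda>z. delta_logderiv a b c d z ^ 6 / Ramanujan_Delta z)" "a * d - b * c = int N"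
    using f unfolding logderiv_family_def by blast
  have "on_halfplane (\<lambda>z. f (z + 1)) = on_halfplane (\<lambda>z. delta_logderiv a (a + b) c (c + d) z ^ 6 / Ramanujan_Delta z)"
    by (auto simp: fe on_halfplane_def fun_eq_iff delta_logderiv_plus_1 Ramanujan_Delta_plus_1)
  moreover have "a * (c + d) - (a + b) * c = int N" using fe(2) by (simp add: algebra_simps)
  ultimately show "on_halfplane (\<lambda>z. f (z + 1)) \<in> logderiv_family N" unfolding logderiv_family_def by blast
  have "on_halfplane (\<lambda>z. f (- 1 / z)) = on_halfplane (\<lambda>z. delta_logderiv b (- a) d (- c) z ^ 6 / Ramanujan_Delta z)"
  proof
    fix z
    show "on_halfplane (\<lambda>z. f (- 1 / z)) z = on_halfplane (\<lambda>z. delta_logderiv b (- a) d (- c) z ^ 6 / Ramanujan_Delta z) z"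
    proof (cases "Im z > 0")
      case True
      have z0: "z \<noteq> 0" using True by auto
      have det: "a * d - b * c > 0" using fe(2) N by simp
      have "f (- 1 / z) = delta_logderiv a b c d (- 1 / z) ^ 6 / Ramanujan_Delta (- 1 / z)"
        using Im_minus_inverse[OF True] unfolding fe on_halfplane_def by (simp only: if_True)
      also have "\<dots> = delta_logderiv b (- a) d (- c) z ^ 6 / Ramanujan_Delta z"
        unfolding delta_logderiv_inversion[OF True det] Ramanujan_Delta_inversion[OF True] power_mult_distrib
        using z0 by (simp flip: power_mult)
      finally show ?thesis using True by (simp add: on_halfplane_def)
    qed (simp add: on_halfplane_def)
  qed
  moreover have "b * (- c) - (- a) * d = int N" using fe(2) by (simp add: algebra_simps)
  ultimately show "on_halfplane (\<lambda>z. f (- 1 / z)) \<in> logderiv_family N" unfolding logderiv_family_def by blast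
next
  fix f assume f: "f \<in> logderiv_family N"
  obtain a b d where *: "a * d = int N" "0 < a" "0 \<le> b" "b < d"
    "f = on_halfplane (\<lambda>z. delta_logderiv a b 0 d z ^ 6 / Ramanujan_Delta z)"
    using logderiv_family_triangular[OF f assms] by blast
  have d: "d > 0" using * by simp
  \<comment> \<open>For a triangular matrix the determinant over \<open>d\<^sup>2\<close> is a/d and
    the middle term of \<open>delta_logderiv\<close> is absent, so no pole arises except from
    1/Delta.\<close>
  define h where "h = (\<lambda>x. E2_fun (tri_root b d * x ^ nat (a * a)) * (of_int a / of_int d) - E2_fun (1 * x ^ N))"
  have ah: "alg_holomorphic h"
  proof -
    have "alg_holomorphic (\<lambda>x. E2_fun (tri_root b d * x ^ nat (a * a)))"
      using * d by (intro alg_holomorphic_compose_monomial alg_holomorphic_E2_fun algebraic_tri_root) (simp_all add: norm_tri_root)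
    moreover have "alg_holomorphic (\<lambda>x. E2_fun (1 * x ^ N))"
      using assms by (intro alg_holomorphic_compose_monomial alg_holomorphic_E2_fun) simp_all
    moreover have "algebraic (of_int a / of_int d :: complex)" by (intro algebraic_divide) simp_all
    ultimately show ?thesis unfolding h_def by (intro alg_holomorphic_mult alg_holomorphic_diff alg_holomorphic_const)
  qed
  define H where "H = (\<lambda>x. h x ^ 6 * inverse (euler_prod (1 * x ^ N) ^ 24))"
  have aH: "alg_holomorphic H"
  proof -
    have "alg_holomorphic (\<lambda>x. euler_prod (1 * x ^ N))"
      using assms by (intro alg_holomorphic_compose_monomial alg_holomorphic_euler_prod) simp_all
    moreover have "euler_prod (1 * x ^ N) ^ 24 \<noteq> 0" if "norm x < 1" for x
      using that assms by (simp add: euler_prod_nonzero norm_power power_less_one_iff)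
    ultimately show ?thesis unfolding H_def
      by (intro alg_holomorphic_mult alg_holomorphic_power alg_holomorphic_inverse ah)
  qed
  have "f z = H (qexp N z) / qexp N z ^ N" if z: "Im z > 0" for z
  proof -
    let ?x = "qexp N z" and ?w = "(of_int a * z + of_int b) / of_int d"
    have I: "Im ?w > 0" using Im_moebius_int_pos[OF z, of a d b 0] * N by simp
    have D: "Ramanujan_Delta z = ?x ^ N * euler_prod (1 * ?x ^ N) ^ 24"
      unfolding Ramanujan_Delta_eq[OF z] mult_1 qexp_power[OF N] ..
    have "delta_logderiv a b 0 d z = eisenstein_E2 ?w * (of_int a / of_int d) - eisenstein_E2 z"
      using d by (simp add: delta_logderiv_def power2_eq_square)
    also have "\<dots> = h ?x"
      unfolding eisenstein_E2_eq[OF I] eisenstein_E2_eq[OF z] qexp_triangular[OF *(1,2) N] h_def mult_1 qexp_power[OF N] ..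
    finally have "f z = h ?x ^ 6 / Ramanujan_Delta z" using z by (simp add: *(5) on_halfplane_def)
    thus ?thesis unfolding D H_def by (simp add: divide_inverse)
  qed
  thus "qmeromorphic N f" unfolding qmeromorphic_def using aH by blast
qed

section \<open>Algebraic values at fixed points of integral matrices\<close>

text \<open>Near the cusp each member behaves like a nonzero constant times the power
  \<open>a * a - N\<close> of the parameter. The exponent is not 0, so it tends to 0 or to infinity
  and avoids \<open>l\<close>; finitely many members share a neighbourhood.\<close>

lemma hecke_norm_nonzero:
  assumes N: "N > 0" "\<And>k. N \<noteq> k * k" and l: "l \<noteq> 0"
  shows "\<exists>z. Im z > 0 \<and> (\<Prod>f\<in>hecke_family N. l - f z) \<noteq> 0"
proof -
  have ev: "\<exists>\<epsilon>>0. \<forall>z. Im z > 0 \<longrightarrow> norm (qexp N z) < \<epsilon> \<longrightarrow> f z \<noteq> l" if f: "f \<in> hecke_family N" for f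
  proof -
    obtain a b d where *: "a * d = int N" "0 < a" "0 \<le> b" "b < d" "f = on_halfplane (delta_quotient a b 0 d)"
      using hecke_family_triangular[OF f N(1)] by blast
    define u where "u = tri_fun a b d N"
    define m where "m = nat (a * a)"
    have d: "d > 0" using * by simp
    have u: "isCont u 0"
      using holomorphic_on_imp_continuous_on[OF alg_holomorphicD(1)[OF alg_holomorphic_tri_fun[OF *(2) d N(1), of b]]]
      by (simp add: continuous_on_eq_continuous_at u_def)
    have "nat (a * a) > 0" using *(2) by simp
    hence u0: "u 0 \<noteq> 0" using d N(1) by (simp add: u_def tri_fun_def tri_root_def zero_power)
    have mN: "m \<noteq> N"
    proof
      assume "m = N"
      hence "N = nat a * nat a" using *(2) by (simp add: m_def nat_mult_distrib)
      thus False using N(2) by blast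
    qed
    have fz: "f z = u (qexp N z) * qexp N z ^ m / qexp N z ^ N" if "Im z > 0" for z
      using that delta_quotient_tri[OF *(1,2) N(1) that] by (simp add: *(5) on_halfplane_def u_def m_def)
    \<comment> \<open>The equation \<open>f z = l\<close> with the smaller of the two powers of the
      parameter divided out. At 0 this leaves \<open>u 0\<close> if \<open>m < N\<close> and
      \<open>- l\<close> if \<open>m > N\<close>.\<close>
    define g where "g = (\<lambda>x. if m < N then u x - l * x ^ (N - m) else u x * x ^ (m - N) - l)"
    have "isCont g 0" unfolding g_def using u by (cases "m < N") (auto intro!: continuous_intros)
    moreover have "g 0 \<noteq> 0" using mN u0 l by (auto simp: g_def)
    ultimately have "eventually (\<lambda>x. g x \<noteq> 0) (nhds 0)"
      using tendsto_imp_eventually_ne[of g "g 0" "nhds 0" 0] by (simp add: continuous_at tendsto_at_iff_tendsto_nhds)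
    then obtain \<epsilon> where \<epsilon>: "\<epsilon> > 0" "\<And>x. norm x < \<epsilon> \<Longrightarrow> g x \<noteq> 0"
      unfolding eventually_nhds_metric by (auto simp: dist_norm)
    have "f z \<noteq> l" if z: "Im z > 0" "norm (qexp N z) < \<epsilon>" for z
    proof
      assume "f z = l"
      hence "u (qexp N z) * qexp N z ^ m = l * qexp N z ^ N" using fz[OF z(1)] by (simp add: field_simps)
      hence "g (qexp N z) * qexp N z ^ min m N = 0"
        unfolding g_def by (cases "m < N") (simp_all add: algebra_simps power_add[symmetric])
      thus False using \<epsilon>(2)[OF z(2)] by simp
    qed
    thus ?thesis using \<epsilon>(1) by blast
  qed
  have fin: "finite (hecke_family N)" by (rule finite_hecke_family[OF N(1)])
  have "\<exists>\<epsilon>>0. \<forall>f\<in>F. \<forall>z. Im z > 0 \<longrightarrow> norm (qexp N z) < \<epsilon> \<longrightarrow> f z \<noteq> l"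
    if "finite F" "F \<subseteq> hecke_family N" for F
    using that
  proof (induction F rule: finite_induct)
    case empty show ?case by (intro exI[of _ 1]) simp
  next
    case (insert f F)
    then obtain e1 where e1: "e1 > 0" "\<forall>f\<in>F. \<forall>z. Im z > 0 \<longrightarrow> norm (qexp N z) < e1 \<longrightarrow> f z \<noteq> l" by blast
    obtain e2 where e2: "e2 > 0" "\<forall>z. Im z > 0 \<longrightarrow> norm (qexp N z) < e2 \<longrightarrow> f z \<noteq> l"
      using ev[of f] insert.prems by blast
    show ?case using e1 e2 by (intro exI[of _ "min e1 e2"]) (simp del: norm_exp_eq_Re)
  qed
  from this[OF fin order.refl] obtain \<epsilon> where \<epsilon>: "\<epsilon> > 0" "\<And>f z. f \<in> hecke_family N \<Longrightarrow> Im z > 0 \<Longrightarrow> norm (qexp N z) < \<epsilon> \<Longrightarrow> f z \<noteq> l" by blast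
  define x where "x = complex_of_real (min \<epsilon> 1 / 2)"
  have x: "x \<noteq> 0" "norm x < 1" "norm x < \<epsilon>" using \<epsilon>(1) by (auto simp: x_def min_def)
  obtain z where z: "Im z > 0" "x = qexp N z" using qexp_surj[OF x(1,2) N(1)] by blast
  have "(\<Prod>f\<in>hecke_family N. l - f z) \<noteq> 0"
    using \<epsilon>(2)[OF _ z(1)] x(3) z(2) fin by (auto simp: prod_zero_iff)
  thus ?thesis using z(1) by blast
qed

lemma cm_algebraic:
  assumes z0: "Im z0 > 0" and r: "r \<noteq> 0" and det: "p * s - q * r = int N" and N: "N > 0" "\<And>k. N \<noteq> k * k"
    and cm: "of_int p * z0 + of_int q = z0 * (of_int r * z0 + of_int s)"
  shows "algebraic (modular_j z0)"
    "algebraic ((eisenstein_E2 z0 - 3 / of_real (pi * Im z0)) ^ 6 / Ramanujan_Delta z0)"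
proof -
  have det0: "p * s - q * r > 0" using det N by simp
  define \<alpha> where "\<alpha> = of_int r * z0 + of_int s"
  have \<alpha>: "\<alpha> \<noteq> 0" unfolding \<alpha>_def by (rule linear_form_nonzero[OF z0 det0])
  have fixp: "(of_int p * z0 + of_int q) / \<alpha> = z0"
    using cm \<alpha> by (simp add: \<alpha>_def)
  have D0: "Ramanujan_Delta z0 \<noteq> 0" by (rule Ramanujan_Delta_nonzero[OF z0])
  have az0: "algebraic z0"
  proof (rule algebraic_poly_root[of "[:- of_int q, of_int s - of_int p, of_int r:]"])
    show "poly [:- of_int q, of_int s - of_int p, of_int r:] z0 = 0"
      using cm by (simp add: algebra_simps)
    show "algebraic (coeff [:- of_int q, of_int s - of_int p, of_int r:] i :: complex)" for i
      unfolding coeff_pCons by (auto split: nat.splits simp: algebraic_diff)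
  qed (use r in simp)
  have a\<alpha>: "algebraic \<alpha>" unfolding \<alpha>_def by (intro algebraic_add algebraic_mult az0) simp_all
  have ay: "algebraic (of_real (Im z0) :: complex)"
  proof -
    have "of_real (Im z0) = (z0 - cnj z0) / (2 * \<i>)" by (simp add: complex_eq_iff)
    moreover have "algebraic ((z0 - cnj z0) / (2 * \<i>))"
      by (intro algebraic_divide algebraic_diff algebraic_mult algebraic_cnj az0) simp_all
    ultimately show ?thesis by simp
  qed
  \<comment> \<open>At the fixed point the two values of Delta cancel, and only the automorphy
    factor remains.\<close>
  have quot: "delta_quotient p q r s z0 = inverse \<alpha> ^ 12"
    unfolding delta_quotient_def \<alpha>_def[symmetric] fixp using D0 by (simp add: divide_simps power_inverse)
  show j: "algebraic (modular_j z0)"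
  proof -
    have "algebraic (inverse \<alpha> ^ 12)" using a\<alpha> by (intro algebraic_power algebraic_inverse)
    from modular_family_norm[OF modular_family_hecke[OF N(1)] this] obtain P where
      P: "\<And>i. algebraic (coeff P i)" "\<And>z. Im z > 0 \<Longrightarrow> (\<Prod>f\<in>hecke_family N. inverse \<alpha> ^ 12 - f z) = poly P (modular_j z)"
      by blast
    have "inverse \<alpha> ^ 12 \<noteq> 0" using \<alpha> by simp
    then obtain z where "Im z > 0" "(\<Prod>f\<in>hecke_family N. inverse \<alpha> ^ 12 - f z) \<noteq> 0"
      using hecke_norm_nonzero[OF N] by blast
    hence "P \<noteq> 0" using P(2)[of z] by auto
    moreover have "poly P (modular_j z0) = 0"
    proof -
      have "on_halfplane (delta_quotient p q r s) \<in> hecke_family N"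
        using det unfolding hecke_family_def by blast
      moreover have "on_halfplane (delta_quotient p q r s) z0 = inverse \<alpha> ^ 12"
        using z0 quot by (simp add: on_halfplane_def)
      ultimately have "\<exists>f\<in>hecke_family N. inverse \<alpha> ^ 12 - f z0 = 0" by (metis diff_self)
      hence "(\<Prod>f\<in>hecke_family N. inverse \<alpha> ^ 12 - f z0) = 0"
        by (intro prod_zero finite_hecke_family N)
      thus ?thesis using P(2)[OF z0] by simp
    qed
    ultimately show ?thesis using algebraic_poly_root P(1) by blast
  qed
  let ?e = "eisenstein_E2 z0 - 3 / of_real (pi * Im z0)"
  have "on_halfplane (\<lambda>z. delta_logderiv p q r s z ^ 6 / Ramanujan_Delta z) \<in> logderiv_family N"
    using det unfolding logderiv_family_def by blast
  from modular_family_algebraic[OF modular_family_logderiv[OF N(1)] this z0 j]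
  have A: "algebraic (delta_logderiv p q r s z0 ^ 6 / Ramanujan_Delta z0)"
    using z0 by (simp add: on_halfplane_def)
  \<comment> \<open>Comparing imaginary parts of z0 and of its image, which coincide, shows that the
    determinant is the norm of \<open>\<alpha>\<close>.\<close>
  have nrm: "of_int (p * s - q * r) = \<alpha> * cnj \<alpha>"
  proof -
    have "Im z0 = of_int (p * s - q * r) * Im z0 / (norm \<alpha>)\<^sup>2"
      using Im_moebius_int[OF z0 det0] unfolding \<alpha>_def[symmetric] fixp .
    moreover have "X = n" if "Im z0 = X * Im z0 / n" "n \<noteq> 0" for X n :: real
      using that z0 by (simp add: divide_simps)
    ultimately have "of_int (p * s - q * r) = (norm \<alpha>)\<^sup>2" using \<alpha> by simp
    hence "complex_of_real (of_int (p * s - q * r)) = of_real ((norm \<alpha>)\<^sup>2)" by simp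
    thus ?thesis by (simp only: complex_norm_square of_real_of_int_eq)
  qed
  \<comment> \<open>With this factor both the E2 part and the remaining part of the logarithmic
    derivative become multiples of \<open>\<beta>\<close>, and E2 - 3/(pi y) appears.\<close>
  define \<beta> where "\<beta> = - 2 * \<i> * of_int r * of_real (Im z0) / \<alpha>"
  have "cnj \<alpha> - \<alpha> = - 2 * \<i> * of_int r * of_real (Im z0)"
    by (simp add: \<alpha>_def complex_eq_iff)
  moreover have "cnj \<alpha> / \<alpha> - 1 = (cnj \<alpha> - \<alpha>) / \<alpha>" using \<alpha> by (simp add: diff_divide_distrib)
  ultimately have c: "cnj \<alpha> / \<alpha> - 1 = \<beta>" by (simp only: \<beta>_def)
  have "delta_logderiv p q r s z0 = eisenstein_E2 z0 * (cnj \<alpha> / \<alpha> - 1) - 6 * of_int r / (of_real pi * \<i> * \<alpha>)"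
    unfolding delta_logderiv_def \<alpha>_def[symmetric] fixp nrm using \<alpha> by (simp add: power2_eq_square right_diff_distrib)
  also have "6 * of_int r / (of_real pi * \<i> * \<alpha>) = \<beta> * (3 / of_real (pi * Im z0))"
  proof -
    have "6 * of_int r / (of_real pi * \<i> * \<alpha>) = - 6 * \<i> * of_int r / (of_real pi * \<alpha>)"
      by (simp add: divide_simps)
    thus ?thesis using z0 by (simp add: \<beta>_def mult_ac)
  qed
  finally have L: "delta_logderiv p q r s z0 = \<beta> * ?e" unfolding c by (simp add: algebra_simps)
  have \<beta>0: "\<beta> \<noteq> 0" using r z0 \<alpha> by (simp add: \<beta>_def)
  have "algebraic \<beta>" unfolding \<beta>_def
    by (intro algebraic_divide algebraic_mult ay a\<alpha>) simp_all
  hence "algebraic (delta_logderiv p q r s z0 ^ 6 / Ramanujan_Delta z0 / \<beta> ^ 6)"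
    by (intro algebraic_divide A algebraic_power)
  thus "algebraic (?e ^ 6 / Ramanujan_Delta z0)"
    using \<beta>0 by (simp add: L power_mult_distrib)
qed

section \<open>Taylor coefficients at CM points\<close>

lemma squarefree_not_square:
  fixes n :: int
  assumes "squarefree n" "\<bar>n\<bar> \<noteq> 1"
  shows "nat \<bar>n\<bar> \<noteq> k * k"
proof
  assume "nat \<bar>n\<bar> = k * k"
  hence "\<bar>n\<bar> = (int k)\<^sup>2" by (metis abs_ge_zero int_nat_eq nat_0_le of_nat_mult power2_eq_square)
  hence "(int k)\<^sup>2 dvd n" by (metis abs_dvd_iff dvd_abs_iff dvd_refl)
  hence "is_unit (int k)" by (rule squarefreeD[OF assms(1)])
  hence "k = 1" by simp
  thus False using assms(2) \<open>\<bar>n\<bar> = (int k)\<^sup>2\<close> by simp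
qed

text \<open>The matrix describes multiplication by an element \<open>r z + s\<close> of the order on
  the lattice spanned by z and 1; its determinant is the norm. Squarefree norms other than 1 are not
  squares.\<close>

lemma cm_point_matrix:
  assumes D: "neg_fundamental_discriminant D"
  obtains p q r s N where "r \<noteq> 0" "p * s - q * r = int N" "N > 0" "\<And>k. N \<noteq> k * k"
    "of_int p * cm_point D + of_int q = cm_point D * (of_int r * cm_point D + of_int s)"
proof -
  have neg: "D < 0" using D by (simp add: neg_fundamental_discriminant_def)
  define w where "w = csqrt (of_int D)"
  have w2: "w * w = of_int D" unfolding w_def by (simp add: power2_eq_square[symmetric])
  consider "D mod 4 = 1" "squarefree D" | m where "D = 4 * m" "m mod 4 \<in> {2, 3}" "squarefree m"
    using D unfolding neg_fundamental_discriminant_def by blast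
  thus ?thesis
  proof cases
    case 1
    then obtain e where e: "D = 4 * e + 1" by (metis mult_div_mod_eq)
    have cm: "cm_point D = (1 + w) / 2" using e by (simp add: cm_point_def w_def)
    show ?thesis
    \<comment> \<open>Multiplication by sqrt D = 2 z - 1, of norm -D. The instantiation order is r,
      p, s, q, N.\<close>
    proof (rule that[of 2 1 "-1" "2 * e" "nat (- D)"])
      show "1 * - 1 - 2 * e * 2 = int (nat (- D))" using neg e by simp
      have "\<bar>D\<bar> \<noteq> 1" using neg 1 by auto
      thus "nat (- D) \<noteq> k * k" for k using squarefree_not_square[OF 1(2)] neg by (simp add: abs_if)
      have "w * w = 4 * of_int e + 1" using w2 e by simp
      thus "of_int 1 * cm_point D + of_int (2 * e) = cm_point D * (of_int 2 * cm_point D + of_int (- 1))"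
        unfolding cm by (simp add: field_simps)
    qed (use neg in auto)
  next
    case (2 m)
    have m: "m < 0" using 2 neg by simp
    define u where "u = w / 2"
    have u2: "u * u = of_int m" using w2 2 by (simp add: u_def)
    have cm: "cm_point D = u" using 2 by (simp add: cm_point_def w_def u_def)
    show ?thesis
    proof (cases "m = - 1")
      case False
      show ?thesis
      \<comment> \<open>Multiplication by z = sqrt m itself, of norm -m.\<close>
      proof (rule that[of 1 0 0 m "nat (- m)"])
        show "0 * 0 - m * 1 = int (nat (- m))" using m by simp
        have "\<bar>m\<bar> \<noteq> 1" using m False by auto
        thus "nat (- m) \<noteq> k * k" for k using squarefree_not_square[OF 2(3)] m by (simp add: abs_if)
        show "of_int 0 * cm_point D + of_int m = cm_point D * (of_int 1 * cm_point D + of_int 0)"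
          by (simp add: cm u2)
      qed (use m in auto)
    next
      case True
      show ?thesis
      \<comment> \<open>For z = i the norm of z is the square 1; 1 + i of norm 2 is used
        instead.\<close>
      proof (rule that[of 1 1 1 "- 1" 2])
        show "2 \<noteq> k * k" for k :: nat
        proof
          assume k: "2 = k * k"
          show False
          proof (cases "k \<le> 1")
            case True
            thus False using k by (cases k) auto
          next
            case False
            hence "2 * 2 \<le> k * k" by (intro mult_le_mono) auto
            thus False using k by simp
          qed
        qed
        show "of_int 1 * cm_point D + of_int (- 1) = cm_point D * (of_int 1 * cm_point D + of_int 1)"
          using u2 True by (simp add: cm distrib_left)
      qed auto
    qed
  qed
qed

section \<open>Ramanujan's system on the disc and the Taylor coefficients\<close>

lemma exists_complex_root: "k > 0 \<Longrightarrow> \<exists>y::complex. y ^ k = x"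
  by (cases "x = 0") (auto intro: exI[of _ "exp (Ln x / of_nat k)"] exI[of _ 0] simp: exp_of_nat_mult[symmetric])

lemma algebraic_of_power:
  fixes x :: complex
  assumes "algebraic (x ^ k)" "k > 0"
  shows "algebraic x"
proof (rule algebraic_poly_root[of "monom 1 k - [:x ^ k:]"])
  have "coeff (monom 1 k - [:x ^ k:]) k = 1" using assms(2) by (cases k) (simp_all add: coeff_pCons)
  thus "monom 1 k - [:x ^ k:] \<noteq> 0" by (metis coeff_0 zero_neq_one)
  show "algebraic (coeff (monom 1 k - [:x ^ k:]) i)" for i
    unfolding coeff_diff coeff_monom coeff_pCons
    by (rule algebraic_diff) (auto split: nat.splits intro: assms(1))
qed (simp add: poly_monom)

text \<open>The quotient rule for a form pulled back to the disc over \<open>v ^ k\<close>,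
  \<open>v = 1 - w\<close>; the last summand, from the automorphy factor, is what the extra term in
  P has to absorb.\<close>

lemma deriv_over_power_eq:
  fixes v c0 :: complex
  assumes "v \<noteq> 0" "k > 0"
  shows "(X / v\<^sup>2 / c0 * v ^ k - b * (- (of_nat k * v ^ (k - 1)))) / (v ^ k * v ^ k)
    = X / (v\<^sup>2 * v ^ k) / c0 + of_nat k * (b / v ^ k) / v"
proof -
  obtain m where m: "k = Suc m" using assms(2) by (cases k) auto
  define u where "u = v ^ m"
  have u: "u \<noteq> 0" using assms by (simp add: u_def)
  have "v ^ k = v * u" by (simp add: m u_def)
  moreover have "v ^ (k - 1) = u" by (simp add: m u_def)
  ultimately show ?thesis using assms(1) u by (cases "c0 = 0") (simp_all add: field_simps)
qed

text \<open>Verification of the four equations, in order F, P, Q, R, with v = 1 - w,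
  \<open>v2\<close> its square, \<open>u\<close> the power of v belonging to the weight, and p, q
  the powers of the period by which P and Q (or R) are divided.\<close>

lemma ramanujan_system_rescale:
  fixes p q c0 v v2 u e f g \<kappa> :: complex
  assumes "p \<noteq> 0" "q \<noteq> 0" "c0 \<noteq> 0" "v \<noteq> 0" "v2 \<noteq> 0" "u \<noteq> 0"
  shows "\<kappa> * (e * f / (v2 * u) / c0 + of_nat 12 * (f / u) / v)
      = (e / v2 + 12 * c0 / v) / p * (\<kappa> * (f / u)) / (c0 / p)"
    "((e\<^sup>2 - f) / 12 / (v2 * v2) / c0 + of_nat 2 * (e / v2) / v + 12 * c0 / (v * v)) / p
      = (((e / v2 + 12 * c0 / v) / p)\<^sup>2 - f / (v2 * v2) / (p * p)) / 12 / (c0 / p)"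
    "((e * f - g) / 3 / (v2 * u) / c0 + of_nat 4 * (f / u) / v) / q
      = ((e / v2 + 12 * c0 / v) / p * (f / u / q) - g / (v2 * u) / (p * q)) / 3 / (c0 / p)"
    "((e * f - g) / 2 / (v2 * u) / c0 + of_nat 6 * (f / u) / v) / q
      = ((e / v2 + 12 * c0 / v) / p * (f / u / q) - g / (v2 * u) / (p * q)) / 2 / (c0 / p)"
  using assms by (simp_all add: field_simps power2_eq_square)

lemma taylor_coeff_Delta_vz_poly:
  assumes z0: "Im z0 > 0" and j: "algebraic (modular_j z0)"
    and e2: "algebraic ((eisenstein_E2 z0 - 3 / of_real (pi * Im z0)) ^ 6 / Ramanujan_Delta z0)"
  obtains c \<kappa> a1 a2 a3 a4 where "c \<noteq> 0" "\<kappa> \<noteq> 0"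
    "\<And>i. algebraic (coeff a1 i)" "\<And>i. algebraic (coeff a2 i)"
    "\<And>i. algebraic (coeff a3 i)" "\<And>i. algebraic (coeff a4 i)"
    "\<And>n. taylor_coeff 12 z0 Ramanujan_Delta n = \<kappa> * poly (vz_poly a1 a2 a3 a4 n) 0 / c ^ n / fact n"
proof -
  define y where "y = Im z0"
  have y: "y > 0" using z0 by (simp add: y_def)
  obtain \<Omega> where \<Omega>: "\<Omega> ^ 12 = Ramanujan_Delta z0" using exists_complex_root[of 12 "Ramanujan_Delta z0"] by auto
  have D0: "Ramanujan_Delta z0 \<noteq> 0" by (rule Ramanujan_Delta_nonzero[OF z0])
  have \<Omega>0: "\<Omega> \<noteq> 0" using \<Omega> D0 by auto
  define S where "S = ball (0 :: complex) 1"
  define \<sigma> where "\<sigma> = (\<lambda>w. (z0 - cnj z0 * w) / (1 - w))"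
  define F where "F = slash 12 Ramanujan_Delta (disc_to_halfplane z0)"
  \<comment> \<open>c0 is 1/((2 pi i) (2 i y)): the first factor belongs to the derivation with
    respect to log q, the second to the derivative of \<open>\<sigma>\<close>.\<close>
  define c0 where "c0 = - 1 / (4 * of_real pi * of_real y :: complex)"
  define c where "c = c0 / \<Omega>\<^sup>2"
  \<comment> \<open>The summand \<open>12 * c0 / (1 - w)\<close> makes P/c the logarithmic
    derivative of F; at w = 0 it is -3/(pi y).\<close>
  define P where "P = (\<lambda>w. (eisenstein_E2 (\<sigma> w) / (1 - w)\<^sup>2 + 12 * c0 / (1 - w)) / \<Omega>\<^sup>2)"
  define Q where "Q = (\<lambda>w. eisenstein_E4 (\<sigma> w) / (1 - w) ^ 4 / \<Omega> ^ 4)"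
  define R where "R = (\<lambda>w. eisenstein_E6 (\<sigma> w) / (1 - w) ^ 6 / \<Omega> ^ 6)"
  have c0: "c0 \<noteq> 0" using y by (simp add: c0_def)
  have c: "c \<noteq> 0" using c0 \<Omega>0 by (simp add: c_def)
  have I: "Im (\<sigma> w) > 0" if "w \<in> S" for w
    unfolding \<sigma>_def using Im_moebius_disc_pos[OF z0, of w] that by (simp add: S_def)
  have w1: "1 - w \<noteq> 0" if "w \<in> S" for w using that by (auto simp: S_def)
  have zz: "z0 - cnj z0 = 2 * \<i> * of_real y" by (simp add: complex_eq_iff y_def)
  have d\<sigma>: "(\<sigma> has_field_derivative 2 * \<i> * of_real y / (1 - w)\<^sup>2) (at w)" if "w \<in> S" for w
  proof -
    have "(\<sigma> has_field_derivative ((- cnj z0) * (1 - w) - (z0 - cnj z0 * w) * (- 1)) / ((1 - w) * (1 - w))) (at w)"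
      unfolding \<sigma>_def using w1[OF that] by (auto intro!: derivative_eq_intros)
    also have "(- cnj z0) * (1 - w) - (z0 - cnj z0 * w) * (- 1) = z0 - cnj z0" by (simp add: algebra_simps)
    finally show ?thesis unfolding zz power2_eq_square .
  qed
  have c0': "2 * of_real pi * \<i> * X * (2 * \<i> * of_real y / v) = X / v / c0" for X v
    by (simp add: c0_def divide_simps)
  have d1: "((\<lambda>w. (1 - w) ^ k) has_field_derivative - (of_nat k * (1 - w) ^ (k - 1))) (at w)" for k w
    by (auto intro!: derivative_eq_intros)
  define K where "K = Determinants.det (disc_to_halfplane z0) powi 6 * (2 * \<i> * of_real y) ^ 12"
  have FK: "F w = K * (Ramanujan_Delta (\<sigma> w) / (1 - w) ^ 12)" if "w \<in> S" for w
  proof -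
    have "F w = Determinants.det (disc_to_halfplane z0) powi 6 * Ramanujan_Delta (\<sigma> w) * ((1 - w) / (2 * \<i> * of_real y)) powi (- 12)"
      unfolding F_def slash_def moebius_disc_to_halfplane[OF z0] \<sigma>_def
      by (simp add: diff_divide_distrib y_def)
    also have "((1 - w) / (2 * \<i> * of_real y)) powi (- 12) = (2 * \<i> * of_real y) ^ 12 / (1 - w) ^ 12"
      by (simp add: power_int_minus power_divide)
    finally show ?thesis by (simp add: K_def)
  qed
  have dF: "(F has_field_derivative P w * F w / c) (at w)" if w: "w \<in> S" for w
  proof -
    have "((\<lambda>w. K * (Ramanujan_Delta (\<sigma> w) / (1 - w) ^ 12)) has_field_derivative
       K * ((2 * of_real pi * \<i> * eisenstein_E2 (\<sigma> w) * Ramanujan_Delta (\<sigma> w) * (2 * \<i> * of_real y / (1 - w)\<^sup>2) * (1 - w) ^ 12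
       - Ramanujan_Delta (\<sigma> w) * (- (of_nat 12 * (1 - w) ^ (12 - 1)))) / ((1 - w) ^ 12 * (1 - w) ^ 12))) (at w)"
      using w1[OF w] by (intro DERIV_cmult DERIV_divide d1 DERIV_chain2[where f = Ramanujan_Delta, OF has_field_derivative_Ramanujan_Delta[OF I[OF w]] d\<sigma>[OF w]]) simp
    also have "K * ((2 * of_real pi * \<i> * eisenstein_E2 (\<sigma> w) * Ramanujan_Delta (\<sigma> w) * (2 * \<i> * of_real y / (1 - w)\<^sup>2) * (1 - w) ^ 12
       - Ramanujan_Delta (\<sigma> w) * (- (of_nat 12 * (1 - w) ^ (12 - 1)))) / ((1 - w) ^ 12 * (1 - w) ^ 12)) = P w * F w / c"
    proof -
      define v where "v = 1 - w"
      have v: "v \<noteq> 0" using w1[OF w] by (simp add: v_def)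
      have X: "2 * of_real pi * \<i> * eisenstein_E2 (\<sigma> w) * Ramanujan_Delta (\<sigma> w) * (2 * \<i> * of_real y / v\<^sup>2)
          = eisenstein_E2 (\<sigma> w) * Ramanujan_Delta (\<sigma> w) / v\<^sup>2 / c0"
        using c0'[of "eisenstein_E2 (\<sigma> w) * Ramanujan_Delta (\<sigma> w)" "v\<^sup>2"] by (simp only: mult.assoc)
      show ?thesis
        unfolding FK[OF w] P_def c_def v_def[symmetric] X deriv_over_power_eq[OF v, of 12, OF zero_less_numeral]
        by (rule ramanujan_system_rescale) (use v \<Omega>0 c0 in simp_all)
    qed
    finally show ?thesis
      by (rule has_field_derivative_transform_within_open[where S = S]) (use w FK in \<open>auto simp: S_def\<close>)
  qed
  have dP: "(P has_field_derivative ((P w)\<^sup>2 - Q w) / 12 / c) (at w)" if w: "w \<in> S" for w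
  proof -
    define v where "v = 1 - w"
    have v: "v \<noteq> 0" using w1[OF w] by (simp add: v_def)
    have pP: "v ^ 4 = v\<^sup>2 * v\<^sup>2" "\<Omega> ^ 4 = \<Omega>\<^sup>2 * \<Omega>\<^sup>2" "0 * v - 12 * c0 * - 1 = 12 * c0" by (simp_all flip: power_add)
    let ?E2 = "eisenstein_E2 (\<sigma> w)" and ?E4 = "eisenstein_E4 (\<sigma> w)"
    have "(P has_field_derivative
       ((2 * of_real pi * \<i> * ((?E2\<^sup>2 - ?E4) / 12) * (2 * \<i> * of_real y / (1 - w)\<^sup>2) * (1 - w)\<^sup>2
         - ?E2 * (- (of_nat 2 * (1 - w) ^ (2 - 1)))) / ((1 - w)\<^sup>2 * (1 - w)\<^sup>2)
        + (0 * (1 - w) - 12 * c0 * (- 1)) / ((1 - w) * (1 - w))) / \<Omega>\<^sup>2) (at w)"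
      unfolding P_def using w1[OF w]
      by (intro DERIV_cdivide DERIV_add DERIV_divide d1 DERIV_chain2[where f = eisenstein_E2, OF has_field_derivative_E2[OF I[OF w]] d\<sigma>[OF w]] DERIV_const)
        (auto intro!: derivative_eq_intros)
    also have "((2 * of_real pi * \<i> * ((?E2\<^sup>2 - ?E4) / 12) * (2 * \<i> * of_real y / (1 - w)\<^sup>2) * (1 - w)\<^sup>2
         - ?E2 * (- (of_nat 2 * (1 - w) ^ (2 - 1)))) / ((1 - w)\<^sup>2 * (1 - w)\<^sup>2)
        + (0 * (1 - w) - 12 * c0 * (- 1)) / ((1 - w) * (1 - w))) / \<Omega>\<^sup>2 = ((P w)\<^sup>2 - Q w) / 12 / c"
      unfolding c0' P_def Q_def c_def v_def[symmetric] deriv_over_power_eq[OF v, OF zero_less_numeral] pP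
      by (rule ramanujan_system_rescale) (use v \<Omega>0 c0 in simp_all)
    finally show ?thesis .
  qed
  have dQ: "(Q has_field_derivative (P w * Q w - R w) / 3 / c) (at w)" if w: "w \<in> S" for w
  proof -
    define v where "v = 1 - w"
    have v: "v \<noteq> 0" using w1[OF w] by (simp add: v_def)
    have pQ: "v ^ 6 = v\<^sup>2 * v ^ 4" "\<Omega> ^ 6 = \<Omega>\<^sup>2 * \<Omega> ^ 4" by (simp_all flip: power_add)
    let ?E2 = "eisenstein_E2 (\<sigma> w)" and ?E4 = "eisenstein_E4 (\<sigma> w)" and ?E6 = "eisenstein_E6 (\<sigma> w)"
    have "(Q has_field_derivative
       (2 * of_real pi * \<i> * ((?E2 * ?E4 - ?E6) / 3) * (2 * \<i> * of_real y / (1 - w)\<^sup>2) * (1 - w) ^ 4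
         - ?E4 * (- (of_nat 4 * (1 - w) ^ (4 - 1)))) / ((1 - w) ^ 4 * (1 - w) ^ 4) / \<Omega> ^ 4) (at w)"
      unfolding Q_def using w1[OF w]
      by (intro DERIV_cdivide DERIV_divide d1 DERIV_chain2[where f = eisenstein_E4, OF has_field_derivative_E4[OF I[OF w]] d\<sigma>[OF w]]) simp
    also have "(2 * of_real pi * \<i> * ((?E2 * ?E4 - ?E6) / 3) * (2 * \<i> * of_real y / (1 - w)\<^sup>2) * (1 - w) ^ 4
         - ?E4 * (- (of_nat 4 * (1 - w) ^ (4 - 1)))) / ((1 - w) ^ 4 * (1 - w) ^ 4) / \<Omega> ^ 4 = (P w * Q w - R w) / 3 / c"
      unfolding c0' P_def Q_def R_def c_def v_def[symmetric] deriv_over_power_eq[OF v, OF zero_less_numeral] pQ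
      by (rule ramanujan_system_rescale) (use v \<Omega>0 c0 in simp_all)
    finally show ?thesis .
  qed
  have dR: "(R has_field_derivative (P w * R w - (Q w)\<^sup>2) / 2 / c) (at w)" if w: "w \<in> S" for w
  proof -
    define v where "v = 1 - w"
    have v: "v \<noteq> 0" using w1[OF w] by (simp add: v_def)
    let ?E2 = "eisenstein_E2 (\<sigma> w)" and ?E4 = "eisenstein_E4 (\<sigma> w)" and ?E6 = "eisenstein_E6 (\<sigma> w)"
    have pR: "(?E4 / v ^ 4 / \<Omega> ^ 4)\<^sup>2 = ?E4\<^sup>2 / (v\<^sup>2 * v ^ 6) / (\<Omega>\<^sup>2 * \<Omega> ^ 6)"
      by (simp add: power_divide power_mult_distrib flip: power_add power_mult)
    have "(R has_field_derivative
       (2 * of_real pi * \<i> * ((?E2 * ?E6 - ?E4\<^sup>2) / 2) * (2 * \<i> * of_real y / (1 - w)\<^sup>2) * (1 - w) ^ 6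
         - ?E6 * (- (of_nat 6 * (1 - w) ^ (6 - 1)))) / ((1 - w) ^ 6 * (1 - w) ^ 6) / \<Omega> ^ 6) (at w)"
      unfolding R_def using w1[OF w]
      by (intro DERIV_cdivide DERIV_divide d1 DERIV_chain2[where f = eisenstein_E6, OF has_field_derivative_E6[OF I[OF w]] d\<sigma>[OF w]]) simp
    also have "(2 * of_real pi * \<i> * ((?E2 * ?E6 - ?E4\<^sup>2) / 2) * (2 * \<i> * of_real y / (1 - w)\<^sup>2) * (1 - w) ^ 6
         - ?E6 * (- (of_nat 6 * (1 - w) ^ (6 - 1)))) / ((1 - w) ^ 6 * (1 - w) ^ 6) / \<Omega> ^ 6 = (P w * R w - (Q w)\<^sup>2) / 2 / c"
      unfolding c0' P_def Q_def R_def c_def v_def[symmetric] deriv_over_power_eq[OF v, OF zero_less_numeral] pR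
      by (rule ramanujan_system_rescale) (use v \<Omega>0 c0 in simp_all)
    finally show ?thesis .
  qed
  have \<sigma>0: "\<sigma> 0 = z0" by (simp add: \<sigma>_def)
  have P0: "P 0 = (eisenstein_E2 z0 - 3 / of_real (pi * Im z0)) / \<Omega>\<^sup>2"
    using y by (simp add: P_def \<sigma>0 c0_def y_def)
  have Q0: "Q 0 = eisenstein_E4 z0 / \<Omega> ^ 4" and R0: "R 0 = eisenstein_E6 z0 / \<Omega> ^ 6"
    by (simp_all add: Q_def R_def \<sigma>0)
  \<comment> \<open>The sixth power of P(0) is the given algebraic number, the cube of Q(0) is j and
    the square of R(0) is j - 1728.\<close>
  have \<Omega>p: "(\<Omega>\<^sup>2) ^ 6 = Ramanujan_Delta z0" "(\<Omega> ^ 4) ^ 3 = Ramanujan_Delta z0" "(\<Omega> ^ 6)\<^sup>2 = Ramanujan_Delta z0"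
    unfolding \<Omega>[symmetric] by (simp_all flip: power_mult)
  have aP: "algebraic (P 0)"
    by (rule algebraic_of_power[of _ 6], unfold P0 power_divide \<Omega>p, rule e2) simp
  have aQ: "algebraic (Q 0)"
    by (rule algebraic_of_power[of _ 3], unfold Q0 power_divide \<Omega>p, rule j[unfolded modular_j_def]) simp
  have rel: "eisenstein_E6 z0 ^ 2 = eisenstein_E4 z0 ^ 3 - 1728 * Ramanujan_Delta z0"
    using E4_cubed_minus_E6_squared[OF z0] by (simp add: algebra_simps)
  have aR: "algebraic (R 0)"
  proof (rule algebraic_of_power[of _ 2])
    have "R 0 ^ 2 = modular_j z0 - 1728"
      unfolding R0 power_divide \<Omega>p rel modular_j_def using D0 by (simp add: diff_divide_distrib)
    thus "algebraic (R 0 ^ 2)" using algebraic_diff[OF j, of 1728] by simp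
  qed simp
  have nz: "Q 0 \<noteq> 0 \<or> R 0 \<noteq> 0" using rel D0 \<Omega>0 by (auto simp: Q0 R0)
  have S: "open S" "0 \<in> S" by (simp_all add: S_def)
  obtain a1 a2 a3 a4 where a:
    "\<And>i. algebraic (coeff a1 i)" "\<And>i. algebraic (coeff a2 i)" "\<And>i. algebraic (coeff a3 i)" "\<And>i. algebraic (coeff a4 i)"
    "\<And>n. (deriv ^^ n) F 0 = F 0 * poly (vz_poly a1 a2 a3 a4 n) 0 / c ^ n"
    using ramanujan_system_vz_poly[OF S c dF dP dQ dR nz aP aQ aR] by blast
  have "Determinants.det (disc_to_halfplane z0) \<noteq> 0"
  proof -
    have "Determinants.det (disc_to_halfplane z0) = 1 / (2 * \<i> * of_real y)"
      using y zz unfolding det_2 by (simp add: y_def[symmetric] divide_simps)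
    thus ?thesis using y by simp
  qed
  hence "F 0 \<noteq> 0" using FK[OF S(2)] D0 y by (simp add: \<sigma>0 K_def)
  moreover have "taylor_coeff 12 z0 Ramanujan_Delta n = F 0 * poly (vz_poly a1 a2 a3 a4 n) 0 / c ^ n / fact n" for n
    unfolding taylor_coeff_def F_def[symmetric] fps_expansion_def by (simp add: a(5))
  ultimately show ?thesis using that[of c "F 0" a1 a2 a3 a4] c a by blast
qed

theorem theorem1p2:
  fixes D :: int
  assumes "neg_fundamental_discriminant D"
  shows "\<exists>(K :: complex set) (\<kappa> :: complex) (\<mu> :: complex)
            (a1 :: complex poly) (a2 :: complex poly) (a3 :: complex poly) (a4 :: complex poly)
            (q :: nat \<Rightarrow> complex poly).
           number_field K \<and> \<kappa> \<noteq> 0 \<and> \<mu> \<noteq> 0 \<and>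
           {a1, a2, a3, a4} \<subseteq> polys_over (ring_of_integers K) \<and>
           (\<forall>m. q m \<in> polys_over (ring_of_integers K)) \<and>
           q 0 = 1 \<and> q 1 = a1 \<and>
           (\<forall>n\<ge>1. q (n + 1) = (a1 + of_nat n * a2) * q n + a3 * pderiv (q n)
                               + of_nat (n * (n + 11)) * a4 * q (n - 1)) \<and>
           (\<forall>m. taylor_coeff 12 (cm_point D) Ramanujan_Delta m
                  = \<kappa> * \<mu> ^ m / fact m * poly (q m) 0)"
proof -
  have z0: "Im (cm_point D) > 0"
    using assms by (intro Im_cm_point_pos) (simp add: neg_fundamental_discriminant_def)
  obtain p q r s N where M: "r \<noteq> 0" "p * s - q * r = int N" "N > 0" "\<And>k. N \<noteq> k * k"
    "of_int p * cm_point D + of_int q = cm_point D * (of_int r * cm_point D + of_int s)"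
    by (rule cm_point_matrix[OF assms]) (rule that)
  obtain c \<kappa> b1 b2 b3 b4 where c: "c \<noteq> 0" "\<kappa> \<noteq> 0"
    and b: "\<And>i. algebraic (coeff b1 i)" "\<And>i. algebraic (coeff b2 i)" "\<And>i. algebraic (coeff b3 i)" "\<And>i. algebraic (coeff b4 i)"
    and tc: "\<And>n. taylor_coeff 12 (cm_point D) Ramanujan_Delta n = \<kappa> * poly (vz_poly b1 b2 b3 b4 n) 0 / c ^ n / fact n"
  proof (rule taylor_coeff_Delta_vz_poly[OF z0 cm_algebraic[OF z0 M]])
    fix c \<kappa> b1 b2 b3 b4
    assume *: "c \<noteq> 0" "\<kappa> \<noteq> 0" "\<And>i. algebraic (coeff b1 i)" "\<And>i. algebraic (coeff b2 i)"
      "\<And>i. algebraic (coeff b3 i)" "\<And>i. algebraic (coeff b4 i)"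
      "\<And>n. taylor_coeff 12 (cm_point D) Ramanujan_Delta n = \<kappa> * poly (vz_poly b1 b2 b3 b4 n) 0 / c ^ n / fact n"
    show thesis by (rule that[OF *])
  qed
  \<comment> \<open>Finitely many algebraic numbers: they generate the field K and have a common
    denominator.\<close>
  define C where "C = (\<Union>b\<in>{b1, b2, b3, b4}. coeff b ` {..degree b})"
  have finC: "finite C" by (simp add: C_def)
  have "\<forall>x\<in>C. algebraic x" by (simp add: C_def ball_Un b)
  hence algC: "algebraic x" if "x \<in> C" for x using that by (rule bspec)
  have "\<exists>K. number_field K \<and> C \<subseteq> K"
    by (rule finite_algebraic_number_field[OF finC algC])
  then obtain K where K: "number_field K" "C \<subseteq> K" by (elim exE conjE)
  have "\<exists>n::int. n > 0 \<and> (\<forall>x\<in>C. algebraic_int (of_int n * x))"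
    by (rule finite_algebraic_common_denominator[OF finC algC])
  then obtain n where n0: "n > 0 \<and> (\<forall>x\<in>C. algebraic_int (of_int n * x))" by (elim exE)
  have n: "n > 0" "\<And>x. x \<in> C \<Longrightarrow> algebraic_int (of_int n * x)" using n0 by blast+
  define s where "s = complex_of_int n"
  have s0: "s \<noteq> 0" using n by (simp add: s_def)
  have sK: "s \<in> K" using number_field_closed(10)[OF K(1), of "of_int n"] by (simp add: s_def)
  have s_int: "algebraic_int s" unfolding s_def by (intro int_imp_algebraic_int) simp
  have O0: "0 \<in> ring_of_integers K" using number_field_closed(1)[OF K(1)] by (simp add: ring_of_integers_def)
  have sb: "s * coeff b i \<in> ring_of_integers K" if "b \<in> {b1, b2, b3, b4}" for b i
  proof (cases "i \<le> degree b")
    case True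
    hence "coeff b i \<in> C" using that unfolding C_def by blast
    hence "coeff b i \<in> K" "algebraic_int (s * coeff b i)" using n(2) K(2) by (auto simp: s_def)
    thus ?thesis using number_field_closed(5)[OF K(1) sK] by (simp add: ring_of_integers_def)
  qed (use O0 in \<open>simp add: coeff_eq_0\<close>)
  \<comment> \<open>The weights of \<open>vz_poly_smult\<close>: one factor s for each of the first
    three, two for \<open>a4\<close>.\<close>
  define a1 where "a1 = Polynomial.smult s b1"
  define a2 where "a2 = Polynomial.smult s b2"
  define a3 where "a3 = Polynomial.smult s b3"
  define a4 where "a4 = Polynomial.smult (s\<^sup>2) b4"
  have "a1 \<in> polys_over (ring_of_integers K)" "a2 \<in> polys_over (ring_of_integers K)" "a3 \<in> polys_over (ring_of_integers K)"
    using sb by (auto simp: polys_over_def a1_def a2_def a3_def)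
  moreover have "a4 \<in> polys_over (ring_of_integers K)"
  proof -
    have "s * (s * coeff b4 i) \<in> ring_of_integers K" for i
      using sb[of b4 i] number_field_closed(5)[OF K(1) sK] algebraic_int_mult[OF s_int]
      by (simp add: ring_of_integers_def)
    thus ?thesis by (simp add: polys_over_def a4_def power2_eq_square mult.assoc)
  qed
  ultimately have a: "{a1, a2, a3, a4} \<subseteq> polys_over (ring_of_integers K)" by simp
  define Q where "Q = vz_poly a1 a2 a3 a4"
  have Q_int: "Q m \<in> polys_over (ring_of_integers K)" for m
    unfolding Q_def by (rule polys_over_vz_poly[OF K(1) a])
  have Q_Suc: "Q (n + 1) = (a1 + of_nat n * a2) * Q n + a3 * pderiv (Q n) + of_nat (n * (n + 11)) * a4 * Q (n - 1)" for n
    unfolding Q_def Suc_eq_plus1[symmetric] by (rule vz_poly_Suc)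
  \<comment> \<open>The factor \<open>s ^ m\<close> gained by the polynomials is taken back by the
    power of \<open>1 / (c * s)\<close>, which is the constant lambda of the theorem.\<close>
  have Q_taylor: "taylor_coeff 12 (cm_point D) Ramanujan_Delta m = \<kappa> * (1 / (c * s)) ^ m / fact m * poly (Q m) 0" for m
    unfolding Q_def a1_def a2_def a3_def a4_def vz_poly_smult tc
    using c s0 by (simp add: power_divide power_mult_distrib)
  have init: "1 / (c * s) \<noteq> 0" "Q 0 = 1" "Q 1 = a1" using c s0 by (simp_all add: Q_def)
  show ?thesis
    by (rule exI[of _ K], rule exI[of _ \<kappa>], rule exI[of _ "1 / (c * s)"], rule exI[of _ a1], rule exI[of _ a2],
        rule exI[of _ a3], rule exI[of _ a4], rule exI[of _ Q], intro conjI allI impI)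
      (rule K(1) c(2) init a Q_int Q_Suc Q_taylor)+
qed

end
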